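(* Let $F$ be a reversible Finsler metric on the $2$-torus $\mathbb{T}^2=\mathbb{R}^2/\mathbb{Z}^2$. Then $$\operatorname{area}_{BH}(\mathbb{T}^2,F)\;\geq\;\frac{\pi}{4}\,\operatorname{sys}(\mathbb{T}^2,F)^2 .$$ This inequality is optimal (the constant $\pi/4$ cannot be improved): equality holds for the flat Finsler metric on $\mathbb{T}^2$ induced by the supremum norm $\|\cdot\|_\infty$ on $\mathbb{R}^2$.
   Context: A (continuous) Finsler metric on $\mathbb{T}^2=\mathbb{R}^2/\mathbb{Z}^2$ is a continuous function $F:T\mathbb{T}^2\to[0,\infty)$ whose restriction to each tangent space $T_x\mathbb{T}^2$ is a possibly non-symmetric norm, i.e. a function that is positive outside the origin, convex and positively homogeneous. It is reversible if each of these norms is symmetric, i.e. $F(x,-v)=F(x,v)$ for all $x,v$. Let $\pi:\mathbb{R}^2\to\mathbb{T}^2$ be the quotient map and $\tilde F(\tilde x,\tilde v)=F(\pi(\tilde x),d_{\tilde x}\pi(\tilde v))$ the induced $\mathbb{Z}^2$-periodic Finsler metric on $\mathbb{R}^2$. Identifying $T_{\tilde x}\mathbb{R}^2$ with $\mathbb{R}^2$, put $\widetilde K_{\tilde x}=\{v\in\mathbb{R}^2 : \tilde F(\tilde x,v)\le 1\}$, a convex body containing the origin in its interior. A norm $\|\cdot\|$ on $\mathbb{R}^2$ induces the flat Finsler metric on $\mathbb{T}^2$ whose lift is $\tilde F(\tilde x,v)=\|v\|$ for all $\tilde x$. The Busemann-Hausdorff area is $$\operatorname{area}_{BH}(\mathbb{T}^2,F)=\int_{[0,1]^2}\frac{\pi}{|\widetilde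 K_{\tilde x}|}\,d\tilde x_1\,d\tilde x_2,$$ where $|\cdot|$ is Lebesgue measure on $\mathbb{R}^2$ and, in the integrand, $\pi$ is the number $3.14\ldots$ The length of a piecewise smooth curve $\gamma:[a,b]\to\mathbb{T}^2$ is $\ell_F(\gamma)=\int_a^b F(\gamma(t),\dot\gamma(t))\,dt$, and the systole is $$\operatorname{sys}(\mathbb{T}^2,F)=\inf\{\ell_F(\gamma) : \gamma \text{ a non-contractible (piecewise smooth) closed curve in } \mathbb{T}^2\}.$$ *)

theory Defs
  imports "HOL-Analysis.Analysis"
begin

quotient_type torus = "real ^ 2" / "\<lambda>x y. \<forall>i. x $ i - y $ i \<in> \<int>"
proof (rule equivpI)
  show "reflp (\<lambda>x y :: real ^ 2. \<forall>i. x $ i - y $ i \<in> \<int>)"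
    by (simp add: reflp_def)
  show "symp (\<lambda>x y :: real ^ 2. \<forall>i. x $ i - y $ i \<in> \<int>)"
    by (intro sympI allI) (metis Ints_minus minus_diff_eq)
  show "transp (\<lambda>x y :: real ^ 2. \<forall>i. x $ i - y $ i \<in> \<int>)"
  proof (rule transpI, rule allI)
    fix x y z :: "real ^ 2" and i
    assume "\<forall>i. x $ i - y $ i \<in> \<int>" "\<forall>i. y $ i - z $ i \<in> \<int>"
    then have "(x $ i - y $ i) + (y $ i - z $ i) \<in> \<int>"
      by (intro Ints_add) auto
    then show "x $ i - z $ i \<in> \<int>" by simp
  qed
qed

definition torus_proj :: "real ^ 2 \<Rightarrow> torus" where
  "torus_proj = abs_torus"

lemma torus_proj_eq_iff: "torus_proj x = torus_proj y \<longleftrightarrow> (\<forall>i. x $ i - y $ i \<in> \<int>)"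
  unfolding torus_proj_def by (rule torus.abs_eq_iff)

instantiation torus :: topological_space
begin

text \<open>The quotient topology.\<close>

definition open_torus :: "torus set \<Rightarrow> bool" where
  "open_torus U \<longleftrightarrow> open (torus_proj -` U)"

instance
proof
  show "open (UNIV :: torus set)" by (simp add: open_torus_def)
  show "open (S \<inter> T)" if "open S" "open T" for S T :: "torus set"
    using that by (simp add: open_torus_def open_Int)
  show "open (\<Union>K)" if "\<forall>S\<in>K. open S" for K :: "torus set set"
    using that by (auto simp: open_torus_def vimage_Union)
qed

end

text \<open>The deck transformations of \<^term>\<open>torus_proj\<close> are translations, so its differential
  identifies every tangent space of the torus with \<^typ>\<open>real ^ 2\<close>, and the tangent bundle with
  \<^typ>\<open>torus \<times> (real ^ 2)\<close>. In this trivialization the lift of a metric \<open>F\<close> to the plane is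
  \<open>\<lambda>x v. F (torus_proj x) v\<close>.\<close>

definition nonsym_norm :: "(real ^ 2 \<Rightarrow> real) \<Rightarrow> bool" where
  "nonsym_norm p \<longleftrightarrow>
     (\<forall>v. v \<noteq> 0 \<longrightarrow> p v > 0) \<and> convex_on UNIV p \<and> (\<forall>c\<ge>0. \<forall>v. p (c *\<^sub>R v) = c * p v)"

definition finsler_metric :: "(torus \<Rightarrow> real ^ 2 \<Rightarrow> real) \<Rightarrow> bool" where
  "finsler_metric F \<longleftrightarrow>
     continuous_on UNIV (\<lambda>(x, v). F x v) \<and> (\<forall>x. nonsym_norm (F x))"

definition reversible :: "(torus \<Rightarrow> real ^ 2 \<Rightarrow> real) \<Rightarrow> bool" where
  "reversible F \<longleftrightarrow> (\<forall>x v. F x (- v) = F x v)"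

definition flat_metric :: "(real ^ 2 \<Rightarrow> real) \<Rightarrow> torus \<Rightarrow> real ^ 2 \<Rightarrow> real" where
  "flat_metric N = (\<lambda>_. N)"

definition finsler_lift :: "(torus \<Rightarrow> real ^ 2 \<Rightarrow> real) \<Rightarrow> real ^ 2 \<Rightarrow> real ^ 2 \<Rightarrow> real" where
  "finsler_lift F x v = F (torus_proj x) v"

definition unit_body :: "(torus \<Rightarrow> real ^ 2 \<Rightarrow> real) \<Rightarrow> real ^ 2 \<Rightarrow> (real ^ 2) set" where
  "unit_body F x = {v. finsler_lift F x v \<le> 1}"

definition area_BH :: "(torus \<Rightarrow> real ^ 2 \<Rightarrow> real) \<Rightarrow> real" where
  "area_BH F = integral (cbox 0 1) (\<lambda>x. pi / measure lebesgue (unit_body F x))"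

text \<open>Class \<open>C\<^sup>\<infinity>\<close> on the compact interval, with one-sided derivatives at its end points;
  \<open>D k\<close> is the \<open>k\<close>-th derivative.\<close>

definition smooth_curve :: "real \<Rightarrow> real \<Rightarrow> (real \<Rightarrow> real ^ 2) \<Rightarrow> bool" where
  "smooth_curve a b g \<longleftrightarrow>
     (\<exists>D :: nat \<Rightarrow> real \<Rightarrow> real ^ 2. D 0 = g \<and>
        (\<forall>k. \<forall>t\<in>{a..b}. (D k has_vector_derivative D (Suc k) t) (at t within {a..b})))"

text \<open>The projection is a local diffeomorphism, so a curve in the torus is smooth iff it is
  locally the projection of a smooth plane curve. As break points may be added, it is no
  restriction to ask for one such plane curve on each piece. Adjacent pieces share
  their end points, so continuity of the curve is implied. (\<open>piecewise_C1_differentiable_on\<close>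
  would not do: it allows the speed to be non-integrable near a break point.)\<close>

definition piecewise_smooth_torus :: "real \<Rightarrow> real \<Rightarrow> (real \<Rightarrow> torus) \<Rightarrow> bool" where
  "piecewise_smooth_torus a b \<gamma> \<longleftrightarrow>
     (\<exists>(n::nat) (s :: nat \<Rightarrow> real). s 0 = a \<and> s n = b \<and>
        (\<forall>i<n. s i < s (Suc i) \<and>
           (\<exists>g. smooth_curve (s i) (s (Suc i)) g \<and>
                (\<forall>t\<in>{s i..s (Suc i)}. \<gamma> t = torus_proj (g t)))))"

definition has_torus_velocity :: "(real \<Rightarrow> torus) \<Rightarrow> real ^ 2 \<Rightarrow> real \<Rightarrow> bool" where
  "has_torus_velocity \<gamma> v t \<longleftrightarrow>
     (\<exists>g. (g has_vector_derivative v) (at t) \<and> (\<forall>\<^sub>F s in nhds t. \<gamma> s = torus_proj (g s)))"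

text \<open>Unspecified where the velocity does not exist; for a piecewise smooth curve this concerns
  only the finitely many break points and end points.\<close>

definition torus_velocity :: "(real \<Rightarrow> torus) \<Rightarrow> real \<Rightarrow> real ^ 2" where
  "torus_velocity \<gamma> t = (THE v. has_torus_velocity \<gamma> v t)"

lemma has_torus_velocity_unique:
  assumes "has_torus_velocity \<gamma> v t" "has_torus_velocity \<gamma> w t"
  shows "v = w"
proof -
  obtain g where g: "(g has_vector_derivative v) (at t)"
      "\<forall>\<^sub>F s in nhds t. \<gamma> s = torus_proj (g s)"
    using assms(1) unfolding has_torus_velocity_def by blast
  obtain h where h: "(h has_vector_derivative w) (at t)"
      "\<forall>\<^sub>F s in nhds t. \<gamma> s = torus_proj (h s)"
    using assms(2) unfolding has_torus_velocity_def by blast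
  define f where "f s = g s - h s" for s
  have f: "(f has_vector_derivative (v - w)) (at t)"
    unfolding f_def by (intro derivative_intros g h)
  have int: "\<forall>\<^sub>F s in nhds t. \<forall>i. f s $ i \<in> \<int>"
    using g(2) h(2)
  proof eventually_elim
    case (elim s)
    then have "torus_proj (g s) = torus_proj (h s)" by simp
    then show ?case unfolding torus_proj_eq_iff f_def vector_minus_component .
  qed
  then have int_t: "\<forall>i. f t $ i \<in> \<int>" using eventually_nhds_x_imp_x by fast
  have "isCont f t" using f has_vector_derivative_continuous by blast
  then have "f \<midarrow>t\<rightarrow> f t" by (simp add: isCont_def)
  then have "\<forall>\<^sub>F s in at t. dist (f s) (f t) < 1" by (rule tendstoD) simp
  then have near: "\<forall>\<^sub>F s in nhds t. dist (f s) (f t) < 1"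
    unfolding eventually_at_filter by (rule eventually_mono) auto
  have const: "\<forall>\<^sub>F s in nhds t. f s = f t"
    using int near
  proof eventually_elim
    case (elim s)
    have "f s $ i = f t $ i" for i
    proof -
      have "\<bar>(f s - f t) $ i\<bar> < 1"
        using elim(2) component_le_norm_cart[of "f s - f t" i] by (simp add: dist_norm)
      moreover have "f s $ i - f t $ i \<in> \<int>" using elim(1) int_t by (intro Ints_diff) auto
      ultimately show ?thesis using Ints_nonzero_abs_less1[of "f s $ i - f t $ i"] by simp
    qed
    then show ?case by (simp add: vec_eq_iff)
  qed
  have "(f has_vector_derivative (v - w)) (at t) =
        ((\<lambda>_. f t) has_vector_derivative (v - w)) (at t)"
    by (rule has_vector_derivative_cong_ev) (use const in \<open>auto elim: eventually_mono\<close>)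
  with f have "((\<lambda>_. f t) has_vector_derivative (v - w)) (at t)" by simp
  then have "v - w = 0"
    by (rule vector_derivative_unique_at[OF _ has_vector_derivative_const])
  then show ?thesis by simp
qed

lemma torus_velocity_eq: "has_torus_velocity \<gamma> v t \<Longrightarrow> torus_velocity \<gamma> t = v"
  unfolding torus_velocity_def using has_torus_velocity_unique by blast

definition finsler_length ::
    "(torus \<Rightarrow> real ^ 2 \<Rightarrow> real) \<Rightarrow> real \<Rightarrow> real \<Rightarrow> (real \<Rightarrow> torus) \<Rightarrow> real" where
  "finsler_length F a b \<gamma> = integral {a..b} (\<lambda>t. F (\<gamma> t) (torus_velocity \<gamma> t))"

definition closed_curve :: "real \<Rightarrow> real \<Rightarrow> (real \<Rightarrow> torus) \<Rightarrow> bool" where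
  "closed_curve a b \<gamma> \<longleftrightarrow> a < b \<and> piecewise_smooth_torus a b \<gamma> \<and> \<gamma> a = \<gamma> b"

text \<open>Free homotopy of loops; \<open>linepath a b\<close> rescales the parameter to \<open>[0,1]\<close>.\<close>

definition contractible_curve :: "real \<Rightarrow> real \<Rightarrow> (real \<Rightarrow> torus) \<Rightarrow> bool" where
  "contractible_curve a b \<gamma> \<longleftrightarrow> (\<exists>x. homotopic_loops UNIV (\<gamma> \<circ> linepath a b) (\<lambda>_. x))"

definition systole :: "(torus \<Rightarrow> real ^ 2 \<Rightarrow> real) \<Rightarrow> real" where
  "systole F =
     Inf {finsler_length F a b \<gamma> | a b \<gamma>. closed_curve a b \<gamma> \<and> \<not> contractible_curve a b \<gamma>}"

end

theory Submission
  imports Defs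
begin

text \<open>Let \<open>\<sigma> > 0\<close> be the systole and \<open>d\<close> the lifted distance on the plane. A curve from \<open>x\<close> to
  \<open>x + k z\<close> with \<open>k \<ge> 2\<close> meets its translate by \<open>z\<close> and can be cut there, so \<open>d x (x + k z) \<ge> \<bar>k\<bar> \<sigma>\<close>;
  therefore the stable norm is at least \<open>\<sigma>\<close> on nonzero lattice vectors.

  In a reduced lattice basis, support covectors of the stable norm at \<open>z1\<close>, \<open>z2\<close>, \<open>z1 - z2\<close> give three
  covectors \<open>b\<^sub>i\<close> and weights \<open>w\<^sub>i\<close> of sum one with \<open>\<sigma>\<^sup>2 / 4 \<le> (\<Sum>i<j. w\<^sub>i w\<^sub>j \<bar>b\<^sub>i \<and> b\<^sub>j\<bar>)\<close>, which is
  Minkowski's lattice point theorem for hexagons. Each \<open>b\<^sub>i\<close> is the cohomology class of a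
  1-Lipschitz function \<open>x \<mapsto> (INF z. d x z + b\<^sub>i \<bullet> z)\<close>, which averaging makes \<open>C\<^sup>1\<close> at the cost of a
  factor \<open>1 + \<delta>\<close> in the Lipschitz bound.

  At every point the unit ball lies in the three strips defined by these differentials, and
  Minkowski's mixed area inequality bounds its area by the reciprocal of
  \<open>(\<Sum>i<j. w\<^sub>i w\<^sub>j \<bar>df\<^sub>i \<and> df\<^sub>j\<bar>)\<close>. Integrating the closed forms \<open>df\<^sub>i \<and> df\<^sub>j\<close> over the torus gives
  \<open>b\<^sub>i \<and> b\<^sub>j\<close> and thereby the inequality.\<close>

section \<open>Area of a body inside three strips\<close>

text \<open>Integrals over the torus see only signed wedges: the integral of
  \<open>df\<^sub>i \<and> df\<^sub>j\<close> is determined by the periods, that of its absolute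
  value is not. The reciprocal area of the unit ball must therefore be bounded below by a
  combination of wedges with coefficients that are constant over the torus. This is the role of the
  weights, which are chosen once from the stable norm and then used at every point, whatever the
  shape of the ball there. Two covectors with weights 1/2 suffice when their wedge is at least
  \<open>\<sigma>\<^sup>2\<close>, and this is where 1/4 comes from; if the wedge is smaller, a
  third covector has to make up for the loss. As the metric is merely continuous, minimal curves are
  avoided: distances are infima over polygons, and potentials are differentiated only after
  averaging.\<close>

definition wedge :: "real ^ 2 \<Rightarrow> real ^ 2 \<Rightarrow> real" where
  "wedge a b = a $ 1 * b $ 2 - a $ 2 * b $ 1"

text \<open>Minkowski's inequality for the mixed area of the hexagon with edges
  \<open>p b1\<close>, \<open>q b2\<close>, \<open>r b3\<close> (rotated) and the body, in coordinates; \<open>A\<close>, \<open>B\<close>, \<open>C\<close> stand for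
  \<open>\<bar>b2 \<and> b3\<bar>\<close>, \<open>\<bar>b1 \<and> b3\<bar>\<close>, \<open>\<bar>b1 \<and> b2\<bar>\<close>.\<close>

lemma weighted_triangle_bound:
  fixes A B C p q r :: real
  assumes pos: "A > 0" "B > 0" and W: "4 * A * B - (A + B - C)\<^sup>2 > 0" and sum: "p + q + r = 1"
  shows "(C * p * q + B * p * r + A * q * r) * (4 * A * B - (A + B - C)\<^sup>2) \<le> A * B * C"
proof -
  define W where "W = 4 * A * B - (A + B - C)\<^sup>2"
  \<comment> \<open>\<open>X\<close> and \<open>Y\<close> are \<open>W\<close> times the offsets of
    \<open>p\<close> and \<open>q\<close> from the maximiser of the quadratic form on the plane
    \<open>p + q + r = 1\<close>, so the identity below is a completed square. By Heron's formula
    \<open>W\<close> is 16 times the squared area of a triangle with squared sides \<open>A\<close>,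
    \<open>B\<close>, \<open>C\<close>.\<close>
  define X where "X = W * p - A * (B + C - A)"
  define Y where "Y = W * q - B * (A + C - B)"
  have r: "r = 1 - p - q" using sum by simp
  have "4 * B * (W * (A * B * C - (C * p * q + B * p * r + A * q * r) * W))
      = (2 * B * X + (A + B - C) * Y)\<^sup>2 + W * Y\<^sup>2"
    unfolding X_def Y_def W_def r by algebra
  also have "\<dots> \<ge> 0" using W by (simp add: W_def)
  finally have "0 \<le> (4 * B * W) * (A * B * C - (C * p * q + B * p * r + A * q * r) * W)"
    by (simp add: mult.assoc)
  moreover have "4 * B * W > 0" using W pos by (simp add: W_def)
  ultimately have "0 \<le> A * B * C - (C * p * q + B * p * r + A * q * r) * W"
    using zero_le_mult_iff by (metis less_le_not_le)
  then show ?thesis by (simp add: W_def)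
qed

text \<open>Here the third strip cuts nothing off the parallelogram of the other two. The terms with
  \<open>r\<close> do not decrease when \<open>B * p + A * q\<close> is replaced by
  \<open>C * max p q\<close>, and what remains is \<open>C * x * (1 - x)\<close> with
  \<open>x = max p q\<close>.\<close>

lemma weighted_degenerate_bound:
  fixes A B C p q r :: real
  assumes nn: "A \<ge> 0" "B \<ge> 0" "p \<ge> 0" "q \<ge> 0" "r \<ge> 0" and C: "A + B \<le> C" and sum: "p + q + r = 1"
  shows "C * p * q + B * p * r + A * q * r \<le> C / 4"
proof -
  have quarter: "x * (1 - x) \<le> 1 / 4" for x :: real
    using zero_le_power2[of "x - 1/2"] by (simp add: power2_eq_square algebra_simps)
  have *: "C * p * q + C * x * r \<le> C / 4" if "x = p \<or> x = q" for x
  proof -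
    have "p * q + x * r \<le> 1 / 4"
      using that quarter[of p] quarter[of q] sum
      by (metis add.commute add_diff_cancel_left' distrib_left mult.commute add.left_commute)
    then have "C * (p * q + x * r) \<le> C * (1/4)"
      using nn C by (intro mult_left_mono) auto
    then show ?thesis by (simp add: algebra_simps)
  qed
  have m: "B * p + A * q \<le> C * max p q"
  proof -
    have "B * p + A * q \<le> B * max p q + A * max p q"
      using nn by (intro add_mono mult_left_mono) auto
    also have "\<dots> = (A + B) * max p q" by (simp add: algebra_simps)
    also have "\<dots> \<le> C * max p q" using nn C by (intro mult_right_mono) auto
    finally show ?thesis .
  qed
  have "B * p * r + A * q * r = (B * p + A * q) * r" by (simp add: algebra_simps)
  also have "\<dots> \<le> (C * max p q) * r" using m nn by (intro mult_right_mono) auto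
  finally have "B * p * r + A * q * r \<le> C * max p q * r" .
  moreover have "C * p * q + C * max p q * r \<le> C / 4" by (rule *) (simp add: max_def)
  ultimately show ?thesis by linarith
qed

text \<open>The weights are the critical point of the quadratic form on the plane
  \<open>p + q + r = 1\<close>. The triangle inequalities make them nonnegative, and the value there
  is \<open>A * B * C / V\<close>, which the last hypothesis compares with 1/4.\<close>

lemma exists_weights_sides:
  fixes A B C :: real
  assumes pos: "A > 0" "B > 0" "C > 0" and tri: "A \<le> B + C" "B \<le> A + C" "C \<le> A + B"
    and W: "2*A*B + 2*B*C + 2*A*C - A\<^sup>2 - B\<^sup>2 - C\<^sup>2 \<le> 4 * A * B * C"
  shows "\<exists>p q r. 0 \<le> p \<and> 0 \<le> q \<and> 0 \<le> r \<and> p + q + r = 1 \<and>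
           1/4 \<le> C * p * q + B * p * r + A * q * r"
proof -
  define V where "V = 2*A*B + 2*B*C + 2*A*C - A\<^sup>2 - B\<^sup>2 - C\<^sup>2"
  define p where "p = A * (B + C - A) / V"
  define q where "q = B * (A + C - B) / V"
  define r where "r = C * (A + B - C) / V"
  have Vsum: "V = A * (B + C - A) + B * (A + C - B) + C * (A + B - C)"
    unfolding V_def by algebra
  have V: "V > 0"
  proof -
    have "A * (B + C - A) \<ge> 0" "B * (A + C - B) \<ge> 0" "C * (A + B - C) \<ge> 0"
      using pos tri by auto
    moreover have "B + C - A > 0 \<or> A + C - B > 0 \<or> A + B - C > 0" using pos by linarith
    ultimately show ?thesis using pos unfolding Vsum
      by (smt (verit) mult_pos_pos)
  qed
  have nn: "p \<ge> 0" "q \<ge> 0" "r \<ge> 0"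
    using pos tri V by (auto simp: p_def q_def r_def)
  have s: "p + q + r = 1" using V Vsum
    by (simp add: p_def q_def r_def add_divide_distrib[symmetric])
  have e: "p * V = A * (B + C - A)" "q * V = B * (A + C - B)" "r * V = C * (A + B - C)"
    using V by (auto simp: p_def q_def r_def)
  have "(C * p * q + B * p * r + A * q * r) * V * V
     = C * (p*V) * (q*V) + B * (p*V) * (r*V) + A * (q*V) * (r*V)" by algebra
  also have "\<dots> = A * B * C * V"
    unfolding e unfolding V_def by (simp add: algebra_simps power2_eq_square)
  finally have "(C * p * q + B * p * r + A * q * r) * V = A * B * C" using V by simp
  moreover have "V \<le> 4 * (A * B * C)" using W by (simp add: V_def)
  ultimately have "V \<le> 4 * (C * p * q + B * p * r + A * q * r) * V" by linarith
  then have "1 \<le> 4 * (C * p * q + B * p * r + A * q * r)" using V by simp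
  then show ?thesis using nn s by (intro exI[of _ p] exI[of _ q] exI[of _ r]) simp
qed

text \<open>Minkowski's lattice point theorem for the covectors \<open>(1, s)\<close>, \<open>(t, 1)\<close>, \<open>(u, u - 1)\<close>: the
  slack in the inequality is a perfect square.\<close>

lemma exists_weights_unit:
  fixes s t u :: real
  assumes s: "0 \<le> s" and t: "0 \<le> t" and u: "0 \<le> u" "u \<le> 1"
  shows "\<exists>p q r. 0 \<le> p \<and> 0 \<le> q \<and> 0 \<le> r \<and> p + q + r = 1 \<and>
    1/4 \<le> (1 - s * t) * p * q + ((1 - u) + s * u) * p * r + (t * (1 - u) + u) * q * r"
proof -
  define A where "A = t * (1 - u) + u"
  define B where "B = (1 - u) + s * u"
  define C where "C = 1 - s * t"
  have "\<exists>p q r. 0 \<le> p \<and> 0 \<le> q \<and> 0 \<le> r \<and> p + q + r = 1 \<and>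
     1/4 \<le> C * p * q + B * p * r + A * q * r"
  proof -
    \<comment> \<open>A coefficient of at least 1 needs only its own two covectors, with weight 1/2
      each. The hexagon matters when all three are below 1.\<close>
    consider "A \<ge> 1" | "B \<ge> 1" | "C \<ge> 1" | "A < 1" "B < 1" "C < 1" by linarith
    then show ?thesis
    proof cases
      case 1 then show ?thesis by (intro exI[of _ 0] exI[of _ "1/2"]) auto
    next
      case 2 then show ?thesis by (intro exI[of _ "1/2"] exI[of _ 0] exI[of _ "1/2"]) auto
    next
      case 3 then show ?thesis by (intro exI[of _ "1/2"] exI[of _ "1/2"] exI[of _ 0]) auto
    next
      case 4
      have "(1 - t) * (1 - u) > 0" using 4(1) by (simp add: A_def algebra_simps)
      then have t1: "t < 1" "u < 1" using u by (auto simp: zero_less_mult_iff)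
      have "(1 - s) * u > 0" using 4(2) by (simp add: B_def algebra_simps)
      then have s1: "s < 1" "u > 0" using u by (auto simp: zero_less_mult_iff)
      define w where "w = 1 - u"
      define x where "x = 1 - t"
      define y where "y = 1 - s"
      have e: "A = 1 - w * x" "B = 1 - (1 - w) * y" "C = 1 - (1 - x) * (1 - y)"
        by (auto simp: A_def B_def C_def w_def x_def y_def algebra_simps)
      have r: "0 < w" "w < 1" "0 < x" "x \<le> 1" "0 < y" "y \<le> 1"
        using s t t1 s1 by (auto simp: w_def x_def y_def)
      have sum: "A + B + C - 2 = x * (1 - y) * (1 - w) + (1 - x) * y * w"
        unfolding e by (simp add: algebra_simps)
      also have "\<dots> \<ge> 0" using r by simp
      finally have ge: "A + B + C \<ge> 2" by simp
      have "4 * A * B * C - (2*A*B + 2*B*C + 2*A*C - A\<^sup>2 - B\<^sup>2 - C\<^sup>2)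
         = (x * (1 - y) * (1 - w) - (1 - x) * y * w)\<^sup>2"
        unfolding e by algebra
      also have "\<dots> \<ge> 0" by simp
      finally have W: "2*A*B + 2*B*C + 2*A*C - A\<^sup>2 - B\<^sup>2 - C\<^sup>2 \<le> 4 * A * B * C" by simp
      \<comment> \<open>Each side is below 1 and their sum is at least 2, which gives positivity and
        the triangle inequalities.\<close>
      show ?thesis by (rule exists_weights_sides[OF _ _ _ _ _ _ W]) (use 4 ge in linarith)+
    qed
  qed
  then show ?thesis by (simp add: A_def B_def C_def)
qed

section \<open>Areas of clipped squares and of bodies in strips\<close>

lemma measure_square: "measure lebesgue {w :: real^2. \<bar>w$1\<bar> \<le> 1 \<and> \<bar>w$2\<bar> \<le> 1} = 4"
  and square_lmeasurable: "{w :: real^2. \<bar>w$1\<bar> \<le> 1 \<and> \<bar>w$2\<bar> \<le> 1} \<in> lmeasurable"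
proof -
  have eq: "{w :: real^2. \<bar>w$1\<bar> \<le> 1 \<and> \<bar>w$2\<bar> \<le> 1} = cbox (-1) 1"
    by (auto simp: mem_box_cart forall_2 abs_le_iff)
  show "measure lebesgue {w :: real^2. \<bar>w$1\<bar> \<le> 1 \<and> \<bar>w$2\<bar> \<le> 1} = 4"
    unfolding eq
    by (simp add: measure_completion content_cbox_cart prod_2 interval_ne_empty_cart)
  show "{w :: real^2. \<bar>w$1\<bar> \<le> 1 \<and> \<bar>w$2\<bar> \<le> 1} \<in> lmeasurable"
    unfolding eq by simp
qed

lemma clipped_square_lmeasurable:
  "{w :: real^2. \<bar>w$1\<bar> \<le> 1 \<and> \<bar>w$2\<bar> \<le> 1 \<and> \<bar>A * w$1 + B * w$2\<bar> \<le> C} \<in> lmeasurable"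
proof -
  have "closed {w :: real^2. \<bar>A * w$1 + B * w$2\<bar> \<le> C}"
    by (intro closed_Collect_le continuous_intros)
  then have "{w :: real^2. \<bar>A * w$1 + B * w$2\<bar> \<le> C} \<in> sets lebesgue" by auto
  from fmeasurable_Int_fmeasurable[OF square_lmeasurable this] show ?thesis
    by (simp add: Collect_conj_eq Int_assoc)
qed

text \<open>The strip removes two opposite corner triangles \<open>T\<close> and \<open>T'\<close>
  with legs \<open>e / A\<close> and \<open>e / B\<close>. The half turn of \<open>T\<close> about
  the centre of the rectangle \<open>R\<close> is a translate of \<open>T'\<close>, and the two
  cover \<open>R\<close> up to a null set, so no triangle area has to be computed.\<close>

lemma measure_clipped_square:
  fixes A B C :: real
  assumes pos: "A > 0" "B > 0" and C: "A \<le> C" "B \<le> C" "C \<le> A + B"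
  shows "measure lebesgue {w :: real^2. \<bar>w$1\<bar> \<le> 1 \<and> \<bar>w$2\<bar> \<le> 1 \<and> \<bar>A * w$1 + B * w$2\<bar> \<le> C}
           \<le> 4 - (A + B - C)\<^sup>2 / (A * B)"
    (is "measure lebesgue ?H \<le> _")
proof -
  define S where "S = {w :: real^2. \<bar>w$1\<bar> \<le> 1 \<and> \<bar>w$2\<bar> \<le> 1}"
  define T where "T = {w \<in> S. A * w$1 + B * w$2 > C}"
  define T' where "T' = {w \<in> S. A * w$1 + B * w$2 < - C}"
  define e where "e = A + B - C"
  define R :: "(real^2) set" where "R = cbox (vector [1 - e/A, 1 - e/B]) 1"
  \<comment> \<open>The sum of two opposite corners of \<open>R\<close>: sending \<open>w\<close> to
    \<open>ctr - w\<close> is the half turn about its centre.\<close>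
  define ctr :: "real^2" where "ctr = vector [2 - e/A, 2 - e/B]"
  have e: "0 \<le> e" "e \<le> A" "e \<le> B" using C by (auto simp: e_def)
  have S: "S \<in> lmeasurable" unfolding S_def by (rule square_lmeasurable)
  have "open {w :: real^2. A * w$1 + B * w$2 > C}" "open {w :: real^2. A * w$1 + B * w$2 < - C}"
    by (intro open_Collect_less continuous_intros)+
  then have hs: "{w :: real^2. A * w$1 + B * w$2 > C} \<in> sets lebesgue"
      "{w :: real^2. A * w$1 + B * w$2 < - C} \<in> sets lebesgue" by auto
  have T: "T \<in> lmeasurable" "T' \<in> lmeasurable"
    using fmeasurable_Int_fmeasurable[OF S hs(1)] fmeasurable_Int_fmeasurable[OF S hs(2)]
    by (simp_all add: T_def T'_def Collect_conj_eq Int_commute)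
  have T': "T' = uminus ` T"
  proof -
    have "w \<in> uminus ` T" if "w \<in> T'" for w
      using that by (intro image_eqI[of _ _ "-w"]) (auto simp: T_def T'_def S_def)
    then show ?thesis by (auto simp: T_def T'_def S_def)
  qed
  have mT': "measure lebesgue T' = measure lebesgue T"
    unfolding T' using measure_lebesgue_affine[of "-1" "0::real^2" T] by simp
  have compact: "?H \<in> lmeasurable" by (rule clipped_square_lmeasurable)
  define N where "N = {w :: real^2. vector [A, B] \<bullet> w = C}"
  have N: "N \<in> lmeasurable" "measure lebesgue N = 0"
  proof -
    have "(vector [A, B] :: real^2) \<noteq> 0" using pos by (metis vector_2(1) zero_index less_irrefl)
    then have "negligible N" unfolding N_def by (intro negligible_hyperplane) simp
    then show "N \<in> lmeasurable" "measure lebesgue N = 0"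
      by (auto simp: negligible_iff_measure)
  qed
  have mR: "measure lebesgue R = e\<^sup>2 / (A * B)"
    using e pos by (simp add: R_def measure_completion content_cbox_cart interval_ne_empty_cart
        UNIV_2 forall_2 power2_eq_square)
  have "R \<subseteq> N \<union> (T \<union> (\<lambda>w. ctr + w) ` T')"
  proof
    fix w assume w: "w \<in> R"
    have rw: "1 - e/A \<le> w$1" "w$1 \<le> 1" "1 - e/B \<le> w$2" "w$2 \<le> 1"
      using w by (auto simp: R_def mem_box_cart forall_2)
    have eA: "e / A \<le> 1" "e / B \<le> 1" using e pos by auto
    consider "A * w$1 + B * w$2 = C" | "A * w$1 + B * w$2 > C" | "A * w$1 + B * w$2 < C" by linarith
    then show "w \<in> N \<union> (T \<union> (\<lambda>w. ctr + w) ` T')"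
    proof cases
      case 1 then show ?thesis by (simp add: N_def inner_vec_def sum_2)
    next
      case 2 then show ?thesis using rw eA by (simp add: T_def S_def)
    next
      case 3
      have "A * (w$1 - (2 - e/A)) + B * (w$2 - (2 - e/B)) < - C"
      proof -
        have "A * (e/A) = e" "B * (e/B) = e" using pos by auto
        then show ?thesis using 3 by (simp add: right_diff_distrib) (simp add: e_def)
      qed
      then have "w - ctr \<in> T'" using rw eA by (simp add: T'_def S_def ctr_def)
      then show ?thesis by (intro UnI2 image_eqI[of _ _ "w - ctr"]) auto
    qed
  qed
  then have "measure lebesgue R \<le> measure lebesgue (N \<union> (T \<union> (\<lambda>w. ctr + w) ` T'))"
    using T N by (intro measure_mono_fmeasurable) (auto simp: R_def measurable_translation fmeasurable.Un)
  also have "\<dots> \<le> measure lebesgue N + measure lebesgue (T \<union> (\<lambda>w. ctr + w) ` T')"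
    using T N by (intro measure_Un_le) (auto simp: measurable_translation fmeasurableD)
  also have "\<dots> \<le> 0 + (measure lebesgue T + measure lebesgue ((\<lambda>w. ctr + w) ` T'))"
    using T N by (intro add_mono measure_Un_le) (auto simp: measurable_translation fmeasurableD)
  also have "\<dots> = 2 * measure lebesgue T" by (simp add: measure_translation mT')
  finally have 2: "e\<^sup>2 / (A * B) \<le> 2 * measure lebesgue T" by (simp add: mR)
  have "measure lebesgue (?H \<union> (T \<union> T')) = measure lebesgue ?H + measure lebesgue (T \<union> T')"
    using T compact C pos by (intro measure_Un_AE AE_I2) (auto simp: T_def T'_def fmeasurable.Un)
  also have "measure lebesgue (T \<union> T') = measure lebesgue T + measure lebesgue T'"
    using T C pos by (intro measure_Un_AE AE_I2) (auto simp: T_def T'_def)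
  finally have "measure lebesgue ?H + 2 * measure lebesgue T = measure lebesgue (?H \<union> (T \<union> T'))"
    by (simp add: mT')
  also have "\<dots> \<le> measure lebesgue S"
    using S T compact by (intro measure_mono_fmeasurable) (auto simp: T_def T'_def S_def)
  also have "\<dots> = 4" unfolding S_def by (rule measure_square)
  finally show ?thesis using 2 by (simp add: e_def)
qed

text \<open>Up to signs, \<open>b1 \<bullet> v\<close> and \<open>b2 \<bullet> v\<close> are
  coordinates that scale area by \<open>C\<close> and turn the first two strips into a square;
  Cramer's identity turns the third into a strip clipping it. In the main case the clipped square
  has area at most \<open>W / (A * B)\<close> and the quadratic form in the weights is at most
  \<open>A * B * C / W\<close>, so the two bounds multiply to \<open>C\<close>.\<close>

lemma measure_strips_bound:
  fixes K :: "(real^2) set"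
  assumes K: "K \<in> lmeasurable" and nn: "p \<ge> 0" "q \<ge> 0" "r \<ge> 0" and sum: "p + q + r = 1"
    and strips: "\<And>v. v \<in> K \<Longrightarrow> \<bar>b1 \<bullet> v\<bar> \<le> 1 \<and> \<bar>b2 \<bullet> v\<bar> \<le> 1 \<and> \<bar>b3 \<bullet> v\<bar> \<le> 1"
    and max: "\<bar>wedge b2 b3\<bar> \<le> \<bar>wedge b1 b2\<bar>" "\<bar>wedge b1 b3\<bar> \<le> \<bar>wedge b1 b2\<bar>"
  shows "measure lebesgue K *
     (\<bar>wedge b1 b2\<bar> * p * q + \<bar>wedge b1 b3\<bar> * p * r + \<bar>wedge b2 b3\<bar> * q * r) \<le> 1"
proof -
  define A where "A = \<bar>wedge b2 b3\<bar>"
  define B where "B = \<bar>wedge b1 b3\<bar>"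
  define C where "C = \<bar>wedge b1 b2\<bar>"
  \<comment> \<open>The signs flip the coordinates so that both coefficients of the third strip are
    nonnegative. Where a wedge vanishes the sign is immaterial.\<close>
  define s where "s = (if wedge b2 b3 * wedge b1 b2 > 0 then - 1 else (1::real))"
  define t where "t = (if wedge b1 b3 * wedge b1 b2 < 0 then - 1 else (1::real))"
  define f :: "real^2 \<Rightarrow> real^2" where "f v = vector [s * (b1 \<bullet> v), t * (b2 \<bullet> v)]" for v
  have st: "\<bar>s\<bar> = 1" "\<bar>t\<bar> = 1" by (auto simp: s_def t_def)
  have lin: "linear f"
    by (rule linearI) (auto simp: f_def vec_eq_iff forall_2 inner_add_right algebra_simps)
  have det: "\<bar>det (matrix f)\<bar> = C"
  proof -
    have "det (matrix f) = s * t * wedge b1 b2"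
      by (simp add: det_2 matrix_def f_def inner_axis wedge_def algebra_simps)
    then show ?thesis using st by (simp add: C_def abs_mult)
  qed
  have mf: "measure lebesgue (f ` K) = C * measure lebesgue K" and Kf: "f ` K \<in> lmeasurable"
    using measure_linear_image[OF lin K] measurable_linear_image[OF lin K] det by simp_all
  have b3: "C * \<bar>b3 \<bullet> v\<bar> = \<bar>A * f v $ 1 + B * f v $ 2\<bar>" for v
  proof -
    have "wedge b1 b2 * (b3 \<bullet> v) = - wedge b2 b3 * (b1 \<bullet> v) + wedge b1 b3 * (b2 \<bullet> v)"
      by (simp add: wedge_def inner_vec_def sum_2 algebra_simps)
    then have "C * \<bar>b3 \<bullet> v\<bar> = \<bar>- wedge b2 b3 * (b1 \<bullet> v) + wedge b1 b3 * (b2 \<bullet> v)\<bar>"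
      by (metis C_def abs_mult)
    also have "\<dots> = \<bar>A * f v $ 1 + B * f v $ 2\<bar>"
    proof (cases "wedge b1 b2 > 0")
      case True
      then have "A * s = - wedge b2 b3" "B * t = wedge b1 b3"
        by (auto simp: A_def B_def s_def t_def zero_less_mult_iff mult_less_0_iff)
      then show ?thesis by (simp add: f_def flip: mult.assoc)
    next
      case False
      show ?thesis
      proof (cases "wedge b1 b2 = 0")
        case True
        then show ?thesis using max by simp (simp add: A_def B_def)
      next
        case f: False
        with False have "wedge b1 b2 < 0" by simp
        then have "A * s = wedge b2 b3" "B * t = - wedge b1 b3"
          by (auto simp: A_def B_def s_def t_def zero_less_mult_iff mult_less_0_iff)
        then show ?thesis by (simp add: f_def flip: mult.assoc)
      qed
    qed
    finally show ?thesis .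
  qed
  have nnABC: "A \<ge> 0" "B \<ge> 0" "C \<ge> 0" "A \<le> C" "B \<le> C"
    using max by (auto simp: A_def B_def C_def)
  have sub: "f ` K \<subseteq> {w. \<bar>w$1\<bar> \<le> 1 \<and> \<bar>w$2\<bar> \<le> 1 \<and> \<bar>A * w$1 + B * w$2\<bar> \<le> C}"
  proof safe
    fix v assume v: "v \<in> K"
    show "\<bar>f v $ 1\<bar> \<le> 1" "\<bar>f v $ 2\<bar> \<le> 1"
      using strips[OF v] st by (auto simp: f_def abs_mult)
    have "C * \<bar>b3 \<bullet> v\<bar> \<le> C * 1" using strips[OF v] nnABC by (intro mult_left_mono) auto
    then show "\<bar>A * f v $ 1 + B * f v $ 2\<bar> \<le> C" by (simp add: b3)
  qed
  have "measure lebesgue K * (C * p * q + B * p * r + A * q * r) \<le> 1"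
  proof -
    consider "C = 0" | "C > 0" "A + B \<le> C" | "C > 0" "C < A + B" using nnABC by linarith
    then show ?thesis
    proof cases
      case 1 then show ?thesis using nnABC by simp
    next
      case 2
      have "C * measure lebesgue K \<le> 4"
        unfolding mf[symmetric] measure_square[symmetric]
        using sub Kf square_lmeasurable by (intro measure_mono_fmeasurable) auto
      moreover have "C * p * q + B * p * r + A * q * r \<le> C / 4"
        by (rule weighted_degenerate_bound) (use 2 nn nnABC sum in auto)
      ultimately have "measure lebesgue K * (C * p * q + B * p * r + A * q * r)
          \<le> measure lebesgue K * (C / 4)" by (intro mult_left_mono) auto
      also have "\<dots> \<le> 1" using \<open>C * measure lebesgue K \<le> 4\<close> by (simp add: mult.commute)
      finally show ?thesis .
    next
      case 3
      then have pos: "A > 0" "B > 0" using nnABC by auto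
      define W where "W = 4 * A * B - (A + B - C)\<^sup>2"
      have "(A + B - C)\<^sup>2 = (A + B - C) * (A + B - C)" by (simp add: power2_eq_square)
      also have "\<dots> \<le> A * B" using 3 nnABC by (intro mult_mono) auto
      also have "\<dots> < 4 * A * B" using pos by simp
      finally have W: "W > 0" by (simp add: W_def)
      have "C * measure lebesgue K \<le> measure lebesgue
          {w :: real^2. \<bar>w$1\<bar> \<le> 1 \<and> \<bar>w$2\<bar> \<le> 1 \<and> \<bar>A * w$1 + B * w$2\<bar> \<le> C}"
        unfolding mf[symmetric]
        using sub Kf clipped_square_lmeasurable by (intro measure_mono_fmeasurable) auto
      also have "\<dots> \<le> 4 - (A + B - C)\<^sup>2 / (A * B)"
        by (rule measure_clipped_square) (use 3 pos nnABC in auto)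
      also have "\<dots> = W / (A * B)" using pos by (simp add: W_def field_simps)
      finally have le: "A * B * C * measure lebesgue K \<le> W" using pos by (simp add: field_simps)
      have "(C * p * q + B * p * r + A * q * r) * W \<le> A * B * C"
        unfolding W_def by (rule weighted_triangle_bound) (use pos W sum in \<open>auto simp: W_def\<close>)
      then have "measure lebesgue K * ((C * p * q + B * p * r + A * q * r) * W)
         \<le> measure lebesgue K * (A * B * C)" by (intro mult_left_mono) auto
      also have "\<dots> \<le> W" using le by (simp add: mult.commute)
      finally have "(measure lebesgue K * (C * p * q + B * p * r + A * q * r)) * W \<le> 1 * W"
        by (simp add: mult.assoc)
      then show ?thesis using W by (simp only: mult_le_cancel_right_pos)
    qed
  qed
  then show ?thesis by (simp add: A_def B_def C_def)
qed

lemma wedge_commute_abs: "\<bar>wedge a b\<bar> = \<bar>wedge b a\<bar>"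
  by (simp add: wedge_def abs_minus_commute mult.commute)

text \<open>The weights travel with the covectors, so the expression is invariant under permutations
  and the pair with the largest wedge may be put first.\<close>

lemma measure_three_strips:
  fixes K :: "(real^2) set"
  assumes K: "K \<in> lmeasurable" and nn: "p \<ge> 0" "q \<ge> 0" "r \<ge> 0" and sum: "p + q + r = 1"
    and strips: "\<And>v. v \<in> K \<Longrightarrow> \<bar>b1 \<bullet> v\<bar> \<le> 1 \<and> \<bar>b2 \<bullet> v\<bar> \<le> 1 \<and> \<bar>b3 \<bullet> v\<bar> \<le> 1"
  shows "measure lebesgue K *
     (\<bar>wedge b1 b2\<bar> * p * q + \<bar>wedge b1 b3\<bar> * p * r + \<bar>wedge b2 b3\<bar> * q * r) \<le> 1"
proof -
  consider "\<bar>wedge b2 b3\<bar> \<le> \<bar>wedge b1 b2\<bar>" "\<bar>wedge b1 b3\<bar> \<le> \<bar>wedge b1 b2\<bar>"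
    | "\<bar>wedge b2 b3\<bar> \<le> \<bar>wedge b1 b3\<bar>" "\<bar>wedge b1 b2\<bar> \<le> \<bar>wedge b1 b3\<bar>"
    | "\<bar>wedge b1 b2\<bar> \<le> \<bar>wedge b2 b3\<bar>" "\<bar>wedge b1 b3\<bar> \<le> \<bar>wedge b2 b3\<bar>" by linarith
  then show ?thesis
  proof cases
    case 1 then show ?thesis using measure_strips_bound[of K p q r b1 b2 b3] K nn sum strips by blast
  next
    case 2
    have "measure lebesgue K *
     (\<bar>wedge b1 b3\<bar> * p * r + \<bar>wedge b1 b2\<bar> * p * q + \<bar>wedge b3 b2\<bar> * r * q) \<le> 1"
      by (rule measure_strips_bound) (use 2 K nn sum strips wedge_commute_abs[of b3 b2] in auto)
    then show ?thesis using wedge_commute_abs[of b3 b2] by (simp add: algebra_simps)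
  next
    case 3
    have "measure lebesgue K *
     (\<bar>wedge b2 b3\<bar> * q * r + \<bar>wedge b2 b1\<bar> * q * p + \<bar>wedge b3 b1\<bar> * r * p) \<le> 1"
      by (rule measure_strips_bound)
        (use 3 K nn sum strips wedge_commute_abs[of b3 b1] wedge_commute_abs[of b2 b1] in auto)
    then show ?thesis using wedge_commute_abs[of b3 b1] wedge_commute_abs[of b2 b1]
      by (simp add: algebra_simps)
  qed
qed

section \<open>Chords of plane curves\<close>

text \<open>Ending at or below the starting angle, with a negative cosine of the difference, forces
  a drop of at least \<open>pi / 2\<close>. Coming from the negative real axis, the angle would then
  pass the positive imaginary axis, where the sine is 1.\<close>

lemma angle_increases_in_lower_half_plane:
  fixes u :: "real \<Rightarrow> real"
  assumes cont: "continuous_on {0..1} u" and start: "cos (u 0) = -1"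
    and turn: "cos (u 1 - u 0) < 0" and lower: "\<And>r. r \<in> {0..1} \<Longrightarrow> sin (u r) \<le> 0"
  shows "u 0 < u 1"
proof (rule ccontr)
  assume "\<not> u 0 < u 1"
  then have "u 1 \<le> u 0 - pi / 2"
    using turn cos_ge_zero[of "u 1 - u 0"] by (force simp: not_less)
  then obtain r where r: "0 \<le> r" "r \<le> 1" "u r = u 0 - pi / 2"
    using IVT2'[of u 1 "u 0 - pi/2" 0] cont by auto
  have "sin (u r) = 1" using start by (simp add: r(3) sin_diff)
  then show False using lower[of r] r by simp
qed

text \<open>If the curve and its translate by one were disjoint, the angle of the chord from \<open>c s\<close>
  to \<open>c (s + r)\<close> shifted back by one would turn by a negative real factor as \<open>r\<close> runs over a
  period. Seen from a highest point of the curve it turns counterclockwise, from a lowest point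
  clockwise, and by continuity it would not turn at all in between.\<close>

lemma lattice_chord_exists:
  fixes c :: "real \<Rightarrow> complex" and k :: int
  assumes cont: "continuous_on {0..1} c" and k: "k \<ge> 2" and per: "c 1 - c 0 = of_int k"
  shows "\<exists>s t m. 0 \<le> s \<and> s < t \<and> t \<le> 1 \<and> c t - c s = of_int m \<and> m \<noteq> 0 \<and> m \<noteq> k"
proof (rule ccontr)
  assume no: "\<not> ?thesis"
  \<comment> \<open>Continued over a second period, so that every \<open>s\<close> has a full period
    of chords ahead of it.\<close>
  define e where "e t = (if t \<le> 1 then c t else c (t - 1) + of_int k)" for t
  have conte: "continuous_on {0..2} e"
  proof -
    have "continuous_on ({0..1} \<union> {1..2}) (\<lambda>t. if t \<le> 1 then c t else c (t - 1) + of_int k)"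
    proof (rule continuous_on_cases)
      show "continuous_on {1..2} (\<lambda>t. c (t - 1) + of_int k)"
        by (intro continuous_intros continuous_on_compose2[OF cont]) auto
      show "\<forall>t. t \<in> {0..1} \<and> \<not> t \<le> 1 \<or> t \<in> {1..2} \<and> t \<le> 1 \<longrightarrow> c t = c (t - 1) + of_int k"
      proof (intro allI impI)
        fix t :: real assume "t \<in> {0..1} \<and> \<not> t \<le> 1 \<or> t \<in> {1..2} \<and> t \<le> 1"
        then have "t = 1" by auto
        then show "c t = c (t - 1) + of_int k" using per by (simp add: algebra_simps)
      qed
    qed (use cont in auto)
    moreover have "{0..1} \<union> {1..2} = {0..(2::real)}" by auto
    ultimately show ?thesis by (simp add: e_def[abs_def])
  qed
  define G where "G x = e (fst x + snd x) - e (fst x) - 1" for x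
  let ?Q = "{0..1::real} \<times> {0..1::real}"
  have contG: "continuous_on ?Q G"
    unfolding G_def by (intro continuous_intros continuous_on_compose2[OF conte]) auto
  have nz: "G x \<noteq> 0" if "x \<in> ?Q" for x
  proof
    assume "G x = 0"
    obtain s r where "x = (s, r)" by (cases x)
    with that have x: "x = (s, r)" "0 \<le> s" "s \<le> 1" "0 \<le> r" "r \<le> 1" by auto
    then have eq: "e (s + r) - c s = 1" using \<open>G x = 0\<close> by (simp add: G_def e_def)
    show False
    proof (cases "s + r \<le> 1")
      case True
      then have "c (s + r) - c s = of_int 1" using eq by (simp add: e_def)
      moreover from this have "r \<noteq> 0" by auto
      ultimately show False using no x True k
        by (metis add_0 add_increasing2 add_less_cancel_left less_eq_real_def one_neq_zero
            linorder_not_le numeral_le_one_iff semiring_norm(69) add.right_neutral)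
    next
      case False
      \<comment> \<open>A chord that wraps around the end gives a chord of \<open>c\<close> with
        difference \<open>k - 1\<close> over the complementary interval; since \<open>k\<close> is
        at least 2, this is neither 0 nor \<open>k\<close>.\<close>
      then have *: "c s - c (s + r - 1) = of_int (k - 1)" using eq by (simp add: e_def algebra_simps)
      then have "r \<noteq> 1" using k by auto
      then have "s + r - 1 < s" using x by simp
      then show False using no x False k *
        by (smt (verit))
    qed
  qed
  have "contractible ?Q" by (intro convex_imp_contractible convex_Times) auto
  then obtain g where g: "continuous_on ?Q g" "\<And>x. x \<in> ?Q \<Longrightarrow> G x = exp (g x)"
    using continuous_logarithm_on_contractible[OF contG _ nz] by blast
  \<comment> \<open>The total turning over one period. Its cosine is negative because
    \<open>G\<close> goes from -1 to the positive number \<open>k - 1\<close>.\<close>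
  define D where "D s = Im (g (s, 1)) - Im (g (s, 0))" for s
  have G0: "G (s, 0) = -1" and G1: "G (s, 1) = of_int (k - 1)" if "s \<in> {0..1}" for s
    using that per by (auto simp: G_def e_def algebra_simps)
  have cosD: "cos (D s) < 0" if s: "s \<in> {0..1}" for s
  proof -
    have "exp (g (s, 1) - g (s, 0)) = G (s, 1) / G (s, 0)"
      using s g(2)[of "(s,1)"] g(2)[of "(s,0)"] by (simp add: exp_diff)
    also have "\<dots> = of_int (1 - k)" using G0 G1 s by simp
    finally have "Re (exp (g (s, 1) - g (s, 0))) < 0" using k by simp
    then show ?thesis by (simp add: Re_exp D_def mult_less_0_iff)
  qed
  have cos0: "cos (Im (g (s, 0))) = -1" if s: "s \<in> {0..1}" for s
  proof -
    have "exp (g (s, 0)) = -1" using s g(2)[of "(s,0)"] G0 by simp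
    then have a: "Re (exp (g (s,0))) = -1" "Im (exp (g (s,0))) = 0" "cmod (exp (g (s, 0))) = 1" by auto
    then show ?thesis by (simp add: Re_exp)
  qed
  have contg: "continuous_on {0..1} (\<lambda>r. Im (g (s, r)))" if "s \<in> {0..1}" for s
    by (intro continuous_intros continuous_on_compose2[OF g(1)]) (use that in auto)
  have Ime: "Im (G (s, r)) = Im (e (s + r)) - Im (c s)" if "s \<in> {0..1}" for s r
    using that by (simp add: G_def e_def)
  have sinG: "Im (G (s, r)) = exp (Re (g (s, r))) * sin (Im (g (s, r)))"
    if "s \<in> {0..1}" "r \<in> {0..1}" for s r
    using g(2)[of "(s,r)"] that by (simp add: Im_exp)
  have Imc: "continuous_on {0..1} (\<lambda>t. Im (c t))" by (intro continuous_intros cont)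
  obtain a where a: "a \<in> {0..1}" "\<And>t. t \<in> {0..1} \<Longrightarrow> Im (c t) \<le> Im (c a)"
    using continuous_attains_sup[OF compact_Icc _ Imc] by auto
  obtain b where b: "b \<in> {0..1}" "\<And>t. t \<in> {0..1} \<Longrightarrow> Im (c b) \<le> Im (c t)"
    using continuous_attains_inf[OF compact_Icc _ Imc] by auto
  have Ime': "\<exists>t'\<in>{0..1}. Im (e t) = Im (c t')" if "t \<in> {0..2}" for t
    using that by (cases "t \<le> 1") (auto simp: e_def intro: bexI[of _ t] bexI[of _ "t - 1"])
  have "Im (g (a, 0)) < Im (g (a, 1))"
  proof (rule angle_increases_in_lower_half_plane[OF contg[OF a(1)] cos0[OF a(1)]])
    show "cos (Im (g (a, 1)) - Im (g (a, 0))) < 0" using cosD[OF a(1)] by (simp add: D_def)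
    fix r :: real assume r: "r \<in> {0..1}"
    have "Im (G (a, r)) \<le> 0" using Ime[OF a(1)] Ime'[of "a + r"] a r by fastforce
    then show "sin (Im (g (a, r))) \<le> 0" using sinG[OF a(1) r] by (simp add: mult_le_0_iff)
  qed
  then have Da: "D a > 0" by (simp add: D_def)
  have "- Im (g (b, 0)) < - Im (g (b, 1))"
  proof (rule angle_increases_in_lower_half_plane)
    show "continuous_on {0..1} (\<lambda>r. - Im (g (b, r)))" by (intro continuous_intros contg b)
    show "cos (- Im (g (b, 0))) = -1" using cos0[OF b(1)] by simp
    show "cos (- Im (g (b, 1)) - - Im (g (b, 0))) < 0"
      using cosD[OF b(1)] cos_minus[of "D b"] by (simp add: D_def)
    fix r :: real assume r: "r \<in> {0..1}"
    have "Im (G (b, r)) \<ge> 0" using Ime[OF b(1)] Ime'[of "b + r"] b r by fastforce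
    then show "sin (- Im (g (b, r))) \<le> 0" using sinG[OF b(1) r] by (simp add: zero_le_mult_iff)
  qed
  then have Db: "D b < 0" by (simp add: D_def)
  have "continuous_on {0..1} D" unfolding D_def
    by (intro continuous_intros continuous_on_compose2[OF g(1)]) auto
  then have "connected (D ` {0..1})" by (intro connected_continuous_image) auto
  then have "0 \<in> D ` {0..1}"
    using Da Db a(1) b(1) connectedD_interval[of "D ` {0..1}" "D b" "D a" 0] by auto
  then obtain s where "s \<in> {0..1}" "D s = 0" by auto
  then show False using cosD[of s] by simp
qed

section \<open>Polygons and the systole\<close>

definition int_lattice :: "(real ^ 2) set" where
  "int_lattice = {z. \<forall>i. z $ i \<in> \<int>}"

lemma int_lattice_simps [simp]:
  "0 \<in> int_lattice" "x \<in> int_lattice \<Longrightarrow> - x \<in> int_lattice"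
  "x \<in> int_lattice \<Longrightarrow> y \<in> int_lattice \<Longrightarrow> x + y \<in> int_lattice"
  "x \<in> int_lattice \<Longrightarrow> y \<in> int_lattice \<Longrightarrow> x - y \<in> int_lattice"
  "x \<in> int_lattice \<Longrightarrow> of_int m *\<^sub>R x \<in> int_lattice"
  "x \<in> int_lattice \<Longrightarrow> of_nat n *\<^sub>R x \<in> int_lattice"
  by (auto simp: int_lattice_def intro!: Ints_mult)

lemma torus_proj_lattice: "torus_proj x = torus_proj y \<longleftrightarrow> x - y \<in> int_lattice"
  by (simp add: torus_proj_eq_iff int_lattice_def)

lemma surj_torus_proj: "\<exists>x. torus_proj x = y"
  unfolding torus_proj_def by (induct y rule: torus.abs_induct) auto

lemma continuous_on_torus_proj: "continuous_on S torus_proj"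
  by (rule continuous_on_subset[of UNIV])
     (auto simp: continuous_on_open_vimage open_torus_def)

lemma continuous_on_torus_descend:
  assumes "continuous_on UNIV f" and "\<And>x. h (torus_proj x) = f x"
  shows "continuous_on UNIV h"
proof -
  have "torus_proj -` (h -` U) = f -` U" for U using assms(2) by auto
  then show ?thesis using assms(1)
    by (simp add: continuous_on_open_vimage open_torus_def)
qed

lemma continuous_Ints_constant:
  fixes f :: "real \<Rightarrow> real"
  assumes "continuous_on {a..b} f" and "\<And>t. t \<in> {a..b} \<Longrightarrow> f t \<in> \<int>" and "s \<in> {a..b}" "t \<in> {a..b}"
  shows "f s = f t"
proof -
  have "f constant_on {a..b}"
  proof (rule continuous_discrete_range_constant)
    fix x assume x: "x \<in> {a..b}"
    have "1 \<le> norm (f y - f x)" if "y \<in> {a..b}" "f y \<noteq> f x" for y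
      using Ints_nonzero_abs_ge1[of "f y - f x"] assms(2)[of y] assms(2)[of x] that x by auto
    then show "\<exists>e>0. \<forall>y. y \<in> {a..b} \<and> f y \<noteq> f x \<longrightarrow> e \<le> norm (f y - f x)"
      by (intro exI[of _ 1]) auto
  qed (use assms in auto)
  then show ?thesis using assms by (auto simp: constant_on_def)
qed

text \<open>Uniqueness of logarithms along a path, in the form needed for winding numbers: the
  imaginary part over \<open>2 * pi\<close> is continuous and integer-valued.\<close>

lemma exp_eq_1_constant:
  fixes u :: "real \<Rightarrow> complex"
  assumes "continuous_on {0..1} u" and "\<And>t. t \<in> {0..1} \<Longrightarrow> exp (u t) = 1"
  shows "u 0 = u 1"
proof -
  have "Im (u 0) / (2 * pi) = Im (u 1) / (2 * pi)"
  proof (rule continuous_Ints_constant[of 0 1 "\<lambda>t. Im (u t) / (2 * pi)"])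
    show "continuous_on {0..1} (\<lambda>t. Im (u t) / (2 * pi))"
      by (intro continuous_intros assms) auto
    fix t :: real assume "t \<in> {0..1}"
    then obtain n :: int where "Im (u t) = of_int (2 * n) * pi"
      using assms(2)[of t] by (auto simp: exp_eq_1)
    then show "Im (u t) / (2 * pi) \<in> \<int>" by simp
  qed auto
  moreover have "Re (u 0) = 0" "Re (u 1) = 0" using assms(2)[of 0] assms(2)[of 1]
    by (auto simp: exp_eq_1)
  ultimately show ?thesis by (auto simp: complex_eq_iff)
qed

text \<open>A winding number argument for each coordinate. A null homotopy of the projected loop,
  mapped to the punctured plane by the character \<open>E\<close>, has a logarithm \<open>g\<close>
  on the square; the increment of \<open>g\<close> around the loop is constant during the homotopy
  and 0 at the constant end. Along \<open>c\<close> it equals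
  \<open>2 * pi * \<i> * (c 1 $ j - c 0 $ j)\<close>.\<close>

lemma projected_path_not_contractible:
  fixes c :: "real \<Rightarrow> real ^ 2"
  assumes cont: "continuous_on {0..1} c" and hom: "homotopic_loops UNIV (torus_proj \<circ> c) (\<lambda>_. y)"
  shows "c 1 = c 0"
proof -
  have "c 0 $ j = c 1 $ j" for j
  proof -
    \<comment> \<open>The representative picked by \<open>SOME\<close> is arbitrary, but two of them
      differ by an integer in coordinate \<open>j\<close>, which the exponential does not
      see.\<close>
    define E where "E y = exp (2 * pi * \<i> * of_real ((SOME x. torus_proj x = y) $ j))" for y
    have E: "E (torus_proj x) = exp (2 * pi * \<i> * of_real (x $ j))" for x
    proof -
      define x' where "x' = (SOME x'. torus_proj x' = torus_proj x)"
      have "torus_proj x' = torus_proj x" unfolding x'_def by (rule someI) simp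
      then have "x' $ j - x $ j \<in> \<int>" by (simp add: torus_proj_eq_iff)
      then obtain n where "x' $ j - x $ j = of_int n" by (auto elim: Ints_cases)
      then have "x' $ j = x $ j + of_int n" by simp
      then have "exp (2 * pi * \<i> * of_real (x' $ j)) = exp (2 * pi * \<i> * of_real (x $ j))"
        unfolding exp_eq by (intro exI[of _ n]) (simp add: algebra_simps)
      then show ?thesis unfolding E_def x'_def .
    qed
    have "continuous_on UNIV E"
    proof (rule continuous_on_torus_descend)
      show "continuous_on UNIV (\<lambda>x::real^2. exp (2 * pi * \<i> * of_real (x $ j)))"
        by (intro continuous_intros)
    qed (rule E)
    moreover have "E \<in> UNIV \<rightarrow> - {0}" by (auto simp: E_def)
    ultimately have "homotopic_loops (- {0}) (E \<circ> (torus_proj \<circ> c)) (E \<circ> (\<lambda>_. y))"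
      using homotopic_loops_continuous_image[OF hom] by blast
    then obtain h where h: "continuous_on ({0..1::real} \<times> {0..1::real}) h"
      "h \<in> ({0..1} \<times> {0..1}) \<rightarrow> - {0}" "\<And>t. t \<in> {0..1} \<Longrightarrow> h (0, t) = E (torus_proj (c t))"
      "\<And>t. t \<in> {0..1} \<Longrightarrow> h (1, t) = E y" "\<And>s. s \<in> {0..1} \<Longrightarrow> h (s, 1) = h (s, 0)"
      unfolding homotopic_loops by (auto simp: pathfinish_def pathstart_def)
    have "contractible ({0..1::real} \<times> {0..1::real})"
      by (intro convex_imp_contractible convex_Times) auto
    then obtain g where g: "continuous_on ({0..1} \<times> {0..1}) g"
      "\<And>x. x \<in> {0..1} \<times> {0..1} \<Longrightarrow> h x = exp (g x)"
      using continuous_logarithm_on_contractible[OF h(1)] h(2) by blast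
    have c1: "continuous_on {0..1} (\<lambda>t. g (s, t))" "continuous_on {0..1} (\<lambda>t. g (t, s))"
      if "s \<in> {0..1}" for s
    proof -
      show "continuous_on {0..1} (\<lambda>t. g (s, t))"
        by (rule continuous_on_compose2[OF g(1)]) (use that in \<open>auto intro!: continuous_intros\<close>)
      show "continuous_on {0..1} (\<lambda>t. g (t, s))"
        by (rule continuous_on_compose2[OF g(1)]) (use that in \<open>auto intro!: continuous_intros\<close>)
    qed
    have "g (0, 1) - g (0, 0) = g (1, 1) - g (1, 0)"
    proof (rule exp_eq_1_constant[of "\<lambda>s. g (s, 1) - g (s, 0)"])
      show "continuous_on {0..1} (\<lambda>s. g (s, 1) - g (s, 0))" by (intro continuous_intros c1) auto
      fix s :: real assume "s \<in> {0..1}"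
      then show "exp (g (s, 1) - g (s, 0)) = 1"
        using h(5)[of s] g(2)[of "(s,1)"] g(2)[of "(s,0)"] by (simp add: exp_diff)
    qed
    also have "\<dots> = 0"
    proof -
      have "g (1, 0) - g (1, 0) = g (1, 1) - g (1, 0)"
      proof (rule exp_eq_1_constant[of "\<lambda>s. g (1, s) - g (1, 0)"])
        show "continuous_on {0..1} (\<lambda>s. g (1, s) - g (1, 0))" by (intro continuous_intros c1) auto
        fix s :: real assume "s \<in> {0..1}"
        then show "exp (g (1, s) - g (1, 0)) = 1"
          using h(4)[of s] h(4)[of 0] g(2)[of "(1,s)"] g(2)[of "(1,0)"]
          by (simp add: exp_diff) (simp add: E_def)
      qed
      then show ?thesis by simp
    qed
    finally have g01: "g (0, 1) = g (0, 0)" by simp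
    have "g (0, 0) - 2 * pi * \<i> * of_real (c 0 $ j) = g (0, 1) - 2 * pi * \<i> * of_real (c 1 $ j)"
    proof (rule exp_eq_1_constant[of "\<lambda>t. g (0, t) - 2 * pi * \<i> * of_real (c t $ j)"])
      show "continuous_on {0..1} (\<lambda>t. g (0, t) - 2 * pi * \<i> * of_real (c t $ j))"
        by (intro continuous_intros c1 cont) auto
      fix t :: real assume "t \<in> {0..1}"
      then show "exp (g (0, t) - 2 * pi * \<i> * of_real (c t $ j)) = 1"
        using h(3)[of t] g(2)[of "(0,t)"] E by (simp add: exp_diff)
    qed
    then show "c 0 $ j = c 1 $ j" using g01 by simp
  qed
  then show ?thesis by (simp add: vec_eq_iff)
qed

section \<open>Lengths of polygons\<close>

definition seglen :: "(real ^ 2 \<Rightarrow> real ^ 2 \<Rightarrow> real) \<Rightarrow> real ^ 2 \<Rightarrow> real ^ 2 \<Rightarrow> real" where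
  "seglen G x y = integral {0..1} (\<lambda>t. G (x + t *\<^sub>R (y - x)) (y - x))"

definition broken_line :: "(nat \<Rightarrow> real ^ 2) \<Rightarrow> real \<Rightarrow> real ^ 2" where
  "broken_line P t = P (nat \<lfloor>t\<rfloor>) + (t - real_of_int \<lfloor>t\<rfloor>) *\<^sub>R (P (Suc (nat \<lfloor>t\<rfloor>)) - P (nat \<lfloor>t\<rfloor>))"

lemma broken_line_segment:
  assumes "real i \<le> t" "t \<le> 1 + real i"
  shows "broken_line P t = P i + (t - real i) *\<^sub>R (P (Suc i) - P i)"
proof (cases "t = real (Suc i)")
  \<comment> \<open>At the right end \<open>floor\<close> already selects the next edge, which
    starts at the same vertex.\<close>
  case True
  then have "\<lfloor>t\<rfloor> = int (Suc i)" by (simp add: floor_eq_iff)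
  then have "nat \<lfloor>t\<rfloor> = Suc i" "real_of_int \<lfloor>t\<rfloor> = t" using True by auto
  then show ?thesis using True by (simp add: broken_line_def)
next
  case False
  then have "\<lfloor>t\<rfloor> = int i" using assms by (simp add: floor_eq_iff)
  then show ?thesis by (simp add: broken_line_def)
qed

lemma broken_line_of_nat [simp]: "broken_line P (real i) = P i"
  using broken_line_segment[of i "real i" P] by simp

lemma continuous_on_broken_line: "continuous_on {0..real n} (broken_line P)"
proof (induction n)
  case 0 then show ?case by simp
next
  case (Suc n)
  have "continuous_on {real n..real (Suc n)} (broken_line P)"
  proof (rule continuous_on_eq)
    show "continuous_on {real n..real (Suc n)} (\<lambda>t. P n + (t - real n) *\<^sub>R (P (Suc n) - P n))"
      by (intro continuous_intros)
  qed (auto simp: broken_line_segment[of n])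
  then have "continuous_on ({0..real n} \<union> {real n..real (Suc n)}) (broken_line P)"
    using Suc by (intro continuous_on_closed_Un) auto
  moreover have "{0..real n} \<union> {real n..real (Suc n)} = {0..real (Suc n)}" by auto
  ultimately show ?case by simp
qed

lemma smooth_curve_affine: "smooth_curve a b (\<lambda>t. p + (t - t0) *\<^sub>R v)"
proof -
  define D where "D k = (if k = 0 then (\<lambda>t. p + (t - t0) *\<^sub>R v) else if k = Suc 0 then (\<lambda>_. v) else (\<lambda>_. 0))" for k
  have "D 0 = (\<lambda>t. p + (t - t0) *\<^sub>R v)" by (simp add: D_def)
  moreover have "(D k has_vector_derivative D (Suc k) t) (at t within {a..b})" for k t
    by (auto simp: D_def intro!: derivative_eq_intros)
  ultimately show ?thesis unfolding smooth_curve_def by blast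
qed

lemma finsler_metric_lift_continuous:
  assumes "finsler_metric F"
  shows "continuous_on UNIV (\<lambda>(x, v). finsler_lift F x v)"
proof -
  have "continuous_on UNIV (\<lambda>(x, v). F x v)" using assms by (simp add: finsler_metric_def)
  then have "continuous_on UNIV ((\<lambda>(x, v). F x v) \<circ> (\<lambda>(x, v). (torus_proj x, v)))"
    by (intro continuous_on_compose)
       (auto simp: case_prod_unfold intro!: continuous_intros continuous_on_compose2[OF continuous_on_torus_proj] elim: continuous_on_subset)
  then show ?thesis by (simp add: finsler_lift_def o_def case_prod_unfold)
qed

lemma finsler_metric_nonneg:
  assumes "finsler_metric F"
  shows "0 \<le> F x v"
proof (cases "v = 0")
  case True
  have "F x (0 *\<^sub>R v) = 0 * F x v" using assms unfolding finsler_metric_def nonsym_norm_def by blast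
  then show ?thesis using True by simp
qed (use assms in \<open>auto simp: finsler_metric_def nonsym_norm_def less_imp_le\<close>)

lemma finsler_length_nonneg:
  assumes "finsler_metric F"
  shows "0 \<le> finsler_length F a b \<gamma>"
\<comment> \<open>If the speed is not integrable, the integral takes its default value 0.\<close>
proof (cases "(\<lambda>t. F (\<gamma> t) (torus_velocity \<gamma> t)) integrable_on {a..b}")
  case True
  then show ?thesis
    unfolding finsler_length_def by (intro integral_nonneg finsler_metric_nonneg[OF assms])
qed (simp add: finsler_length_def not_integrable_integral)

lemma has_torus_velocity_projI:
  assumes "a < t" "t < b" "\<And>s. s \<in> {a..b} \<Longrightarrow> \<gamma> s = torus_proj (g s)"
    and "(g has_vector_derivative v) (at t)"
  shows "has_torus_velocity \<gamma> v t"
  unfolding has_torus_velocity_def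
proof (rule exI[of _ g], intro conjI assms(4))
  have "\<forall>\<^sub>F s in nhds t. s \<in> {a<..<b}" using assms by (intro eventually_nhds_in_open) auto
  then show "\<forall>\<^sub>F s in nhds t. \<gamma> s = torus_proj (g s)"
    by (rule eventually_mono) (use assms(3) in auto)
qed

text \<open>Stated with \<open>has_integral\<close>, so that edges can be joined one at a time. The
  velocity is unspecified at the vertices, hence the comparison only on open intervals.\<close>

lemma finsler_length_broken_line:
  assumes F: "finsler_metric F"
  shows "((\<lambda>t. F (torus_proj (broken_line P t)) (torus_velocity (torus_proj \<circ> broken_line P) t))
    has_integral (\<Sum>i<n. seglen (finsler_lift F) (P i) (P (Suc i)))) {0..real n}"
    (is "(?f has_integral _) _")
proof (induction n)
  case 0 show ?case by (simp add: has_integral_refl)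
next
  case (Suc n)
  let ?w = "P (Suc n) - P n"
  let ?h = "\<lambda>t. finsler_lift F (P n + t *\<^sub>R ?w) ?w"
  have "continuous_on {0..1} (\<lambda>t. (\<lambda>(x, v). finsler_lift F x v) (P n + t *\<^sub>R ?w, ?w))"
    by (rule continuous_on_compose2[OF finsler_metric_lift_continuous[OF F]]) (auto intro!: continuous_intros)
  then have "?h integrable_on {0..1}" by (simp add: integrable_continuous_real)
  then have "(?h has_integral seglen (finsler_lift F) (P n) (P (Suc n))) (cbox 0 1)"
    by (simp add: seglen_def has_integral_integral)
  from has_integral_affinity'[OF this, of 1 "- real n"]
  have 1: "((\<lambda>t. ?h (t - real n)) has_integral seglen (finsler_lift F) (P n) (P (Suc n)))
      (cbox (real n) (real (Suc n)))" by (simp add: add.commute)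
  have "(?f has_integral seglen (finsler_lift F) (P n) (P (Suc n))) (cbox (real n) (real (Suc n)))"
  proof (rule has_integral_spike_interior[OF 1])
    fix t assume t: "t \<in> box (real n) (real (Suc n))"
    have "has_torus_velocity (torus_proj \<circ> broken_line P) ?w t"
    proof (rule has_torus_velocity_projI)
      show "real n < t" "t < real (Suc n)" using t by (auto simp: mem_box)
      show "(torus_proj \<circ> broken_line P) s = torus_proj (P n + (s - real n) *\<^sub>R ?w)"
        if "s \<in> {real n..real (Suc n)}" for s
        using that by (simp add: broken_line_segment[of n])
    qed (auto intro!: derivative_eq_intros)
    then show "?f t = ?h (t - real n)"
      using t by (simp add: torus_velocity_eq broken_line_segment[of n] finsler_lift_def mem_box)
  qed
  then have "(?f has_integral seglen (finsler_lift F) (P n) (P (Suc n))) {real n..real (Suc n)}"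
    by simp
  from has_integral_combine[OF _ _ Suc this] show ?case by (simp add: o_def)
qed

lemma polygon_length_in_systole_set:
  assumes F: "finsler_metric F" and z: "P n - P 0 \<in> int_lattice" "P n \<noteq> P 0"
  shows "(\<Sum>i<n. seglen (finsler_lift F) (P i) (P (Suc i))) \<in>
     {finsler_length F a b \<gamma> | a b \<gamma>. closed_curve a b \<gamma> \<and> \<not> contractible_curve a b \<gamma>}"
proof -
  have n: "n > 0" using z by (metis gr0I)
  define \<gamma> where "\<gamma> = torus_proj \<circ> broken_line P"
  have "(\<Sum>i<n. seglen (finsler_lift F) (P i) (P (Suc i))) = finsler_length F 0 (real n) \<gamma>"
    using finsler_length_broken_line[OF F, of P n]
    by (simp add: finsler_length_def \<gamma>_def integral_unique)
  moreover have "piecewise_smooth_torus 0 (real n) \<gamma>"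
    unfolding piecewise_smooth_torus_def
  proof (intro exI[of _ n] exI[of _ real] conjI allI impI)
    fix i assume "i < n"
    show "\<exists>g. smooth_curve (real i) (real (Suc i)) g \<and> (\<forall>t\<in>{real i..real (Suc i)}. \<gamma> t = torus_proj (g t))"
      by (rule exI[of _ "\<lambda>t. P i + (t - real i) *\<^sub>R (P (Suc i) - P i)"])
         (auto simp: \<gamma>_def broken_line_segment[of i] smooth_curve_affine)
  qed auto
  moreover have "\<gamma> 0 = \<gamma> (real n)"
  proof -
    have "broken_line P 0 = P 0" using broken_line_of_nat[of P 0] by simp
    then show ?thesis using z int_lattice_simps(2)[OF z(1)] by (simp add: \<gamma>_def torus_proj_lattice)
  qed
  moreover have "\<not> contractible_curve 0 (real n) \<gamma>"
  proof
    assume "contractible_curve 0 (real n) \<gamma>"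
    then obtain y where y: "homotopic_loops UNIV (torus_proj \<circ> (broken_line P \<circ> linepath 0 (real n))) (\<lambda>_. y)"
      by (auto simp: contractible_curve_def \<gamma>_def o_assoc)
    have "continuous_on {0..1} (broken_line P \<circ> linepath 0 (real n))"
    proof (intro continuous_on_compose)
      show "continuous_on (linepath 0 (real n) ` {0..1}) (broken_line P)"
        by (rule continuous_on_subset[OF continuous_on_broken_line[of n]])
           (auto simp: linepath_def mult_left_le_one_le)
    qed (auto simp: linepath_def intro!: continuous_intros)
    from projected_path_not_contractible[OF this y] show False
      using z broken_line_of_nat[of P 0] by (simp add: linepath_def)
  qed
  ultimately show "(\<Sum>i<n. seglen (finsler_lift F) (P i) (P (Suc i))) \<in>
     {finsler_length F a b \<gamma> | a b \<gamma>. closed_curve a b \<gamma> \<and> \<not> contractible_curve a b \<gamma>}"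
    using n unfolding closed_curve_def mem_Collect_eq
    by (intro exI[of _ 0] exI[of _ "real n"] exI[of _ \<gamma>]) simp
qed

text \<open>The area bound uses the systole only through this estimate and its nonnegativity;
  general curves reappear only for the supremum norm.\<close>

lemma systole_le_polygon:
  assumes F: "finsler_metric F" and z: "P n - P 0 \<in> int_lattice" "P n \<noteq> P 0"
  shows "systole F \<le> (\<Sum>i<n. seglen (finsler_lift F) (P i) (P (Suc i)))"
  unfolding systole_def
proof (rule cInf_lower[OF polygon_length_in_systole_set[OF assms]])
  show "bdd_below {finsler_length F a b \<gamma> | a b \<gamma>. closed_curve a b \<gamma> \<and> \<not> contractible_curve a b \<gamma>}"
    by (rule bdd_belowI[of _ 0]) (auto simp: finsler_length_nonneg[OF F])
qed

lemma systole_ge: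
  assumes F: "finsler_metric F"
    and "\<And>a b \<gamma>. closed_curve a b \<gamma> \<Longrightarrow> \<not> contractible_curve a b \<gamma> \<Longrightarrow> u \<le> finsler_length F a b \<gamma>"
  shows "u \<le> systole F"
  unfolding systole_def
proof (rule cInf_greatest)
  \<comment> \<open>A horizontal unit segment shows that the infimum is not taken over the empty
    set.\<close>
  define P :: "nat \<Rightarrow> real ^ 2" where "P i = real i *\<^sub>R axis 1 1" for i
  have "P 1 - P 0 \<in> int_lattice" by (simp add: P_def int_lattice_def axis_def)
  moreover have "P 1 \<noteq> P 0" by (simp add: P_def axis_eq_0_iff)
  ultimately have "P 1 - P 0 \<in> int_lattice" "P 1 \<noteq> P 0" .
  from polygon_length_in_systole_set[OF F this]
  show "{finsler_length F a b \<gamma> | a b \<gamma>. closed_curve a b \<gamma> \<and> \<not> contractible_curve a b \<gamma>} \<noteq> {}"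
    by blast
qed (use assms in auto)

lemma systole_nonneg: "finsler_metric F \<Longrightarrow> 0 \<le> systole F"
  by (rule systole_ge) (auto simp: finsler_length_nonneg)

section \<open>The distance of a periodic metric\<close>

lemma int_lattice_translate:
  fixes x :: "real ^ 2"
  obtains z where "z \<in> int_lattice" "norm (x - z) \<le> 2"
proof
  define z :: "real ^ 2" where "z = (\<chi> i. of_int \<lfloor>x $ i\<rfloor>)"
  show "z \<in> int_lattice" by (simp add: z_def int_lattice_def)
  have "norm (x - z) \<le> (\<Sum>i\<in>UNIV. \<bar>(x - z) $ i\<bar>)" by (rule norm_le_l1_cart)
  also have "\<dots> \<le> (\<Sum>i\<in>(UNIV :: 2 set). 1)"
    by (rule sum_mono) (simp add: z_def abs_le_iff, linarith)
  finally show "norm (x - z) \<le> 2" by simp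
qed

section \<open>Periodic metrics on the plane and their polygonal distance\<close>

locale periodic_metric =
  fixes G :: "real ^ 2 \<Rightarrow> real ^ 2 \<Rightarrow> real"
  assumes continuous: "continuous_on UNIV (\<lambda>(x, v). G x v)"
    and pos: "v \<noteq> 0 \<Longrightarrow> 0 < G x v"
    and homogeneous: "0 \<le> c \<Longrightarrow> G x (c *\<^sub>R v) = c * G x v"
    and even: "G x (- v) = G x v"
    and periodic: "z \<in> int_lattice \<Longrightarrow> G (x + z) v = G x v"
begin

lemma zero [simp]: "G x 0 = 0"
  using homogeneous[of 0 x 0] by simp

lemma nonneg: "0 \<le> G x v"
  using pos[of v x] by (cases "v = 0") auto

lemma continuous_on_G [continuous_intros]:
  assumes "continuous_on S f" "continuous_on S g"
  shows "continuous_on S (\<lambda>t. G (f t) (g t))"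
  using continuous_on_compose2[OF continuous continuous_on_Pair[OF assms]] by simp

text \<open>Periodicity and homogeneity reduce everything to base points in a ball and unit vectors,
  a compact set. Uniform continuity gives an additive error there, which the lower bound
  \<open>m\<close> makes multiplicative.\<close>

lemma bounds_and_comparison:
  shows "\<exists>m>0. \<forall>x v. m * norm v \<le> G x v"
    and "\<exists>M>0. \<forall>x v. G x v \<le> M * norm v"
    and "\<delta> > 0 \<Longrightarrow> \<exists>\<rho>>0. \<forall>x y v. dist x y < \<rho> \<longrightarrow> G y v \<le> (1 + \<delta>) * G x v"
proof -
  \<comment> \<open>A base point can be translated into radius 2; a second one at distance less than
    1 then stays within radius 3.\<close>
  let ?C = "cball (0::real^2) 3 \<times> sphere (0::real^2) 1"
  have comp: "compact ?C" by (intro compact_Times) auto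
  have cont: "continuous_on ?C (\<lambda>(x, v). G x v)" by (rule continuous_on_subset[OF continuous]) simp
  have "axis 1 1 \<in> sphere (0::real^2) 1" by (simp add: norm_axis_1)
  then have ne: "?C \<noteq> {}" by auto
  have scale: "G x v = norm v * G x (v /\<^sub>R norm v)" for x v
    using homogeneous[of "norm v" x "v /\<^sub>R norm v"] by (cases "v = 0") auto
  have sph: "v /\<^sub>R norm v \<in> sphere 0 1" if "v \<noteq> 0" for v :: "real^2" using that by simp
  obtain p where p: "p \<in> ?C" "\<And>q. q \<in> ?C \<Longrightarrow> (\<lambda>(x, v). G x v) p \<le> (\<lambda>(x, v). G x v) q"
    using continuous_attains_inf[OF comp ne cont] by blast
  obtain P where P: "P \<in> ?C" "\<And>q. q \<in> ?C \<Longrightarrow> (\<lambda>(x, v). G x v) q \<le> (\<lambda>(x, v). G x v) P"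
    using continuous_attains_sup[OF comp ne cont] by blast
  define m where "m = G (fst p) (snd p)"
  define M where "M = G (fst P) (snd P)"
  have m0: "m > 0" unfolding m_def using p(1) by (intro pos) auto
  have M0: "M > 0" unfolding M_def using P(1) by (intro pos) auto
  have mM: "m \<le> G x v \<and> G x v \<le> M" if "v \<in> sphere 0 1" for x v
  proof -
    obtain z where z: "z \<in> int_lattice" "norm (x - z) \<le> 2" by (rule int_lattice_translate)
    then have "(x - z, v) \<in> ?C" using that by auto
    moreover have "G (x - z) v = G x v" using periodic[OF z(1), of "x - z" v] by simp
    ultimately show ?thesis using p(2)[of "(x - z, v)"] P(2)[of "(x - z, v)"]
      by (simp add: m_def M_def case_prod_unfold)
  qed
  have "m * norm v \<le> G x v" for x v
  proof (cases "v = 0")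
    case False
    then have "norm v * m \<le> norm v * G x (v /\<^sub>R norm v)"
      using mM[OF sph, of v x] by (intro mult_left_mono) auto
    then show ?thesis using scale[of x v] by (simp add: mult.commute)
  qed auto
  then show "\<exists>m>0. \<forall>x v. m * norm v \<le> G x v" using m0 by blast
  have "G x v \<le> M * norm v" for x v
  proof (cases "v = 0")
    case False
    then have "norm v * G x (v /\<^sub>R norm v) \<le> norm v * M"
      using mM[OF sph, of v x] by (intro mult_left_mono) auto
    then show ?thesis using scale[of x v] by (simp add: mult.commute)
  qed auto
  then show "\<exists>M>0. \<forall>x v. G x v \<le> M * norm v" using M0 by blast
  assume \<delta>: "\<delta> > 0"
  have "uniformly_continuous_on ?C (\<lambda>(x, v). G x v)"
    by (rule compact_uniformly_continuous[OF cont comp])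
  then obtain \<rho> where \<rho>: "\<rho> > 0" "\<And>p q. p \<in> ?C \<Longrightarrow> q \<in> ?C \<Longrightarrow> dist q p < \<rho> \<Longrightarrow>
      dist ((\<lambda>(x, v). G x v) q) ((\<lambda>(x, v). G x v) p) < \<delta> * m"
    unfolding uniformly_continuous_on_def using \<delta> m0 by (metis mult_pos_pos)
  have unit: "G y v \<le> (1 + \<delta>) * G x v" if "v \<in> sphere 0 1" "dist x y < min \<rho> 1" for x y v
  proof -
    obtain z where z: "z \<in> int_lattice" "norm (x - z) \<le> 2" by (rule int_lattice_translate)
    have "norm (y - z) \<le> norm (x - z) + norm (y - x)"
      using norm_triangle_ineq[of "x - z" "y - x"] by simp
    then have C: "(x - z, v) \<in> ?C" "(y - z, v) \<in> ?C"
      using that z by (auto simp: dist_norm norm_minus_commute)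
    have eq: "G (x - z) v = G x v" "G (y - z) v = G y v"
      using periodic[OF z(1), of "x - z" v] periodic[OF z(1), of "y - z" v] by simp_all
    have "dist (y - z, v) (x - z, v) < \<rho>"
      using that by (simp add: dist_Pair_Pair dist_norm norm_minus_commute)
    from \<rho>(2)[OF C this] have "\<bar>G y v - G x v\<bar> < \<delta> * m" by (simp add: eq dist_real_def)
    also have "\<delta> * m \<le> \<delta> * G x v" using mM[OF that(1), of x] \<delta> by (intro mult_left_mono) auto
    finally show ?thesis by (simp add: algebra_simps)
  qed
  have "G y v \<le> (1 + \<delta>) * G x v" if "dist x y < min \<rho> 1" for x y v
  proof (cases "v = 0")
    case False
    have "norm v * G y (v /\<^sub>R norm v) \<le> norm v * ((1 + \<delta>) * G x (v /\<^sub>R norm v))"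
      using unit[OF sph[OF False] that] by (intro mult_left_mono) auto
    then show ?thesis by (simp add: scale[of x v] scale[of y v] algebra_simps)
  qed auto
  then show "\<exists>\<rho>>0. \<forall>x y v. dist x y < \<rho> \<longrightarrow> G y v \<le> (1 + \<delta>) * G x v"
    using \<rho>(1) by (intro exI[of _ "min \<rho> 1"]) auto
qed

lemma seglen_integrable: "(\<lambda>t. G (x + t *\<^sub>R v) w) integrable_on {a..b}"
  by (intro integrable_continuous_real continuous_intros)

lemma seglen_subsegment:
  assumes "s \<le> t"
  shows "seglen G (x + s *\<^sub>R v) (x + t *\<^sub>R v) = integral {s..t} (\<lambda>r. G (x + r *\<^sub>R v) v)"
proof (cases "s = t")
  case True then show ?thesis by (simp add: seglen_def)
next
  case False
  then have st: "t - s > 0" using assms by simp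
  have "((\<lambda>r. G (x + r *\<^sub>R v) v) has_integral integral {s..t} (\<lambda>r. G (x + r *\<^sub>R v) v)) (cbox s t)"
    using seglen_integrable by (simp add: has_integral_integral)
  from has_integral_affinity'[OF this st, of s]
  have "((\<lambda>r. G (x + ((t - s) * r + s) *\<^sub>R v) v) has_integral
      (integral {s..t} (\<lambda>r. G (x + r *\<^sub>R v) v) /\<^sub>R (t - s))) {0..1}" using st by simp
  from has_integral_mult_right[OF this, of "t - s"]
  have "((\<lambda>r. (t - s) * G (x + ((t - s) * r + s) *\<^sub>R v) v) has_integral
      integral {s..t} (\<lambda>r. G (x + r *\<^sub>R v) v)) {0..1}" using st False by (simp flip: mult.assoc)
  moreover have "(t - s) * G (x + ((t - s) * r + s) *\<^sub>R v) v =
      G (x + s *\<^sub>R v + r *\<^sub>R ((x + t *\<^sub>R v) - (x + s *\<^sub>R v))) ((x + t *\<^sub>R v) - (x + s *\<^sub>R v))" for r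
    using homogeneous[of "t - s"] st by (simp add: algebra_simps)
  ultimately show ?thesis unfolding seglen_def by (simp add: integral_unique)
qed

lemma seglen_nonneg: "0 \<le> seglen G x y"
  unfolding seglen_def by (intro integral_nonneg seglen_integrable nonneg)

lemma seglen_refl [simp]: "seglen G x x = 0"
  by (simp add: seglen_def)

lemma seglen_le:
  assumes "\<And>t. t \<in> {0..1} \<Longrightarrow> G (x + t *\<^sub>R (y - x)) (y - x) \<le> u"
  shows "seglen G x y \<le> u"
proof -
  have "seglen G x y \<le> integral {0..1} (\<lambda>t::real. u)"
    unfolding seglen_def by (intro integral_le seglen_integrable assms) auto
  then show ?thesis by simp
qed

lemma seglen_ge:
  assumes "\<And>t. t \<in> {0..1} \<Longrightarrow> u \<le> G (x + t *\<^sub>R (y - x)) (y - x)"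
  shows "u \<le> seglen G x y"
proof -
  have "integral {0..1} (\<lambda>t::real. u) \<le> seglen G x y"
    unfolding seglen_def by (intro integral_le seglen_integrable assms) auto
  then show ?thesis by simp
qed

lemma seglen_translate: "z \<in> int_lattice \<Longrightarrow> seglen G (x + z) (y + z) = seglen G x y"
proof -
  assume z: "z \<in> int_lattice"
  have "G (x + z + t *\<^sub>R (y - x)) (y - x) = G (x + t *\<^sub>R (y - x)) (y - x)" for t
    using periodic[OF z, of "x + t *\<^sub>R (y - x)"] by (simp add: algebra_simps)
  then show ?thesis by (simp add: seglen_def)
qed

text \<open>This is where evenness makes the distance symmetric.\<close>

lemma seglen_commute: "seglen G y x = seglen G x y"
proof -
  have "((\<lambda>t. G (x + t *\<^sub>R (y - x)) (y - x)) has_integral seglen G x y) (cbox 0 1)"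
    unfolding seglen_def using seglen_integrable[of x "y - x" "y - x" 0 1] by (simp add: has_integral_integral)
  from has_integral_affinity[OF this, of "-1" 1]
  have "((\<lambda>t. G (x + (1 - t) *\<^sub>R (y - x)) (y - x)) has_integral seglen G x y) {0..1}"
    by (simp add: image_affinity_cbox)
  moreover have "G (x + (1 - t) *\<^sub>R (y - x)) (y - x) = G (y + t *\<^sub>R (x - y)) (x - y)" for t
    using even[of _ "y - x"] by (simp add: algebra_simps)
  ultimately show ?thesis by (simp add: seglen_def integral_unique)
qed

text \<open>A polygon of length \<open>L\<close> leads from \<open>x\<close> to \<open>y\<close>. In
  inductive form, joining, reversing and translating polygons are rule inductions that need no
  parametrisation.\<close>

inductive conn :: "real ^ 2 \<Rightarrow> real ^ 2 \<Rightarrow> real \<Rightarrow> bool" where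
  refl: "conn x x 0"
| step: "conn x y L \<Longrightarrow> conn x z (L + seglen G y z)"

lemma conn_seglen: "conn x y (seglen G x y)"
  using step[OF refl[of x], of y] by simp

lemma conn_trans: "conn y z L' \<Longrightarrow> conn x y L \<Longrightarrow> conn x z (L + L')"
  by (induction rule: conn.induct) (auto simp flip: add.assoc intro: step)

lemma conn_sym: "conn x y L \<Longrightarrow> conn y x L"
proof (induction rule: conn.induct)
  case (step x y L z)
  show ?case using conn_trans[OF step.IH conn_seglen[of z y]] by (simp add: seglen_commute add.commute)
qed (rule refl)

lemma conn_translate: "conn x y L \<Longrightarrow> z \<in> int_lattice \<Longrightarrow> conn (x + z) (y + z) L"
proof (induction rule: conn.induct)
  case (step x y L w)
  then show ?case using conn.step[of "x + z" "y + z" L "w + z"] by (simp add: seglen_translate)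
qed (rule refl)

lemma conn_nonneg: "conn x y L \<Longrightarrow> 0 \<le> L"
  by (induction rule: conn.induct) (auto simp: seglen_nonneg)

lemma conn_polygon:
  "conn x y L \<Longrightarrow> \<exists>P n. P 0 = x \<and> P n = y \<and> (\<Sum>i<n. seglen G (P i) (P (Suc i))) = L"
proof (induction rule: conn.induct)
  case (refl x)
  show ?case by (intro exI[of _ "\<lambda>_. x"] exI[of _ 0]) simp
next
  case (step x y L z)
  then obtain P n where P: "P 0 = x" "P n = y" "(\<Sum>i<n. seglen G (P i) (P (Suc i))) = L" by blast
  have "(\<Sum>i<n. seglen G ((P(Suc n := z)) i) ((P(Suc n := z)) (Suc i))) = L"
    unfolding P(3)[symmetric] by (rule sum.cong) auto
  then show ?case using P by (intro exI[of _ "P(Suc n := z)"] exI[of _ "Suc n"]) simp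
qed

definition d :: "real ^ 2 \<Rightarrow> real ^ 2 \<Rightarrow> real" where
  "d x y = Inf {L. conn x y L}"

lemma d_le: "conn x y L \<Longrightarrow> d x y \<le> L"
  unfolding d_def by (rule cInf_lower) (auto intro: bdd_belowI[of _ 0] conn_nonneg)

lemma d_ge: "(\<And>L. conn x y L \<Longrightarrow> u \<le> L) \<Longrightarrow> u \<le> d x y"
  unfolding d_def using conn_seglen by (intro cInf_greatest) auto

lemma d_lessE:
  assumes "d x y < u"
  obtains L where "conn x y L" "L < u"
  using d_ge[of x y u] assms by (meson not_le)

lemma d_nonneg: "0 \<le> d x y"
  by (rule d_ge) (rule conn_nonneg)

lemma d_seglen: "d x y \<le> seglen G x y"
  by (rule d_le[OF conn_seglen])

lemma d_refl [simp]: "d x x = 0"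
  using d_nonneg[of x x] d_seglen[of x x] by simp

lemma d_commute: "d x y = d y x"
proof -
  have "conn x y = conn y x" by (intro ext iffI) (auto intro: conn_sym)
  then show ?thesis by (simp add: d_def)
qed

lemma d_translate: "z \<in> int_lattice \<Longrightarrow> d (x + z) (y + z) = d x y"
proof -
  assume z: "z \<in> int_lattice"
  have "conn (x + z) (y + z) L \<longleftrightarrow> conn x y L" for L
    using conn_translate[of x y L z] conn_translate[of "x + z" "y + z" L "- z"] z by auto
  then show ?thesis by (simp add: d_def)
qed

lemma d_triangle: "d x z \<le> d x y + d y z"
proof -
  have "d x z - L \<le> d y z" if L: "conn x y L" for L
  proof (rule d_ge)
    fix L' assume "conn y z L'"
    from d_le[OF conn_trans[OF this L]] show "d x z - L \<le> L'" by simp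
  qed
  then have "d x z - d y z \<le> d x y" by (intro d_ge) (simp add: algebra_simps)
  then show ?thesis by simp
qed

lemma norm_le_conn:
  assumes m: "\<And>x v. m * norm v \<le> G x v" and "m \<ge> 0"
  shows "conn x y L \<Longrightarrow> m * norm (y - x) \<le> L"
proof (induction rule: conn.induct)
  case (step x y L z)
  have "m * norm (z - x) \<le> m * (norm (y - x) + norm (z - y))"
    using norm_triangle_ineq[of "y - x" "z - y"] \<open>m \<ge> 0\<close> by (intro mult_left_mono) auto
  moreover have "m * norm (z - y) \<le> seglen G y z" by (rule seglen_ge) (rule m)
  ultimately show ?case using step.IH by (simp add: algebra_simps)
qed simp

lemma d_lower: "\<exists>m>0. \<forall>x y. m * norm (y - x) \<le> d x y"
proof -
  obtain m where m: "m > 0" "\<And>x v. m * norm v \<le> G x v" using bounds_and_comparison(1) by blast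
  then have "m * norm (y - x) \<le> d x y" for x y by (intro d_ge norm_le_conn) auto
  then show ?thesis using m by blast
qed

lemma d_upper: "\<exists>M>0. \<forall>x y. d x y \<le> M * norm (y - x)"
proof -
  obtain M where M: "M > 0" "\<And>x v. G x v \<le> M * norm v" using bounds_and_comparison(2) by blast
  then have "d x y \<le> M * norm (y - x)" for x y
    by (intro order_trans[OF d_seglen] seglen_le) auto
  then show ?thesis using M by blast
qed

text \<open>The chord argument needs a continuous path, and the cut falls anywhere inside an edge.
  The length function \<open>\<Lambda>\<close> bounds the distance between any two points of the
  path, so that pieces can be estimated without being polygons themselves.\<close>

lemma conn_path:
  "conn x y L \<Longrightarrow> \<exists>c \<Lambda>. path c \<and> pathstart c = x \<and> pathfinish c = y \<and> \<Lambda> 0 = 0 \<and> \<Lambda> 1 = L \<and>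
     (\<forall>s t. 0 \<le> s \<and> s \<le> t \<and> t \<le> 1 \<longrightarrow> d (c s) (c t) \<le> \<Lambda> t - \<Lambda> s)"
proof (induction rule: conn.induct)
  case (refl x)
  show ?case by (intro exI[of _ "\<lambda>_. x"] exI[of _ "\<lambda>_. 0"]) (auto simp: path_def pathstart_def pathfinish_def)
next
  case (step x y L z)
  then obtain c \<Lambda> where c: "path c" "pathstart c = x" "pathfinish c = y" "\<Lambda> 0 = 0" "\<Lambda> 1 = L"
    "\<And>s t. 0 \<le> s \<Longrightarrow> s \<le> t \<Longrightarrow> t \<le> 1 \<Longrightarrow> d (c s) (c t) \<le> \<Lambda> t - \<Lambda> s" by blast
  define l where "l t = integral {0..t} (\<lambda>r. G (y + r *\<^sub>R (z - y)) (z - y))" for t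
  have lp: "linepath y z t = y + t *\<^sub>R (z - y)" for t by (simp add: linepath_def algebra_simps)
  have l: "d (linepath y z s) (linepath y z t) \<le> l t - l s" if "0 \<le> s" "s \<le> t" "t \<le> 1" for s t
  proof -
    have "l s + integral {s..t} (\<lambda>r. G (y + r *\<^sub>R (z - y)) (z - y)) = l t"
      unfolding l_def by (rule Henstock_Kurzweil_Integration.integral_combine) (use that seglen_integrable in auto)
    then show ?thesis
      using d_seglen[of "linepath y z s" "linepath y z t"] seglen_subsegment[OF that(2), of y "z - y"]
      by (simp add: lp)
  qed
  have l01: "l 0 = 0" "l 1 = seglen G y z" by (simp_all add: l_def seglen_def)
  define \<Lambda>' where "\<Lambda>' t = (if t \<le> 1/2 then \<Lambda> (2 * t) else L + l (2 * t - 1))" for t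
  have c1: "c 1 = y" using c(3) by (simp add: pathfinish_def)
  have ly: "linepath y z 0 = y" by (simp add: linepath_def)
  have "d ((c +++ linepath y z) s) ((c +++ linepath y z) t) \<le> \<Lambda>' t - \<Lambda>' s"
    if st: "0 \<le> s" "s \<le> t" "t \<le> 1" for s t
  proof -
    consider "t \<le> 1/2" | "s \<le> 1/2" "1/2 < t" | "1/2 < s" using st by linarith
    then show ?thesis
    proof cases
      case 1 then show ?thesis using st c(6)[of "2 * s" "2 * t"] by (simp add: joinpaths_def \<Lambda>'_def)
    next
      case 2
      have "d (c (2 * s)) (linepath y z (2 * t-1)) \<le> d (c (2 * s)) y + d y (linepath y z (2 * t-1))"
        by (rule d_triangle)
      also have "\<dots> \<le> (L - \<Lambda> (2 * s)) + (l (2 * t-1) - 0)"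
        using c(6)[of "2 * s" 1] l[of 0 "2 * t - 1"] 2 st c1 ly c(5) l01(1) by (intro add_mono) auto
      finally show ?thesis using 2 by (simp add: joinpaths_def \<Lambda>'_def)
    next
      case 3 then show ?thesis using st l[of "2 * s - 1" "2 * t - 1"] by (simp add: joinpaths_def \<Lambda>'_def)
    qed
  qed
  moreover have "path (c +++ linepath y z)" using c by simp
  moreover have "\<Lambda>' 0 = 0" "\<Lambda>' 1 = L + seglen G y z" by (simp_all add: \<Lambda>'_def c l01)
  ultimately show ?case using c(2)
    by (intro exI[of _ "c +++ linepath y z"] exI[of _ \<Lambda>']) simp
qed

end

text \<open>\<open>\<sigma>\<close> bounds the length of every polygon between distinct
  lattice-equivalent points; in the end it is the systole, if that is positive.\<close>

locale systolic_metric = periodic_metric +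
  fixes \<sigma> :: real
  assumes \<sigma>_pos: "\<sigma> > 0"
    and \<sigma>_le: "P n - P 0 \<in> int_lattice \<Longrightarrow> P n \<noteq> P (0 :: nat) \<Longrightarrow>
      \<sigma> \<le> (\<Sum>i<n. seglen G (P i) (P (Suc i)))"
begin

lemma \<sigma>_le_d:
  assumes "z \<in> int_lattice" "z \<noteq> 0"
  shows "\<sigma> \<le> d x (x + z)"
proof (rule d_ge)
  fix L assume "conn x (x + z) L"
  from conn_polygon[OF this] obtain P n
    where P: "P 0 = x" "P n = x + z" "(\<Sum>i<n. seglen G (P i) (P (Suc i))) = L" by blast
  then show "\<sigma> \<le> L" using \<sigma>_le[of P n] assms by auto
qed

text \<open>Division by \<open>z\<close> as a complex number turns multiples of \<open>z\<close>
  into real numbers, so \<open>lattice_chord_exists\<close> applies. The arc between the ends of the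
  chord is one piece; the two remaining arcs, brought together by a translation, are the
  other.\<close>

lemma split_at_chord:
  assumes z: "z \<in> int_lattice" "z \<noteq> 0" and k: "k \<ge> 2" and L: "conn x (x + of_int k *\<^sub>R z) L"
  shows "\<exists>m y. m \<noteq> 0 \<and> m \<noteq> k \<and> d y (y + of_int m *\<^sub>R z) + d x (x + of_int (k - m) *\<^sub>R z) \<le> L"
proof -
  obtain c \<Lambda> where c: "path c" "c 0 = x" "c 1 = x + of_int k *\<^sub>R z" and \<Lambda>: "\<Lambda> 0 = 0" "\<Lambda> 1 = L"
    "\<And>s t. 0 \<le> s \<Longrightarrow> s \<le> t \<Longrightarrow> t \<le> 1 \<Longrightarrow> d (c s) (c t) \<le> \<Lambda> t - \<Lambda> s"
    using conn_path[OF L] by (auto simp: pathstart_def pathfinish_def)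
  define \<phi> where "\<phi> (v :: real^2) = Complex (v $ 1) (v $ 2) / Complex (z $ 1) (z $ 2)" for v
  have z': "Complex (z $ 1) (z $ 2) \<noteq> 0" using z by (auto simp: complex_eq_iff vec_eq_iff forall_2)
  have \<phi>_diff: "\<phi> v - \<phi> w = \<phi> (v - w)" for v w
    by (simp add: \<phi>_def complex_diff flip: diff_divide_distrib)
  have \<phi>_scale: "\<phi> (r *\<^sub>R z) = of_real r" for r
  proof -
    have "Complex ((r *\<^sub>R z) $ 1) ((r *\<^sub>R z) $ 2) = of_real r * Complex (z $ 1) (z $ 2)"
      by (simp add: complex_eq_iff)
    then show ?thesis using z' by (simp add: \<phi>_def del: vector_scaleR_component)
  qed
  have \<phi>_inj: "v = r *\<^sub>R z" if "\<phi> v = of_real r" for v r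
  proof -
    have "Complex (v $ 1) (v $ 2) = of_real r * Complex (z $ 1) (z $ 2)"
      using that z' by (simp add: \<phi>_def field_simps)
    then show ?thesis by (simp add: complex_eq_iff vec_eq_iff forall_2)
  qed
  have "continuous_on {0..1} (\<lambda>t. \<phi> (c t))"
    using c(1) unfolding \<phi>_def path_def Complex_eq by (intro continuous_intros) (use z' in \<open>auto simp: Complex_eq\<close>)
  moreover have "\<phi> (c 1) - \<phi> (c 0) = of_int k"
    unfolding \<phi>_diff c using \<phi>_scale[of "of_int k"] by simp
  ultimately obtain s t m where st: "0 \<le> s" "s < t" "t \<le> 1" and m: "m \<noteq> 0" "m \<noteq> k"
    and eq: "\<phi> (c t) - \<phi> (c s) = of_int m"
    using lattice_chord_exists[of "\<lambda>t. \<phi> (c t)" k] k by blast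
  have ct: "c t = c s + of_int m *\<^sub>R z"
    using \<phi>_inj[of "c t - c s" "of_int m"] eq by (simp add: \<phi>_diff algebra_simps)
  \<comment> \<open>The tail is moved back by \<open>of_int m *\<^sub>R z\<close>, so that it starts
    where the first arc ends.\<close>
  have "d (c t) (x + of_int k *\<^sub>R z)
      = d (c t + of_int (- m) *\<^sub>R z) (x + of_int k *\<^sub>R z + of_int (- m) *\<^sub>R z)"
    by (rule d_translate[symmetric]) (use z in simp)
  also have "\<dots> = d (c s) (x + of_int (k - m) *\<^sub>R z)"
    by (simp add: ct algebra_simps)
  finally have "d x (x + of_int (k - m) *\<^sub>R z) \<le> d x (c s) + d (c t) (c 1)"
    using d_triangle[of x "x + of_int (k - m) *\<^sub>R z" "c s"] by (simp add: c)
  also have "\<dots> \<le> (\<Lambda> s - \<Lambda> 0) + (\<Lambda> 1 - \<Lambda> t)"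
    using \<Lambda>(3)[of 0 s] \<Lambda>(3)[of t 1] st c by (intro add_mono) auto
  finally have "d (c s) (c s + of_int m *\<^sub>R z) + d x (x + of_int (k - m) *\<^sub>R z) \<le> L"
    using \<Lambda>(3)[of s t] st \<Lambda>(1,2) by (simp add: ct)
  then show ?thesis using m by blast
qed

text \<open>Cutting a curve in the class \<open>k z\<close> at a lattice chord splits it into two curves in nonzero
  classes. Each of them is shorter than the whole by at least \<open>\<sigma>\<close>, hence induction on the length.\<close>

lemma multiple_le_d_aux:
  assumes z: "z \<in> int_lattice" "z \<noteq> 0"
  shows "d x (x + of_int k *\<^sub>R z) < real n * \<sigma> \<Longrightarrow> \<bar>of_int k\<bar> * \<sigma> \<le> d x (x + of_int k *\<^sub>R z)"
proof (induction n arbitrary: x k)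
  case 0
  then show ?case using d_nonneg[of x "x + of_int k *\<^sub>R z"] by simp
next
  case (Suc n)
  have ge1: "\<sigma> \<le> d y (y + of_int j *\<^sub>R z)" if "j \<noteq> 0" for y j
    using z that by (intro \<sigma>_le_d) auto
  have pos: "of_int k * \<sigma> \<le> d x (x + of_int k *\<^sub>R z)"
    if k: "k \<ge> 2" and lt: "d x (x + of_int k *\<^sub>R z) < real (Suc n) * \<sigma>" for x and k :: int
  proof (rule ccontr)
    assume "\<not> ?thesis"
    then have "d x (x + of_int k *\<^sub>R z) < min (of_int k * \<sigma>) (real (Suc n) * \<sigma>)" using lt by simp
    then obtain L where L: "conn x (x + of_int k *\<^sub>R z) L" "L < min (of_int k * \<sigma>) (real (Suc n) * \<sigma>)"
      by (rule d_lessE)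
    obtain m y where m: "m \<noteq> 0" "m \<noteq> k"
      and sum: "d y (y + of_int m *\<^sub>R z) + d x (x + of_int (k - m) *\<^sub>R z) \<le> L"
      using split_at_chord[OF z k L(1)] by blast
    have ge: "\<sigma> \<le> d y (y + of_int m *\<^sub>R z)" "\<sigma> \<le> d x (x + of_int (k - m) *\<^sub>R z)"
      using m by (auto intro!: ge1 simp del: of_int_diff)
    have "L < real n * \<sigma> + \<sigma>" using L(2) by (simp add: algebra_simps)
    then have lt: "d y (y + of_int m *\<^sub>R z) < real n * \<sigma>" "d x (x + of_int (k - m) *\<^sub>R z) < real n * \<sigma>"
      using ge sum by linarith+
    \<comment> \<open>\<open>m\<close> may be negative or exceed \<open>k\<close>; the absolute
      values still add up to at least \<open>k\<close>.\<close>
    have "of_int k * \<sigma> \<le> (\<bar>of_int m\<bar> + \<bar>of_int (k - m)\<bar>) * \<sigma>"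
      using \<sigma>_pos by (intro mult_right_mono) auto
    also have "\<dots> = \<bar>of_int m\<bar> * \<sigma> + \<bar>of_int (k - m)\<bar> * \<sigma>" by (simp add: algebra_simps)
    also have "\<dots> \<le> L" using Suc.IH[OF lt(1)] Suc.IH[OF lt(2)] sum by linarith
    finally show False using L(2) by simp
  qed
  consider "k = 0" | "\<bar>k\<bar> = 1" | "k \<ge> 2" | "- k \<ge> 2" by linarith
  then show ?case
  proof cases
    case 1 then show ?thesis by (simp add: d_nonneg)
  next
    case 2
    then have "\<bar>of_int k :: real\<bar> = 1" by (simp flip: of_int_abs)
    then show ?thesis using ge1[of k x] 2 by auto
  next
    case 3 then show ?thesis using pos[OF 3 Suc.prems] by simp
  next
    case 4
    define y where "y = x + of_int k *\<^sub>R z"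
    have "d y (y + of_int (- k) *\<^sub>R z) = d x (x + of_int k *\<^sub>R z)"
      by (simp add: y_def d_commute)
    then show ?thesis using pos[OF 4, of y] Suc.prems 4 by simp
  qed
qed

lemma multiple_le_d:
  assumes z: "z \<in> int_lattice" "z \<noteq> 0"
  shows "\<bar>of_int k\<bar> * \<sigma> \<le> d x (x + of_int k *\<^sub>R z)"
proof -
  obtain n where "d x (x + of_int k *\<^sub>R z) < real n * \<sigma>"
    using reals_Archimedean3[OF \<sigma>_pos] by blast
  then show ?thesis by (rule multiple_le_d_aux[OF z])
qed

end

section \<open>The stable norm\<close>

lemma finite_int_lattice_bounded: "finite {z \<in> int_lattice. norm z \<le> R}"
proof (rule finite_subset)
  define k where "k = \<lceil>R\<rceil>"
  show "finite ((\<lambda>(a :: int, b :: int). vector [of_int a, of_int b] :: real ^ 2) ` ({-k..k} \<times> {-k..k}))"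
    by auto
  show "{z \<in> int_lattice. norm z \<le> R} \<subseteq>
    (\<lambda>(a :: int, b :: int). vector [of_int a, of_int b] :: real ^ 2) ` ({-k..k} \<times> {-k..k})"
  proof safe
    fix z :: "real ^ 2" assume z: "z \<in> int_lattice" "norm z \<le> R"
    obtain a b where ab: "z $ 1 = of_int a" "z $ 2 = of_int b"
      using z(1) unfolding int_lattice_def by (metis Ints_cases mem_Collect_eq)
    have "\<bar>of_int a\<bar> \<le> R" "\<bar>of_int b\<bar> \<le> R"
      using component_le_norm_cart[of z 1] component_le_norm_cart[of z 2] z(2) ab by auto
    then have "a \<in> {-k..k}" "b \<in> {-k..k}" by (simp_all add: k_def abs_le_iff ceiling_le_iff) linarith+
    then show "z \<in> (\<lambda>(a :: int, b :: int). vector [of_int a, of_int b] :: real ^ 2) ` ({-k..k} \<times> {-k..k})"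
      using ab by (intro image_eqI[of _ _ "(a, b)"]) (auto simp: vec_eq_iff forall_2)
  qed
qed

lemma wedge_Ints: "z \<in> int_lattice \<Longrightarrow> w \<in> int_lattice \<Longrightarrow> wedge z w \<in> \<int>"
  by (simp add: wedge_def int_lattice_def)

text \<open>The Cauchy-Binet identity. On a lattice basis the second factor is 1 or -1, so wedges of
  covectors can be read off from their values.\<close>

lemma wedge_covectors: "wedge a b * wedge z w = (a \<bullet> z) * (b \<bullet> w) - (a \<bullet> w) * (b \<bullet> z)"
  by (simp add: wedge_def inner_vec_def sum_2 algebra_simps)

lemma lattice_basis_expansion:
  assumes "\<bar>wedge z1 z2\<bar> = 1" and "z1 \<in> int_lattice" "z2 \<in> int_lattice" "z \<in> int_lattice"
  obtains i j :: int where "z = of_int i *\<^sub>R z1 + of_int j *\<^sub>R z2"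
proof -
  have D: "wedge z1 z2 * wedge z1 z2 = 1" using assms(1) by (metis abs_mult_self_eq mult_1)
  have "wedge z1 z2 * wedge z z2 \<in> \<int>" "wedge z1 z2 * wedge z1 z \<in> \<int>"
    using assms by (auto intro!: Ints_mult wedge_Ints)
  then obtain i j :: int where ij: "wedge z1 z2 * wedge z z2 = of_int i" "wedge z1 z2 * wedge z1 z = of_int j"
    by (meson Ints_cases)
  have "wedge z1 z2 *\<^sub>R z = wedge z z2 *\<^sub>R z1 + wedge z1 z *\<^sub>R z2"
    by (simp add: vec_eq_iff forall_2 wedge_def algebra_simps)
  then have "(wedge z1 z2 * wedge z1 z2) *\<^sub>R z
      = (wedge z1 z2 * wedge z z2) *\<^sub>R z1 + (wedge z1 z2 * wedge z1 z) *\<^sub>R z2"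
    using arg_cong[of _ _ "\<lambda>v. wedge z1 z2 *\<^sub>R v"] by (simp only: scaleR_add_right flip: scaleR_scaleR)
  then show ?thesis using that[of i j] by (simp add: D ij)
qed

context systolic_metric
begin

text \<open>On lattice vectors the distances are subadditive in \<open>n\<close>, so this infimum is
  also the limit. As an infimum it is bounded above by each single term, and lower bounds are
  checked term by term.\<close>

definition stable_norm :: "real ^ 2 \<Rightarrow> real" where
  "stable_norm z = (INF n\<in>{1::nat..}. d 0 (real n *\<^sub>R z) / real n)"

lemma stable_norm_le: "n \<ge> 1 \<Longrightarrow> stable_norm z \<le> d 0 (real n *\<^sub>R z) / real n"
  unfolding stable_norm_def by (rule cINF_lower) (auto intro!: bdd_belowI2[of _ 0] simp: d_nonneg)

lemma stable_norm_ge: "(\<And>n. n \<ge> 1 \<Longrightarrow> u \<le> d 0 (real n *\<^sub>R z) / real n) \<Longrightarrow> u \<le> stable_norm z"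
  unfolding stable_norm_def by (rule cINF_greatest) auto

lemma d_multiple_le:
  assumes "z \<in> int_lattice"
  shows "d x (x + real n *\<^sub>R z) \<le> real n * d x (x + z)"
proof (induction n)
  case (Suc n)
  have "d (x + real n *\<^sub>R z) (x + real (Suc n) *\<^sub>R z) = d (x + real n *\<^sub>R z) (x + z + real n *\<^sub>R z)"
    by (simp add: algebra_simps)
  also have "\<dots> = d x (x + z)" by (rule d_translate) (use assms in simp)
  finally have "d x (x + real (Suc n) *\<^sub>R z) \<le> d x (x + real n *\<^sub>R z) + d x (x + z)"
    using d_triangle by metis
  then show ?case using Suc by (simp add: algebra_simps)
qed simp

text \<open>Changing the base point from 0 to \<open>x\<close> costs \<open>2 * d 0 x\<close> once,
  which is negligible after division by \<open>n\<close>.\<close>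

lemma stable_norm_le_d:
  assumes z: "z \<in> int_lattice"
  shows "stable_norm z \<le> d x (x + z)"
proof -
  have le: "stable_norm z \<le> d x (x + z) + 2 * d 0 x / real n" if n: "n \<ge> 1" for n
  proof -
    have "d (x + real n *\<^sub>R z) (real n *\<^sub>R z) = d x 0"
      using d_translate[of "real n *\<^sub>R z" x 0] z by simp
    then have "d 0 (real n *\<^sub>R z) \<le> d 0 x + (d x (x + real n *\<^sub>R z) + d 0 x)"
      using d_triangle[of 0 "real n *\<^sub>R z" x] d_triangle[of x "real n *\<^sub>R z" "x + real n *\<^sub>R z"]
        d_commute[of x 0] by simp
    also have "\<dots> \<le> 2 * d 0 x + real n * d x (x + z)" using d_multiple_le[OF z, of x n] by simp
    finally have "d 0 (real n *\<^sub>R z) / real n \<le> (2 * d 0 x + real n * d x (x + z)) / real n"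
      by (rule divide_right_mono) simp
    also have "\<dots> = d x (x + z) + 2 * d 0 x / real n" using n by (simp add: add_divide_distrib)
    finally show ?thesis using stable_norm_le[OF n, of z] by simp
  qed
  show ?thesis
  proof (rule tendsto_lowerbound)
    have "((\<lambda>n. d x (x + z) + 2 * d 0 x / real n) \<longlongrightarrow> d x (x + z) + 0) sequentially"
      by (intro tendsto_intros tendsto_divide_0[OF tendsto_const] filterlim_at_top_imp_at_infinity
          filterlim_real_sequentially)
    then show "(\<lambda>n. d x (x + z) + 2 * d 0 x / real n) \<longlonglongrightarrow> d x (x + z)" by simp
    show "\<forall>\<^sub>F n in sequentially. stable_norm z \<le> d x (x + z) + 2 * d 0 x / real n"
      using eventually_ge_at_top[of 1] by eventually_elim (rule le)
  qed auto
qed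

lemma stable_norm_ge_\<sigma>:
  assumes z: "z \<in> int_lattice" "z \<noteq> 0"
  shows "\<sigma> \<le> stable_norm z"
proof (rule stable_norm_ge)
  fix n :: nat assume n: "n \<ge> 1"
  have "real n * \<sigma> \<le> d 0 (real n *\<^sub>R z)" using multiple_le_d[OF z, of "int n" 0] by simp
  then show "\<sigma> \<le> d 0 (real n *\<^sub>R z) / real n" using n by (simp add: field_simps)
qed

lemma stable_norm_nonneg: "0 \<le> stable_norm z"
  by (rule stable_norm_ge) (simp add: d_nonneg)

lemma stable_norm_minus: "z \<in> int_lattice \<Longrightarrow> stable_norm (- z) = stable_norm z"
proof -
  assume z: "z \<in> int_lattice"
  have "d 0 (real n *\<^sub>R - z) = d 0 (real n *\<^sub>R z)" for n
    using d_translate[of "real n *\<^sub>R z" 0 "real n *\<^sub>R - z"] z d_commute[of 0 "real n *\<^sub>R z"] by simp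
  then show ?thesis by (simp add: stable_norm_def)
qed

lemma stable_norm_multiple_nat:
  assumes z: "z \<in> int_lattice" and n: "n \<ge> 1"
  shows "stable_norm (real n *\<^sub>R z) = real n * stable_norm z"
proof (rule antisym)
  have "stable_norm (real n *\<^sub>R z) / real n \<le> stable_norm z"
  proof (rule stable_norm_ge)
    fix k :: nat assume k: "k \<ge> 1"
    have "d 0 (real k *\<^sub>R (real n *\<^sub>R z)) \<le> real n * d 0 (real k *\<^sub>R z)"
      using d_multiple_le[of "real k *\<^sub>R z" 0 n] z by (simp add: mult.commute)
    then have "d 0 (real k *\<^sub>R (real n *\<^sub>R z)) / real k \<le> real n * d 0 (real k *\<^sub>R z) / real k"
      by (rule divide_right_mono) simp
    then have "stable_norm (real n *\<^sub>R z) \<le> real n * d 0 (real k *\<^sub>R z) / real k"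
      using stable_norm_le[OF k, of "real n *\<^sub>R z"] by linarith
    then show "stable_norm (real n *\<^sub>R z) / real n \<le> d 0 (real k *\<^sub>R z) / real k"
      using n by (simp add: field_simps)
  qed
  then show "stable_norm (real n *\<^sub>R z) \<le> real n * stable_norm z" using n by (simp add: field_simps)
  show "real n * stable_norm z \<le> stable_norm (real n *\<^sub>R z)"
  proof (rule stable_norm_ge)
    fix k :: nat assume k: "k \<ge> 1"
    have "k * n \<ge> 1" using k n by (simp add: Suc_le_eq)
    from stable_norm_le[OF this, of z] have "stable_norm z \<le> d 0 (real k *\<^sub>R (real n *\<^sub>R z)) / (real k * real n)" by simp
    then show "real n * stable_norm z \<le> d 0 (real k *\<^sub>R (real n *\<^sub>R z)) / real k"
      using k n by (simp add: field_simps)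
  qed
qed

text \<open>Terms of the two infima with indices \<open>n\<close> and \<open>m\<close> are compared
  at the common index \<open>n * m\<close>.\<close>

lemma stable_norm_triangle:
  assumes z: "z \<in> int_lattice" and w: "w \<in> int_lattice"
  shows "stable_norm (z + w) \<le> stable_norm z + stable_norm w"
proof -
  have *: "stable_norm (z + w) \<le> d 0 (real n *\<^sub>R z) / real n + d 0 (real m *\<^sub>R w) / real m"
    if n: "n \<ge> 1" and m: "m \<ge> 1" for n m
  proof -
    have "d (real (n * m) *\<^sub>R z) (real (n * m) *\<^sub>R (z + w)) = d 0 (real (n * m) *\<^sub>R w)"
      using d_translate[of "real (n * m) *\<^sub>R z" 0 "real (n * m) *\<^sub>R w"] z
      by (simp add: scaleR_add_right add.commute del: of_nat_mult)
    then have "d 0 (real (n * m) *\<^sub>R (z + w)) \<le> d 0 (real (n * m) *\<^sub>R z) + d 0 (real (n * m) *\<^sub>R w)"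
      using d_triangle by metis
    also have "\<dots> \<le> real m * d 0 (real n *\<^sub>R z) + real n * d 0 (real m *\<^sub>R w)"
      using d_multiple_le[of "real n *\<^sub>R z" 0 m] d_multiple_le[of "real m *\<^sub>R w" 0 n] z w
      by (intro add_mono) (simp_all add: mult.commute)
    finally have "d 0 (real (n * m) *\<^sub>R (z + w)) / real (n * m)
        \<le> (real m * d 0 (real n *\<^sub>R z) + real n * d 0 (real m *\<^sub>R w)) / real (n * m)"
      by (rule divide_right_mono) simp
    also have "\<dots> = d 0 (real n *\<^sub>R z) / real n + d 0 (real m *\<^sub>R w) / real m"
      using n m by (simp add: field_simps)
    finally show ?thesis using stable_norm_le[of "n * m" "z + w"] n m by (simp add: Suc_le_eq)
  qed
  have "stable_norm (z + w) - stable_norm w \<le> stable_norm z"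
  proof (rule stable_norm_ge)
    fix n :: nat assume n: "n \<ge> 1"
    have "stable_norm (z + w) - d 0 (real n *\<^sub>R z) / real n \<le> stable_norm w"
      by (rule stable_norm_ge) (use *[OF n] in \<open>simp add: algebra_simps\<close>)
    then show "stable_norm (z + w) - stable_norm w \<le> d 0 (real n *\<^sub>R z) / real n" by simp
  qed
  then show ?thesis by simp
qed

lemma stable_norm_multiple_ge:
  assumes z: "z \<in> int_lattice"
  shows "of_int i * stable_norm z \<le> stable_norm (of_int i *\<^sub>R z)"
proof (cases "i > 0")
  case True
  then show ?thesis using stable_norm_multiple_nat[OF z, of "nat i"] by simp
next
  case False
  then have "of_int i * stable_norm z \<le> 0" using stable_norm_nonneg by (intro mult_nonpos_nonneg) auto
  then show ?thesis using stable_norm_nonneg order_trans by blast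
qed

lemma stable_norm_lower: "\<exists>m>0. \<forall>z. m * norm z \<le> stable_norm z"
proof -
  obtain m where m: "m > 0" "\<And>x y. m * norm (y - x) \<le> d x y" using d_lower by blast
  have "m * norm z \<le> stable_norm z" for z
  proof (rule stable_norm_ge)
    fix n :: nat assume n: "n \<ge> 1"
    have "real n * (m * norm z) \<le> d 0 (real n *\<^sub>R z)"
      using m(2)[of "real n *\<^sub>R z" 0] by (simp add: mult.commute mult.left_commute)
    then show "m * norm z \<le> d 0 (real n *\<^sub>R z) / real n" using n by (simp add: field_simps)
  qed
  then show ?thesis using m by blast
qed

text \<open>The Hahn-Banach extension step over the integers.\<close>

lemma norming_slope:
  assumes z1: "z1 \<in> int_lattice" and z2: "z2 \<in> int_lattice"
  shows "\<exists>s. \<forall>i j :: int. of_int i * stable_norm z1 + of_int j * s \<le> stable_norm (of_int i *\<^sub>R z1 + of_int j *\<^sub>R z2)"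
proof -
  \<comment> \<open>\<open>lo i j\<close> is the lower bound that the inequality at
    \<open>(i, - j)\<close> puts on the slope. Combining it with an upper bound so that
    \<open>z2\<close> cancels shows in \<open>up\<close> that the two are compatible; the supremum
    of all lower bounds is then a valid slope.\<close>
  define lo where "lo i j = (of_int i * stable_norm z1 - stable_norm (of_int i *\<^sub>R z1 - real j *\<^sub>R z2)) / real j" for i :: int and j :: nat
  define S where "S = {lo i j | i j. j \<ge> 1}"
  have up: "lo i j * real l \<le> stable_norm (of_int k *\<^sub>R z1 + real l *\<^sub>R z2) - of_int k * stable_norm z1"
    if jl: "j \<ge> 1" "l \<ge> 1" for i k j l
  proof -
    have eq: "real l *\<^sub>R (of_int i *\<^sub>R z1 - real j *\<^sub>R z2) + real j *\<^sub>R (of_int k *\<^sub>R z1 + real l *\<^sub>R z2)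
        = of_int (int l * i + int j * k) *\<^sub>R z1"
      by (simp add: algebra_simps)
    have "of_int (int l * i + int j * k) * stable_norm z1 \<le> stable_norm (of_int (int l * i + int j * k) *\<^sub>R z1)"
      by (rule stable_norm_multiple_ge[OF z1])
    also have "\<dots> \<le> stable_norm (real l *\<^sub>R (of_int i *\<^sub>R z1 - real j *\<^sub>R z2))
        + stable_norm (real j *\<^sub>R (of_int k *\<^sub>R z1 + real l *\<^sub>R z2))"
      unfolding eq[symmetric] using z1 z2 by (intro stable_norm_triangle) auto
    also have "\<dots> = real l * stable_norm (of_int i *\<^sub>R z1 - real j *\<^sub>R z2) + real j * stable_norm (of_int k *\<^sub>R z1 + real l *\<^sub>R z2)"
      using z1 z2 jl by (subst (1 2) stable_norm_multiple_nat) auto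
    finally have "real l * (of_int i * stable_norm z1 - stable_norm (of_int i *\<^sub>R z1 - real j *\<^sub>R z2))
        \<le> real j * (stable_norm (of_int k *\<^sub>R z1 + real l *\<^sub>R z2) - of_int k * stable_norm z1)"
      by (simp add: algebra_simps)
    then show ?thesis using jl by (simp add: lo_def field_simps)
  qed
  have bdd: "bdd_above S"
    using up[of _ 1 _ 0] by (intro bdd_aboveI[of _ "stable_norm z2"]) (auto simp: S_def)
  have lo_le: "lo i j \<le> Sup S" if "j \<ge> 1" for i j
    using that bdd by (intro cSup_upper) (auto simp: S_def)
  have le_up: "Sup S * real l \<le> stable_norm (of_int k *\<^sub>R z1 + real l *\<^sub>R z2) - of_int k * stable_norm z1" if l: "l \<ge> 1" for k l
  proof -
    have "Sup S \<le> (stable_norm (of_int k *\<^sub>R z1 + real l *\<^sub>R z2) - of_int k * stable_norm z1) / real l"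
    proof (rule cSup_least)
      have "lo 0 1 \<in> S" by (auto simp: S_def)
      then show "S \<noteq> {}" by blast
      fix x assume "x \<in> S"
      then obtain i j where "x = lo i j" "j \<ge> 1" by (auto simp: S_def)
      then show "x \<le> (stable_norm (of_int k *\<^sub>R z1 + real l *\<^sub>R z2) - of_int k * stable_norm z1) / real l"
        using up[of j l i k] l by (simp add: field_simps)
    qed
    then show ?thesis using l by (simp add: field_simps)
  qed
  have "of_int i * stable_norm z1 + of_int j * Sup S \<le> stable_norm (of_int i *\<^sub>R z1 + of_int j *\<^sub>R z2)" for i j
  proof -
    consider "j = 0" | "j > 0" | "j < 0" by linarith
    then show ?thesis
    proof cases
      case 1 then show ?thesis using stable_norm_multiple_ge[OF z1] by simp
    next
      case 2 then show ?thesis using le_up[of "nat j" i] by (simp add: algebra_simps)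
    next
      case 3
      have "lo i (nat (- j)) \<le> Sup S" using 3 by (intro lo_le) auto
      then have "of_int i * stable_norm z1 - stable_norm (of_int i *\<^sub>R z1 + of_int j *\<^sub>R z2) \<le> of_int (- j) * Sup S"
        using 3 by (simp add: lo_def field_simps)
      then show ?thesis by (simp add: algebra_simps)
    qed
  qed
  then show ?thesis by blast
qed

text \<open>The unit ball of the norm dual to the stable norm, tested on the lattice only.\<close>

definition dominated :: "real ^ 2 \<Rightarrow> bool" where
  "dominated a \<longleftrightarrow> (\<forall>z\<in>int_lattice. \<bar>a \<bullet> z\<bar> \<le> stable_norm z)"

lemma dominated_scale:
  assumes "dominated a" "\<bar>c\<bar> \<le> 1"
  shows "dominated (c *\<^sub>R a)"
  unfolding dominated_def
proof
  fix z assume "z \<in> int_lattice"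
  then have "\<bar>c\<bar> * \<bar>a \<bullet> z\<bar> \<le> 1 * stable_norm z"
    using assms by (intro mult_mono) (auto simp: dominated_def)
  then show "\<bar>c *\<^sub>R a \<bullet> z\<bar> \<le> stable_norm z" by (simp add: abs_mult)
qed

lemma norming_covector:
  assumes z1: "z1 \<in> int_lattice" and z2: "z2 \<in> int_lattice" and D: "\<bar>wedge z1 z2\<bar> = 1"
  shows "\<exists>a. a \<bullet> z1 = stable_norm z1 \<and> dominated a"
proof -
  obtain s where s: "\<And>i j :: int. of_int i * stable_norm z1 + of_int j * s \<le> stable_norm (of_int i *\<^sub>R z1 + of_int j *\<^sub>R z2)"
    using norming_slope[OF z1 z2] by blast
  \<comment> \<open>Cramer's rule for the covector with values \<open>stable_norm z1\<close> at
    \<open>z1\<close> and \<open>s\<close> at \<open>z2\<close>; the determinant is its own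
    inverse.\<close>
  define a :: "real ^ 2" where "a = wedge z1 z2 *\<^sub>R
     (stable_norm z1 *\<^sub>R vector [z2 $ 2, - z2 $ 1] + s *\<^sub>R vector [- z1 $ 2, z1 $ 1])"
  have DD: "wedge z1 z2 * wedge z1 z2 = 1" using D by (metis abs_mult_self_eq mult_1)
  have "a \<bullet> z1 = stable_norm z1 * (wedge z1 z2 * wedge z1 z2)" "a \<bullet> z2 = s * (wedge z1 z2 * wedge z1 z2)"
    by (simp_all add: a_def inner_vec_def sum_2 wedge_def algebra_simps)
  then have a: "a \<bullet> z1 = stable_norm z1" "a \<bullet> z2 = s" by (simp_all add: DD)
  have le: "a \<bullet> z \<le> stable_norm z" if z: "z \<in> int_lattice" for z
  proof -
    obtain i j :: int where "z = of_int i *\<^sub>R z1 + of_int j *\<^sub>R z2"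
      by (rule lattice_basis_expansion[OF D z1 z2 z])
    then show ?thesis using s[of i j] by (simp add: inner_add_right a)
  qed
  have "dominated a" unfolding dominated_def
    using le stable_norm_minus by (auto simp: abs_le_iff) (metis inner_minus_right int_lattice_simps(2))
  then show ?thesis using a by blast
qed

text \<open>Take a basis minimising \<open>stable_norm z1 + stable_norm z2\<close>; a minimum exists
  because only finitely many bases do as well as the standard one. Exchanging one vector for
  \<open>z1 - z2\<close> or \<open>z1 + z2\<close> gives a basis again, so it cannot lower the
  sum.\<close>

lemma reduced_basis:
  "\<exists>z1 z2. z1 \<in> int_lattice \<and> z2 \<in> int_lattice \<and> \<bar>wedge z1 z2\<bar> = 1 \<and>
     stable_norm z1 \<le> stable_norm (z1 - z2) \<and> stable_norm z2 \<le> stable_norm (z1 - z2) \<and> stable_norm z1 \<le> stable_norm (z1 + z2) \<and> stable_norm z2 \<le> stable_norm (z1 + z2)"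
proof -
  define B where "B = {(z1, z2). z1 \<in> int_lattice \<and> z2 \<in> int_lattice \<and> \<bar>wedge z1 z2\<bar> = 1}"
  define f where "f p = stable_norm (fst p) + stable_norm (snd p)" for p
  define p0 :: "(real^2) \<times> (real^2)" where "p0 = (axis 1 1, axis 2 1)"
  obtain m where m: "m > 0" "\<And>z. m * norm z \<le> stable_norm z" using stable_norm_lower by blast
  have p0: "p0 \<in> B" by (auto simp: p0_def B_def int_lattice_def wedge_def axis_def)
  have "finite {p \<in> B. f p \<le> f p0}"
  proof (rule finite_subset)
    show "finite ({z \<in> int_lattice. norm z \<le> f p0 / m} \<times> {z \<in> int_lattice. norm z \<le> f p0 / m})"
      by (intro finite_cartesian_product finite_int_lattice_bounded)
    have "norm z \<le> f p0 / m" if "stable_norm z + stable_norm w \<le> f p0" for z w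
      using that m(1) m(2)[of z] stable_norm_nonneg[of w] by (simp add: field_simps)
    then show "{p \<in> B. f p \<le> f p0} \<subseteq> {z \<in> int_lattice. norm z \<le> f p0 / m} \<times> {z \<in> int_lattice. norm z \<le> f p0 / m}"
      by (force simp: B_def f_def add.commute)
  qed
  then have fin: "finite (f ` {p \<in> B. f p \<le> f p0})" by simp
  then have "Min (f ` {p \<in> B. f p \<le> f p0}) \<in> f ` {p \<in> B. f p \<le> f p0}"
    by (rule Min_in) (use p0 in \<open>metis (mono_tags, lifting) emptyE image_eqI mem_Collect_eq order_refl\<close>)
  then obtain p where p: "p \<in> B" "f p \<le> f p0" "f p = Min (f ` {p \<in> B. f p \<le> f p0})" by auto
  have min: "f p \<le> f q" if "q \<in> B" "f q \<le> f p0" for q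
    unfolding p(3) by (rule Min_le[OF fin]) (use that in auto)
  have min': "f p \<le> f q" if "q \<in> B" for q using min[OF that] p(2) by linarith
  obtain z1 z2 where z: "p = (z1, z2)" by (cases p)
  have B: "z1 \<in> int_lattice" "z2 \<in> int_lattice" "\<bar>wedge z1 z2\<bar> = 1" using p(1) by (auto simp: B_def z)
  have w: "wedge (z1 - z2) z2 = wedge z1 z2" "wedge z1 (z1 - z2) = - wedge z1 z2"
    "wedge (z1 + z2) z2 = wedge z1 z2" "wedge z1 (z1 + z2) = wedge z1 z2"
    by (simp_all add: wedge_def algebra_simps)
  have "(z1 - z2, z2) \<in> B" "(z1, z1 - z2) \<in> B" "(z1 + z2, z2) \<in> B" "(z1, z1 + z2) \<in> B"
    using B by (auto simp: B_def w)
  from this[THEN min'] show ?thesis using B by (auto simp: f_def z)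
qed

text \<open>Measured on \<open>z1\<close> and \<open>z2\<close> in units of \<open>\<sigma>\<close>,
  the scaled covectors are \<open>(1, s)\<close>, \<open>(t, 1)\<close> and
  \<open>(u, u - 1)\<close>. The sign hypotheses give nonnegative \<open>s\<close> and
  \<open>t\<close>, reducedness confines \<open>u\<close> to the unit interval, and
  \<open>exists_weights_unit\<close> applies.\<close>

lemma dominated_covectors_acute:
  assumes z: "z1 \<in> int_lattice" "z2 \<in> int_lattice" and D: "\<bar>wedge z1 z2\<bar> = 1"
    and red: "stable_norm z1 \<le> stable_norm (z1 - z2)" "stable_norm z2 \<le> stable_norm (z1 - z2)"
    and a1: "dominated a1" "a1 \<bullet> z1 = stable_norm z1" "0 \<le> a1 \<bullet> z2"
    and a2: "dominated a2" "a2 \<bullet> z2 = stable_norm z2" "0 \<le> a2 \<bullet> z1"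
  shows "\<exists>b1 b2 b3 p q r. dominated b1 \<and> dominated b2 \<and> dominated b3 \<and>
    0 \<le> p \<and> 0 \<le> q \<and> 0 \<le> r \<and> p + q + r = 1 \<and>
    \<sigma>\<^sup>2 / 4 \<le> \<bar>wedge b1 b2\<bar> * p * q + \<bar>wedge b1 b3\<bar> * p * r + \<bar>wedge b2 b3\<bar> * q * r"
proof -
  have nz: "z1 \<noteq> 0" "z2 \<noteq> 0" "z1 - z2 \<noteq> 0" using D by (auto simp: wedge_def)
  define N1 where "N1 = stable_norm z1"
  define N2 where "N2 = stable_norm z2"
  define N3 where "N3 = stable_norm (z1 - z2)"
  have Nge: "\<sigma> \<le> N1" "\<sigma> \<le> N2" "\<sigma> \<le> N3"
    using z nz by (auto simp: N1_def N2_def N3_def intro!: stable_norm_ge_\<sigma>)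
  have Npos: "N1 > 0" "N2 > 0" "N3 > 0" using Nge \<sigma>_pos by auto
  have "wedge (z1 - z2) z2 = wedge z1 z2" by (simp add: wedge_def algebra_simps)
  then obtain a3 where a3: "a3 \<bullet> (z1 - z2) = N3" "dominated a3"
    using norming_covector[of "z1 - z2" z2] z D by (auto simp: N3_def)
  \<comment> \<open>Each norm is at least \<open>\<sigma>\<close>, so the factor is at most 1 and
    domination survives.\<close>
  define b1 where "b1 = (\<sigma> / N1) *\<^sub>R a1"
  define b2 where "b2 = (\<sigma> / N2) *\<^sub>R a2"
  define b3 where "b3 = (\<sigma> / N3) *\<^sub>R a3"
  have dom: "dominated b1" "dominated b2" "dominated b3"
    unfolding b1_def b2_def b3_def using Nge Npos \<sigma>_pos a1 a2 a3
    by (auto intro!: dominated_scale simp: abs_div_pos)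
  define s where "s = (a1 \<bullet> z2) / N1"
  define t where "t = (a2 \<bullet> z1) / N2"
  define u where "u = (a3 \<bullet> z1) / N3"
  have st: "0 \<le> s" "0 \<le> t" using a1 a2 Npos by (auto simp: s_def t_def)
  have a3z2: "a3 \<bullet> z2 = N3 * (u - 1)" using a3(1) Npos by (simp add: u_def inner_diff_right field_simps)
  have u: "0 \<le> u" "u \<le> 1"
  proof -
    have "\<bar>a3 \<bullet> z1\<bar> \<le> N3" "\<bar>a3 \<bullet> z2\<bar> \<le> N3"
      using a3(2) z red unfolding dominated_def N3_def by (meson order_trans)+
    then have "N3 * u \<le> N3 * 1" "N3 * (- 1) \<le> N3 * (u - 1)"
      using Npos by (auto simp: u_def a3z2)
    then show "u \<le> 1" "0 \<le> u"
      using Npos by (simp_all only: mult_le_cancel_left_pos)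
  qed
  have val: "b1 \<bullet> z1 = \<sigma>" "b1 \<bullet> z2 = \<sigma> * s" "b2 \<bullet> z1 = \<sigma> * t" "b2 \<bullet> z2 = \<sigma>"
     "b3 \<bullet> z1 = \<sigma> * u" "b3 \<bullet> z2 = \<sigma> * (u - 1)"
    using Npos a1 a2 by (simp_all add: b1_def b2_def b3_def s_def t_def a3z2 u_def N1_def N2_def)
  have W: "\<bar>wedge x y\<bar> = \<bar>(x \<bullet> z1) * (y \<bullet> z2) - (x \<bullet> z2) * (y \<bullet> z1)\<bar>" for x y
    using wedge_covectors[of x y z1 z2] D by (metis abs_mult mult.right_neutral)
  have "\<bar>wedge b1 b2\<bar> = \<bar>\<sigma>\<^sup>2 * (1 - s * t)\<bar>"
    unfolding W val by (simp add: power2_eq_square algebra_simps)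
  then have w12: "\<sigma>\<^sup>2 * (1 - s * t) \<le> \<bar>wedge b1 b2\<bar>" by simp
  have "\<bar>wedge b1 b3\<bar> = \<bar>- (\<sigma>\<^sup>2 * ((1 - u) + s * u))\<bar>"
    unfolding W val by (simp add: power2_eq_square algebra_simps)
  then have w13: "\<sigma>\<^sup>2 * ((1 - u) + s * u) \<le> \<bar>wedge b1 b3\<bar>" by simp
  have "\<bar>wedge b2 b3\<bar> = \<bar>- (\<sigma>\<^sup>2 * (t * (1 - u) + u))\<bar>"
    unfolding W val by (simp add: power2_eq_square algebra_simps)
  then have w23: "\<sigma>\<^sup>2 * (t * (1 - u) + u) \<le> \<bar>wedge b2 b3\<bar>" by simp
  obtain p q r where pqr: "0 \<le> p" "0 \<le> q" "0 \<le> r" "p + q + r = 1"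
    and *: "1/4 \<le> (1 - s * t) * p * q + ((1 - u) + s * u) * p * r + (t * (1 - u) + u) * q * r"
    using exists_weights_unit[OF st u] by blast
  have "\<sigma>\<^sup>2 * (1/4) \<le> \<sigma>\<^sup>2 * ((1 - s * t) * p * q + ((1 - u) + s * u) * p * r + (t * (1 - u) + u) * q * r)"
    by (rule mult_left_mono[OF *]) simp
  also have "\<dots> = \<sigma>\<^sup>2 * (1 - s * t) * (p * q) + \<sigma>\<^sup>2 * ((1 - u) + s * u) * (p * r)
      + \<sigma>\<^sup>2 * (t * (1 - u) + u) * (q * r)" by algebra
  also have "\<dots> \<le> \<bar>wedge b1 b2\<bar> * (p * q) + \<bar>wedge b1 b3\<bar> * (p * r) + \<bar>wedge b2 b3\<bar> * (q * r)"
    using pqr by (intro add_mono mult_right_mono w12 w13 w23) auto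
  finally show ?thesis using dom pqr
    by (intro exI[of _ b1] exI[of _ b2] exI[of _ b3] exI[of _ p] exI[of _ q] exI[of _ r])
       (simp add: mult.assoc)
qed

text \<open>If both off-diagonal values are nonpositive, replacing \<open>z2\<close> by
  \<open>- z2\<close> leads to the acute case. If they have opposite signs or one vanishes, the
  wedge of \<open>a1\<close> and \<open>a2\<close> is already at least the product of the two norms,
  and the weights 1/2, 1/2, 0 suffice.\<close>

theorem dominated_covectors:
  "\<exists>b1 b2 b3 p q r. dominated b1 \<and> dominated b2 \<and> dominated b3 \<and>
    0 \<le> p \<and> 0 \<le> q \<and> 0 \<le> r \<and> p + q + r = 1 \<and>
    \<sigma>\<^sup>2 / 4 \<le> \<bar>wedge b1 b2\<bar> * p * q + \<bar>wedge b1 b3\<bar> * p * r + \<bar>wedge b2 b3\<bar> * q * r"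
proof -
  obtain z1 z2 where z: "z1 \<in> int_lattice" "z2 \<in> int_lattice" and D: "\<bar>wedge z1 z2\<bar> = 1"
    and red: "stable_norm z1 \<le> stable_norm (z1 - z2)" "stable_norm z2 \<le> stable_norm (z1 - z2)" "stable_norm z1 \<le> stable_norm (z1 + z2)" "stable_norm z2 \<le> stable_norm (z1 + z2)"
    using reduced_basis by blast
  obtain a1 where a1: "a1 \<bullet> z1 = stable_norm z1" "dominated a1" using norming_covector[OF z D] by blast
  obtain a2 where a2: "a2 \<bullet> z2 = stable_norm z2" "dominated a2"
    using norming_covector[OF z(2,1)] D wedge_commute_abs by metis
  consider "0 \<le> a1 \<bullet> z2" "0 \<le> a2 \<bullet> z1" | "a1 \<bullet> z2 \<le> 0" "a2 \<bullet> z1 \<le> 0"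
    | "(a1 \<bullet> z2) * (a2 \<bullet> z1) \<le> 0" by (meson linorder_le_cases mult_nonneg_nonpos mult_nonpos_nonneg)
  then show ?thesis
  proof cases
    case 1
    then show ?thesis using dominated_covectors_acute[OF z D red(1,2) a1(2,1) _ a2(2,1)] by blast
  next
    case 2
    have "wedge z1 (- z2) = - wedge z1 z2" by (simp add: wedge_def)
    then show ?thesis
      using dominated_covectors_acute[of z1 "- z2" a1 "- a2"] z D red a1 a2 2
        dominated_scale[of a2 "-1"] stable_norm_minus[OF z(2)] by simp
  next
    case 3
    have nz: "z1 \<noteq> 0" "z2 \<noteq> 0" using D by (auto simp: wedge_def)
    have "\<bar>wedge a1 a2\<bar> = \<bar>stable_norm z1 * stable_norm z2 - (a1 \<bullet> z2) * (a2 \<bullet> z1)\<bar>"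
      using wedge_covectors[of a1 a2 z1 z2] D a1 a2 by (metis abs_mult mult.right_neutral)
    then have "stable_norm z1 * stable_norm z2 \<le> \<bar>wedge a1 a2\<bar>" using 3 by simp
    moreover have "\<sigma> * \<sigma> \<le> stable_norm z1 * stable_norm z2"
      using stable_norm_ge_\<sigma> z nz \<sigma>_pos by (intro mult_mono) (auto simp: stable_norm_nonneg)
    ultimately have "\<sigma>\<^sup>2 / 4 \<le> \<bar>wedge a1 a2\<bar> * (1/2) * (1/2)" by (simp add: power2_eq_square)
    then show ?thesis using a1 a2
      by (intro exI[of _ a1] exI[of _ a2] exI[of _ a2] exI[of _ "1/2"] exI[of _ "1/2"] exI[of _ 0]) simp
  qed
qed

end

section \<open>Averaging and closed forms\<close>

lemma continuous_on_curried:
  assumes "continuous_on UNIV (\<lambda>(x, y). h x y)" "continuous_on S f" "continuous_on S g"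
  shows "continuous_on S (\<lambda>t. h (f t) (g t))"
  using continuous_on_compose2[OF assms(1) continuous_on_Pair[OF assms(2,3)]] by simp

lemma window_derivative:
  fixes \<phi> :: "real \<Rightarrow> real"
  assumes cont: "continuous_on UNIV \<phi>" and e: "e > 0"
  shows "((\<lambda>x. integral {0..e} (\<lambda>s. \<phi> (x + s))) has_real_derivative \<phi> (x + e) - \<phi> x) (at x)"
proof -
  define a where "a = x - 1"
  define b where "b = x + e + 1"
  define \<Phi> where "\<Phi> u = integral {a..u} \<phi>" for u
  have cont': "continuous_on S \<phi>" for S using cont continuous_on_subset by blast
  have int: "\<phi> integrable_on {u..v}" for u v by (intro integrable_continuous_real cont')
  have D: "(\<Phi> has_real_derivative \<phi> t) (at t)" if "a < t" "t < b" for t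
  proof -
    have "(\<Phi> has_real_derivative \<phi> t) (at t within {a..b})"
      unfolding \<Phi>_def using that cont' by (intro integral_has_real_derivative) auto
    moreover have "at t within {a..b} = at t" using that by (intro at_within_interior) auto
    ultimately show ?thesis by simp
  qed
  have "((\<lambda>u. \<Phi> (u + e)) has_real_derivative \<phi> (x + e)) (at x)"
    using D[of "x + e"] e by (simp add: DERIV_shift a_def b_def)
  then have "((\<lambda>u. \<Phi> (u + e) - \<Phi> u) has_real_derivative \<phi> (x + e) - \<phi> x) (at x)"
    using D[of x] e by (intro DERIV_diff) (auto simp: a_def b_def)
  moreover have "\<Phi> (u + e) - \<Phi> u = integral {0..e} (\<lambda>s. \<phi> (u + s))" if "u \<in> {a<..<b}" for u
  proof -
    have "\<Phi> u + integral {u..u+e} \<phi> = \<Phi> (u + e)"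
      unfolding \<Phi>_def by (rule Henstock_Kurzweil_Integration.integral_combine) (use that e int in auto)
    moreover have "integral {u..u+e} \<phi> = integral {0..e} (\<lambda>s. \<phi> (u + s))"
    proof -
      have "(\<phi> has_integral integral {u..u+e} \<phi>) (cbox u (u + e))" using int by (simp add: has_integral_integral)
      from has_integral_affinity'[OF this, of 1 u] show ?thesis
        by (simp add: add.commute integral_unique)
    qed
    ultimately show ?thesis by simp
  qed
  moreover have "x \<in> {a<..<b}" using e by (auto simp: a_def b_def)
  ultimately show ?thesis
    by (metis (no_types, lifting) has_field_derivative_transform_within_open open_greaterThanLessThan)
qed

text \<open>\<open>g\<close> is a function on the plane with additive periods \<open>a\<close>, so
  its differential is a closed form on the torus of class \<open>a\<close>. The common mixed
  derivative \<open>r\<close> is all the second-order regularity needed for Stokes' theorem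
  below.\<close>

definition smooth_form ::
    "real ^ 2 \<Rightarrow> (real \<Rightarrow> real \<Rightarrow> real) \<Rightarrow> (real \<Rightarrow> real \<Rightarrow> real) \<Rightarrow> (real \<Rightarrow> real \<Rightarrow> real) \<Rightarrow> bool" where
  "smooth_form a g p q \<longleftrightarrow>
     continuous_on UNIV (\<lambda>(x, y). g x y) \<and> continuous_on UNIV (\<lambda>(x, y). p x y) \<and>
     continuous_on UNIV (\<lambda>(x, y). q x y) \<and>
     (\<forall>x y. ((\<lambda>x. g x y) has_real_derivative p x y) (at x)) \<and>
     (\<forall>x y. ((\<lambda>y. g x y) has_real_derivative q x y) (at y)) \<and>
     (\<exists>r. continuous_on UNIV (\<lambda>(x, y). r x y) \<and>
        (\<forall>x y. ((\<lambda>y. p x y) has_real_derivative r x y) (at y)) \<and>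
        (\<forall>x y. ((\<lambda>x. q x y) has_real_derivative r x y) (at x))) \<and>
     (\<forall>x y. g (x + 1) y = g x y + a $ 1) \<and> (\<forall>x y. g x (y + 1) = g x y + a $ 2)"

text \<open>Stokes' theorem on the unit square for \<open>g1\<close> times the differential of
  \<open>g2\<close>. The derivatives of \<open>g2\<close> are periodic, so opposite sides cancel up
  to the periods of \<open>g1\<close>.\<close>

lemma smooth_form_wedge_integral:
  assumes f1: "smooth_form a1 g1 p1 q1" and f2: "smooth_form a2 g2 p2 q2"
  shows "integral (cbox (0, 0) (1, 1)) (\<lambda>(x, y). p1 x y * q2 x y - q1 x y * p2 x y) = wedge a1 a2"
proof -
  obtain r2 where r: "continuous_on UNIV (\<lambda>(x, y). r2 x y)"
      "\<And>x y. ((\<lambda>y. p2 x y) has_real_derivative r2 x y) (at y)"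
      "\<And>x y. ((\<lambda>x. q2 x y) has_real_derivative r2 x y) (at x)"
    using f2 unfolding smooth_form_def by blast
  have c1: "continuous_on UNIV (\<lambda>(x, y). g1 x y)" "continuous_on UNIV (\<lambda>(x, y). p1 x y)"
     "continuous_on UNIV (\<lambda>(x, y). q1 x y)"
    and d1: "\<And>x y. ((\<lambda>x. g1 x y) has_real_derivative p1 x y) (at x)"
     "\<And>x y. ((\<lambda>y. g1 x y) has_real_derivative q1 x y) (at y)"
    and per1: "\<And>x y. g1 (x + 1) y = g1 x y + a1 $ 1" "\<And>x y. g1 x (y + 1) = g1 x y + a1 $ 2"
    using f1 unfolding smooth_form_def by blast+
  have c2: "continuous_on UNIV (\<lambda>(x, y). p2 x y)" "continuous_on UNIV (\<lambda>(x, y). q2 x y)"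
    and d2: "\<And>x y. ((\<lambda>x. g2 x y) has_real_derivative p2 x y) (at x)"
     "\<And>x y. ((\<lambda>y. g2 x y) has_real_derivative q2 x y) (at y)"
    and per2: "\<And>x y. g2 (x + 1) y = g2 x y + a2 $ 1" "\<And>x y. g2 x (y + 1) = g2 x y + a2 $ 2"
    using f2 unfolding smooth_form_def by blast+
  note cc = c1[THEN continuous_on_curried] c2[THEN continuous_on_curried] r(1)[THEN continuous_on_curried]
  have q2per: "q2 1 y = q2 0 y" for y
  proof -
    have "((\<lambda>y. g2 0 y + a2 $ 1) has_real_derivative q2 0 y + 0) (at y)"
      by (intro DERIV_add d2 DERIV_const)
    then have "((\<lambda>y. g2 1 y) has_real_derivative q2 0 y) (at y)"
      using per2(1)[of 0] by simp
    then show ?thesis using d2(2)[of 1 y] DERIV_unique by blast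
  qed
  have p2per: "p2 x 1 = p2 x 0" for x
  proof -
    have "((\<lambda>x. g2 x 0 + a2 $ 2) has_real_derivative p2 x 0 + 0) (at x)"
      by (intro DERIV_add d2 DERIV_const)
    then have "((\<lambda>x. g2 x 1) has_real_derivative p2 x 0) (at x)"
      using per2(2)[of _ 0] by simp
    then show ?thesis using d2(1)[of 1 x] DERIV_unique by blast
  qed
  have ftc: "integral {0..1} f' = f 1 - f 0" if "\<And>x. (f has_real_derivative f' x) (at x)" for f f' :: "real \<Rightarrow> real"
    by (rule integral_unique, rule fundamental_theorem_of_calculus)
       (use that in \<open>auto simp: has_real_derivative_iff_has_vector_derivative intro: has_vector_derivative_at_within\<close>)
  \<comment> \<open>\<open>A\<close> is the x-derivative of \<open>g1 * q2\<close> and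
    \<open>B\<close> the y-derivative of \<open>g1 * p2\<close>; the mixed derivative cancels in the
    difference.\<close>
  define A where "A x y = p1 x y * q2 x y + g1 x y * r2 x y" for x y
  define B where "B x y = q1 x y * p2 x y + g1 x y * r2 x y" for x y
  have cA: "continuous_on S (\<lambda>(x, y). A x y)" and cB: "continuous_on S (\<lambda>(x, y). B x y)" for S
    unfolding A_def B_def case_prod_unfold by (intro continuous_intros cc)+
  have "integral (cbox (0, 0) (1, 1)) (\<lambda>(x, y). A x y) = integral {0..1} (\<lambda>x. integral {0..1} (A x))"
    using integral_prod_continuous[OF cA, of 0 0 1 1] by simp
  also have "\<dots> = integral {0..1} (\<lambda>y. integral {0..1} (\<lambda>x. A x y))"
    using integral_swap_continuous[OF cA, of 0 1 0 1] by simp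
  also have "\<dots> = integral {0..1} (\<lambda>y. a1 $ 1 * q2 0 y)"
  proof (rule integral_cong)
    fix y
    have "integral {0..1} (\<lambda>x. A x y) = g1 1 y * q2 1 y - g1 0 y * q2 0 y"
      by (rule ftc) (auto simp: A_def intro!: derivative_eq_intros d1 r)
    then show "integral {0..1} (\<lambda>x. A x y) = a1 $ 1 * q2 0 y"
      using per1(1)[of 0 y] by (simp add: q2per algebra_simps)
  qed
  also have "\<dots> = a1 $ 1 * a2 $ 2" using ftc[of "g2 0" "q2 0"] d2(2) per2(2)[of 0 0] by simp
  finally have IA: "integral (cbox (0, 0) (1, 1)) (\<lambda>(x, y). A x y) = a1 $ 1 * a2 $ 2" .
  have "integral (cbox (0, 0) (1, 1)) (\<lambda>(x, y). B x y) = integral {0..1} (\<lambda>x. integral {0..1} (B x))"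
    using integral_prod_continuous[OF cB, of 0 0 1 1] by simp
  also have "\<dots> = integral {0..1} (\<lambda>x. a1 $ 2 * p2 x 0)"
  proof (rule integral_cong)
    fix x
    have "integral {0..1} (B x) = g1 x 1 * p2 x 1 - g1 x 0 * p2 x 0"
      by (rule ftc) (auto simp: B_def intro!: derivative_eq_intros d1 r)
    then show "integral {0..1} (B x) = a1 $ 2 * p2 x 0"
      using per1(2)[of x 0] by (simp add: p2per algebra_simps)
  qed
  also have "\<dots> = a1 $ 2 * a2 $ 1"
    using ftc[of "\<lambda>x. g2 x 0" "\<lambda>x. p2 x 0"] d2(1) per2(1)[of 0 0] by simp
  finally have IB: "integral (cbox (0, 0) (1, 1)) (\<lambda>(x, y). B x y) = a1 $ 2 * a2 $ 1" .
  have "(\<lambda>(x, y). p1 x y * q2 x y - q1 x y * p2 x y) = (\<lambda>z. (\<lambda>(x, y). A x y) z - (\<lambda>(x, y). B x y) z)"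
    by (auto simp: A_def B_def)
  then show ?thesis
    using integral_diff[OF integrable_continuous[OF cA] integrable_continuous[OF cB], of "(0,0)" "(1,1)"] IA IB
    by (simp add: wedge_def)
qed

text \<open>Partial derivatives alone do not control oblique directions. Joint continuity of one of
  them makes \<open>g\<close> differentiable, and the one-sided difference quotients then bound the
  directional derivative.\<close>

lemma directional_bound:
  fixes g p q :: "real \<Rightarrow> real \<Rightarrow> real"
  assumes dx: "\<And>x y. ((\<lambda>x. g x y) has_real_derivative p x y) (at x)"
    and dy: "\<And>x y. ((\<lambda>y. g x y) has_real_derivative q x y) (at y)"
    and cq: "continuous_on UNIV (\<lambda>(x, y). q x y)"
    and \<tau>: "\<tau>0 > 0" "\<And>\<tau>. 0 < \<tau> \<Longrightarrow> \<tau> < \<tau>0 \<Longrightarrow> g (x + \<tau> * v) (y + \<tau> * w) - g x y \<le> \<tau> * B"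
  shows "p x y * v + q x y * w \<le> B"
proof -
  have "((\<lambda>(x, y). g x y) has_derivative (\<lambda>(tx, ty). p x y * tx + blinfun_mult_right (q x y) ty)) (at (x, y) within UNIV \<times> UNIV)"
  proof (rule has_derivative_partialsI)
    show "((\<lambda>x. g x y) has_derivative (*) (p x y)) (at x)"
      using dx[of y x] by (simp add: has_field_derivative_def)
    show "((\<lambda>y. g x y) has_derivative blinfun_apply (blinfun_mult_right (q x y))) (at y)" for x y
      using dy[of x y] by (simp add: has_field_derivative_def)
    have "continuous_on UNIV (\<lambda>z. blinfun_mult_right (q (fst z) (snd z)) :: real \<Rightarrow>\<^sub>L real)"
      by (intro bounded_linear.continuous_on[OF bounded_linear_blinfun_mult_right]
          continuous_on_curried[OF cq] continuous_intros)
    then show "continuous (at (x, y) within UNIV \<times> UNIV) (\<lambda>(x, y). blinfun_mult_right (q x y) :: real \<Rightarrow>\<^sub>L real)"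
      by (simp add: case_prod_unfold continuous_on_eq_continuous_within)
  qed auto
  then have D: "((\<lambda>(x, y). g x y) has_derivative (\<lambda>(tx, ty). p x y * tx + q x y * ty)) (at (x, y))"
    by simp
  have L: "((\<lambda>\<tau>. (x + \<tau> * v, y + \<tau> * w)) has_derivative (\<lambda>\<tau>. (\<tau> * v, \<tau> * w))) (at 0)"
    by (auto intro!: derivative_eq_intros)
  have "((\<lambda>\<tau>. (\<lambda>(x, y). g x y) (x + \<tau> * v, y + \<tau> * w)) has_derivative
      (\<lambda>\<tau>. (\<lambda>(tx, ty). p x y * tx + q x y * ty) (\<tau> * v, \<tau> * w))) (at 0)"
    by (rule has_derivative_compose[OF L]) (use D in simp)
  moreover have "(\<lambda>\<tau>. (\<lambda>(tx, ty). p x y * tx + q x y * ty) (\<tau> * v, \<tau> * w)) = (*) (p x y * v + q x y * w)"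
    by (auto simp: fun_eq_iff algebra_simps)
  ultimately have "((\<lambda>\<tau>. g (x + \<tau> * v) (y + \<tau> * w)) has_real_derivative (p x y * v + q x y * w)) (at 0)"
    by (simp add: has_field_derivative_def)
  then have "((\<lambda>\<tau>. (g (x + \<tau> * v) (y + \<tau> * w) - g x y) / \<tau>) \<longlongrightarrow> p x y * v + q x y * w) (at_right 0)"
    by (auto simp: has_field_derivative_iff intro: tendsto_within_subset)
  moreover have "\<forall>\<^sub>F \<tau> in at_right 0. (g (x + \<tau> * v) (y + \<tau> * w) - g x y) / \<tau> \<le> B"
    using eventually_at_right_real[OF \<tau>(1)]
  proof eventually_elim
    case (elim \<tau>)
    then show ?case using \<tau>(2)[of \<tau>] by (simp add: field_simps)
  qed
  ultimately show ?thesis by (intro tendsto_upperbound) auto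
qed

text \<open>Averaging over a box of side \<open>e\<close> turns a continuous function into a \<open>C\<^sup>1\<close> function with
  continuous mixed second derivative, and it preserves one-sided Lipschitz bounds.\<close>

lemma box_average:
  fixes h :: "real \<Rightarrow> real \<Rightarrow> real"
  assumes ch: "continuous_on UNIV (\<lambda>(x, y). h x y)" and e: "e > 0"
    and per: "\<And>x y. h (x + 1) y = h x y + a $ 1" "\<And>x y. h x (y + 1) = h x y + a $ 2"
  shows "\<exists>g p q. smooth_form a g p q \<and>
    (\<forall>x y v w B. (\<exists>\<tau>0>0. \<forall>\<tau> s t. 0 < \<tau> \<and> \<tau> < \<tau>0 \<and> s \<in> {0..e} \<and> t \<in> {0..e} \<longrightarrow>
        h (x + s + \<tau> * v) (y + t + \<tau> * w) - h (x + s) (y + t) \<le> \<tau> * B) \<longrightarrow>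
      p x y * v + q x y * w \<le> B)"
proof -
  define E where "E = e\<^sup>2"
  have E: "E > 0" using e by (simp add: E_def)
  define I1 where "I1 x y = integral {0..e} (\<lambda>s. h (x + s) y)" for x y
  define I2 where "I2 x y = integral {0..e} (\<lambda>t. h x (y + t))" for x y
  define g where "g x y = integral {0..e} (\<lambda>s. I2 (x + s) y) / E" for x y
  define p where "p x y = (I2 (x + e) y - I2 x y) / E" for x y
  define q where "q x y = (I1 x (y + e) - I1 x y) / E" for x y
  \<comment> \<open>The mixed derivative of a box average is a second difference of
    \<open>h\<close>, hence continuous as soon as \<open>h\<close> is.\<close>
  define r where "r x y = (h (x + e) (y + e) - h (x + e) y - h x (y + e) + h x y) / E" for x y
  note hc = continuous_on_curried[OF ch]
  have cI1: "continuous_on UNIV (\<lambda>(x, y). I1 x y)"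
    unfolding I1_def case_prod_unfold
    using integral_continuous_on_param[of UNIV 0 e "\<lambda>z s. h (fst z + s) (snd z)"]
    by (simp add: case_prod_unfold hc continuous_intros)
  have cI2: "continuous_on UNIV (\<lambda>(x, y). I2 x y)"
    unfolding I2_def case_prod_unfold
    using integral_continuous_on_param[of UNIV 0 e "\<lambda>z t. h (fst z) (snd z + t)"]
    by (simp add: case_prod_unfold hc continuous_intros)
  note I1c = continuous_on_curried[OF cI1]
  note I2c = continuous_on_curried[OF cI2]
  have cg: "continuous_on UNIV (\<lambda>(x, y). g x y)"
    unfolding g_def case_prod_unfold
    using integral_continuous_on_param[of UNIV 0 e "\<lambda>z s. I2 (fst z + s) (snd z)"] E
    by (intro continuous_intros) (simp_all add: case_prod_unfold I2c continuous_intros)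
  have cp: "continuous_on UNIV (\<lambda>(x, y). p x y)" and cq: "continuous_on UNIV (\<lambda>(x, y). q x y)"
    and cr: "continuous_on UNIV (\<lambda>(x, y). r x y)"
    unfolding p_def q_def r_def case_prod_unfold using E by (intro continuous_intros I1c I2c hc; simp)+
  \<comment> \<open>By Fubini either variable may be averaged last, so the one-variable derivative
    lemma serves both directions.\<close>
  have swap: "integral {0..e} (\<lambda>s. I2 (x + s) y) = integral {0..e} (\<lambda>t. I1 x (y + t))" for x y
  proof -
    have "continuous_on (cbox (0, 0) (e, e)) (\<lambda>(s, t). h (x + s) (y + t))"
      unfolding case_prod_unfold by (intro hc continuous_intros)
    from integral_swap_continuous[OF this] show ?thesis by (simp add: I1_def I2_def)
  qed
  have dgx: "((\<lambda>x. g x y) has_real_derivative p x y) (at x)" for x y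
    unfolding g_def p_def
    by (intro DERIV_cdivide window_derivative e I2c continuous_intros)
  have dgy: "((\<lambda>y. g x y) has_real_derivative q x y) (at y)" for x y
    unfolding g_def q_def swap
    by (intro DERIV_cdivide window_derivative e I1c continuous_intros)
  have dpy: "((\<lambda>y. p x y) has_real_derivative r x y) (at y)" for x y
  proof -
    have "((\<lambda>y. p x y) has_real_derivative ((h (x + e) (y + e) - h (x + e) y) - (h x (y + e) - h x y)) / E) (at y)"
      unfolding p_def I2_def
      by (intro DERIV_cdivide DERIV_diff window_derivative e hc continuous_intros)
    then show ?thesis by (simp add: r_def algebra_simps)
  qed
  have dqx: "((\<lambda>x. q x y) has_real_derivative r x y) (at x)" for x y
  proof -
    have "((\<lambda>x. q x y) has_real_derivative ((h (x + e) (y + e) - h x (y + e)) - (h (x + e) y - h x y)) / E) (at x)"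
      unfolding q_def I1_def
      by (intro DERIV_cdivide DERIV_diff window_derivative e hc continuous_intros)
    then show ?thesis by (simp add: r_def algebra_simps)
  qed
  have int: "(\<lambda>t. h (x + s) (y + t)) integrable_on {0..e}" "(\<lambda>s. I2 (x + s) y) integrable_on {0..e}" for x y s
    by (intro integrable_continuous_real hc I2c continuous_intros)+
  \<comment> \<open>Averaging is monotone. This carries over the directional bounds and, used both
    ways, the periods.\<close>
  have mono: "g x' y' - g x y \<le> B"
    if bd: "\<And>s t. s \<in> {0..e} \<Longrightarrow> t \<in> {0..e} \<Longrightarrow> h (x' + s) (y' + t) - h (x + s) (y + t) \<le> B" for x y x' y' B
  proof -
    have I: "I2 (x' + s) y' - I2 (x + s) y \<le> e * B" if s: "s \<in> {0..e}" for s
    proof -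
      have "I2 (x' + s) y' - I2 (x + s) y = integral {0..e} (\<lambda>t. h (x' + s) (y' + t) - h (x + s) (y + t))"
        unfolding I2_def by (rule integral_diff[symmetric]) (rule int)+
      also have "\<dots> \<le> integral {0..e} (\<lambda>t. B)"
        by (intro integral_le integrable_diff int bd s) auto
      finally show ?thesis using e by simp
    qed
    have "integral {0..e} (\<lambda>s. I2 (x' + s) y') - integral {0..e} (\<lambda>s. I2 (x + s) y)
        = integral {0..e} (\<lambda>s. I2 (x' + s) y' - I2 (x + s) y)"
      by (rule integral_diff[symmetric]) (rule int)+
    also have "\<dots> \<le> integral {0..e} (\<lambda>s. e * B)"
      by (intro integral_le integrable_diff int I) auto
    finally have "integral {0..e} (\<lambda>s. I2 (x' + s) y') - integral {0..e} (\<lambda>s. I2 (x + s) y) \<le> E * B"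
      using e by (simp add: E_def power2_eq_square)
    then show ?thesis using E by (simp add: g_def field_simps)
  qed
  have shift: "g x' y' = g x y + c" if "\<And>s t. h (x' + s) (y' + t) = h (x + s) (y + t) + c" for x y x' y' c
    using mono[of x' y' x y c] mono[of x y x' y' "- c"] that by simp
  have "smooth_form a g p q"
    unfolding smooth_form_def
  proof (intro conjI allI exI[of _ r] cg cp cq cr dgx dgy dpy dqx)
    show "g (x + 1) y = g x y + a $ 1" for x y
      using per(1)[of "x + _" "y + _"] by (intro shift) (simp add: ac_simps)
    show "g x (y + 1) = g x y + a $ 2" for x y
      using per(2)[of "x + _" "y + _"] by (intro shift) (simp add: ac_simps)
  qed
  moreover have "p x y * v + q x y * w \<le> B"
    if "\<tau>0 > 0" "\<forall>\<tau> s t. 0 < \<tau> \<and> \<tau> < \<tau>0 \<and> s \<in> {0..e} \<and> t \<in> {0..e} \<longrightarrow>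
        h (x + s + \<tau> * v) (y + t + \<tau> * w) - h (x + s) (y + t) \<le> \<tau> * B" for x y v w B \<tau>0
  proof (rule directional_bound[OF dgx dgy cq that(1)])
    fix \<tau> assume \<tau>: "0 < \<tau>" "\<tau> < \<tau>0"
    show "g (x + \<tau> * v) (y + \<tau> * w) - g x y \<le> \<tau> * B"
    proof (rule mono)
      fix s t assume "s \<in> {0..e}" "t \<in> {0..e}"
      then show "h (x + \<tau> * v + s) (y + \<tau> * w + t) - h (x + s) (y + t) \<le> \<tau> * B"
        using that(2)[rule_format, of \<tau> s t] \<tau> by (simp add: ac_simps)
    qed
  qed
  ultimately show ?thesis by blast
qed

section \<open>The area inequality\<close>

definition pt :: "real \<Rightarrow> real \<Rightarrow> real ^ 2" where
  "pt x y = x *\<^sub>R axis 1 1 + y *\<^sub>R axis 2 1"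

lemma pt_nth [simp]: "pt x y $ 1 = x" "pt x y $ 2 = y"
  by (simp_all add: pt_def axis_def)

lemma pt_eta [simp]: "pt (v $ 1) (v $ 2) = v"
  by (simp add: vec_eq_iff forall_2)

lemma pt_add: "pt x y + pt v w = pt (x + v) (y + w)"
  by (simp add: vec_eq_iff forall_2)

lemma norm_pt_le: "norm (pt x y) \<le> \<bar>x\<bar> + \<bar>y\<bar>"
  using norm_le_l1_cart[of "pt x y"] by (simp add: sum_2)

lemma continuous_on_pt [continuous_intros]:
  "continuous_on S f \<Longrightarrow> continuous_on S g \<Longrightarrow> continuous_on S (\<lambda>t. pt (f t) (g t))"
  unfolding pt_def by (intro continuous_intros)

text \<open>The area is an integral over \<open>real ^ 2\<close>, Stokes' theorem above one over
  pairs; \<open>pt\<close> maps boxes to boxes of the same content.\<close>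

lemma integral_cbox_pt:
  fixes \<phi> :: "real ^ 2 \<Rightarrow> real"
  assumes "\<phi> integrable_on cbox 0 1"
  shows "integral (cbox (0, 0) (1, 1)) (\<lambda>(x, y). \<phi> (pt x y)) = integral (cbox 0 1) \<phi>"
    and "(\<lambda>(x, y). \<phi> (pt x y)) integrable_on cbox (0, 0) (1, 1)"
proof -
  define g where "g = (\<lambda>(x, y). pt x y)"
  define h where "h = (\<lambda>v :: real ^ 2. (v $ 1, v $ 2))"
  have hc: "h ` cbox u v = cbox (h u) (h v)" for u v
  proof -
    have "z \<in> h ` cbox u v" if "z \<in> cbox (h u) (h v)" for z
      using that by (intro image_eqI[of _ _ "g z"])
        (auto simp: g_def h_def mem_box_cart forall_2 cbox_Pair_eq split: prod.splits)
    then show ?thesis by (auto simp: h_def mem_box_cart forall_2 cbox_Pair_eq)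
  qed
  have gh: "g (h x) = x" and hg: "h (g z) = z" for x z by (auto simp: g_def h_def split: prod.splits)
  have gc: "g ` cbox u v = cbox (g u) (g v)" for u v
  proof -
    have "g ` cbox u v = g ` (h ` cbox (g u) (g v))" by (simp add: hc hg)
    also have "\<dots> = cbox (g u) (g v)" by (simp add: image_image gh)
    finally show ?thesis .
  qed
  have "((\<lambda>x. \<phi> (g x)) has_integral (1 / 1) *\<^sub>R integral (cbox 0 1) \<phi>) (h ` cbox 0 1)"
  proof (rule has_integral_twiddle)
    show "(\<phi> has_integral integral (cbox 0 1) \<phi>) (cbox 0 1)" using assms by (rule integrable_integral)
    show "continuous (at z) g" for z
    proof -
      have "continuous_on UNIV g" unfolding g_def case_prod_unfold by (intro continuous_intros)
      then show ?thesis using continuous_on_eq_continuous_at[OF open_UNIV] by blast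
    qed
    show "measure lborel (g ` cbox u v) = 1 * measure lborel (cbox u v)" for u v
    proof (cases "cbox u v = {}")
      case False
      then have "cbox (g u) (g v) \<noteq> {}" using gc by blast
      then have "measure lborel (cbox (g u) (g v)) = (v - u) \<bullet> (1, 0) * ((v - u) \<bullet> (0, 1))"
        by (subst content_cbox_cart) (auto simp: UNIV_2 g_def split: prod.splits)
      moreover have "measure lborel (cbox u v) = (v - u) \<bullet> (1, 0) * ((v - u) \<bullet> (0, 1))"
      proof -
        obtain a b c d where uv: "u = (a, b)" "v = (c, d)" by (cases u, cases v)
        then show ?thesis using False unfolding uv content_Pair by (auto simp: cbox_Pair_eq)
      qed
      ultimately show ?thesis by (simp add: gc)
    qed auto
    show "\<exists>w z. g ` cbox u v = cbox w z" for u v using gc by blast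
    show "\<exists>w z. h ` cbox u v = cbox w z" for u v using hc by blast
  qed (auto simp: gh hg)
  moreover have "h ` cbox 0 1 = cbox (0, 0) (1, 1)" by (subst hc) (simp add: h_def)
  moreover have "(\<lambda>x. \<phi> (g x)) = (\<lambda>(x, y). \<phi> (pt x y))" by (auto simp: g_def)
  ultimately have "((\<lambda>(x, y). \<phi> (pt x y)) has_integral integral (cbox 0 1) \<phi>) (cbox (0, 0) (1, 1))" by simp
  then show "integral (cbox (0, 0) (1, 1)) (\<lambda>(x, y). \<phi> (pt x y)) = integral (cbox 0 1) \<phi>"
    and "(\<lambda>(x, y). \<phi> (pt x y)) integrable_on cbox (0, 0) (1, 1)"
    by (auto simp: integral_unique)
qed

section \<open>Unit balls and continuity of the area density\<close>

context periodic_metric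
begin

definition K :: "real ^ 2 \<Rightarrow> (real ^ 2) set" where
  "K x = {v. G x v \<le> 1}"

lemma K_lmeasurable: "K x \<in> lmeasurable"
proof -
  obtain m where m: "m > 0" "\<And>x v. m * norm v \<le> G x v" using bounds_and_comparison(1) by blast
  have "norm v \<le> 1 / m" if "v \<in> K x" for v
    using that m(1) m(2)[of v x] by (simp add: K_def field_simps)
  then have "bounded (K x)" by (auto simp: bounded_iff)
  moreover have "closed (K x)" unfolding K_def by (intro closed_Collect_le continuous_intros)
  ultimately show ?thesis by (simp add: lmeasurable_compact compact_eq_bounded_closed)
qed

lemma K_measure_lower: "\<exists>c>0. \<forall>x. c \<le> measure lebesgue (K x)"
proof -
  obtain M where M: "M > 0" "\<And>x v. G x v \<le> M * norm v" using bounds_and_comparison(2) by blast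
  have sub: "ball 0 (1 / M) \<subseteq> K x" for x
  proof
    fix v :: "real ^ 2" assume "v \<in> ball 0 (1 / M)"
    then show "v \<in> K x" using M(1) M(2)[of x v] by (simp add: K_def field_simps)
  qed
  have "measure lebesgue (ball (0 :: real ^ 2) (1 / M)) > 0"
    using M(1) by (simp add: content_ball_pos measure_completion)
  moreover have "measure lebesgue (ball (0 :: real ^ 2) (1 / M)) \<le> measure lebesgue (K x)" for x
    by (intro measure_mono_fmeasurable sub K_lmeasurable) auto
  ultimately show ?thesis by blast
qed

lemma K_measure_pos: "measure lebesgue (K x) > 0"
  using K_measure_lower by (meson less_le_trans)

lemma K_measure_comparison:
  assumes "c > 0" and "\<And>v. G y v \<le> c * G x v"
  shows "measure lebesgue (K x) \<le> c\<^sup>2 * measure lebesgue (K y)"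
proof -
  have "K x \<subseteq> (\<lambda>v. c *\<^sub>R v) ` K y"
  proof
    fix v assume v: "v \<in> K x"
    have "G y v \<le> c" using assms(1) assms(2)[of v] v by (simp add: K_def)
      (metis mult.right_neutral mult_left_mono order_trans less_imp_le)
    moreover have "G y v = c * G y (v /\<^sub>R c)"
      using homogeneous[of c y "v /\<^sub>R c"] assms(1) by simp
    ultimately have "v /\<^sub>R c \<in> K y" using assms(1) by (simp add: K_def)
    then show "v \<in> (\<lambda>v. c *\<^sub>R v) ` K y" using assms(1) by (intro image_eqI[of _ _ "v /\<^sub>R c"]) auto
  qed
  moreover have "(\<lambda>v. c *\<^sub>R v) ` K y \<in> lmeasurable"
    by (rule measurable_linear_image[OF _ K_lmeasurable]) (rule linear_scale_self)
  ultimately have "measure lebesgue (K x) \<le> measure lebesgue ((\<lambda>v. c *\<^sub>R v) ` K y)"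
    using K_lmeasurable by (intro measure_mono_fmeasurable) auto
  also have "\<dots> = c\<^sup>2 * measure lebesgue (K y)"
    using measure_lebesgue_affine[of c 0 "K y"] assms(1) by simp
  finally show ?thesis .
qed

text \<open>Nearby metrics agree up to a factor \<open>1 + \<delta>\<close>, so the areas of their
  balls agree up to its square; the lower bound \<open>c\<close> on the areas turns this into an
  additive estimate.\<close>

lemma continuous_inverse_K: "continuous_on UNIV (\<lambda>x. 1 / measure lebesgue (K x))"
proof -
  obtain c where c: "c > 0" "\<And>x. c \<le> measure lebesgue (K x)" using K_measure_lower by blast
  define A where "A x = measure lebesgue (K x)" for x
  have A: "A x > 0" "1 / A x \<le> 1 / c" for x
    using c(1) c(2)[of x] K_measure_pos[of x] by (auto simp: A_def frac_le)
  have "\<exists>\<rho>>0. \<forall>x y. dist y x < \<rho> \<longrightarrow> dist (1 / A y) (1 / A x) < \<epsilon>" if \<epsilon>: "\<epsilon> > 0" for \<epsilon>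
  proof -
    \<comment> \<open>For \<open>\<delta>\<close> at most 1 the square of
      \<open>1 + \<delta>\<close> exceeds 1 by at most \<open>3 * \<delta>\<close>, which leaves an
      error of at most \<open>3 * \<epsilon> / 4\<close>.\<close>
    define \<delta> where "\<delta> = min 1 (\<epsilon> * c / 4)"
    have \<delta>: "\<delta> > 0" "\<delta> \<le> 1" "\<delta> \<le> \<epsilon> * c / 4" using \<epsilon> c(1) by (auto simp: \<delta>_def)
    obtain \<rho> where \<rho>: "\<rho> > 0" "\<And>x y v. dist x y < \<rho> \<Longrightarrow> G y v \<le> (1 + \<delta>) * G x v"
      using bounds_and_comparison(3)[OF \<delta>(1)] by blast
    have one: "1 / A y - 1 / A x < \<epsilon>" if "dist x y < \<rho>" for x y
    proof -
      have "A x \<le> (1 + \<delta>)\<^sup>2 * A y"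
        unfolding A_def using \<delta> \<rho>(2)[OF that] by (intro K_measure_comparison) auto
      then have "1 / A y \<le> (1 + \<delta>)\<^sup>2 * (1 / A x)" using A(1)[of x] A(1)[of y] by (simp add: field_simps)
      then have "1 / A y - 1 / A x \<le> ((1 + \<delta>)\<^sup>2 - 1) * (1 / A x)" by (simp add: algebra_simps)
      also have "\<dots> \<le> ((1 + \<delta>)\<^sup>2 - 1) * (1 / c)"
        using A(2)[of x] \<delta> by (intro mult_left_mono) auto
      also have "\<dots> \<le> (3 * \<delta>) * (1 / c)"
        using \<delta> c(1) by (intro mult_right_mono) (auto simp: power2_eq_square algebra_simps mult_left_le)
      also have "\<dots> \<le> 3 * (\<epsilon> * c / 4) * (1 / c)" using \<delta> c(1) by (intro mult_right_mono) auto
      also have "\<dots> < \<epsilon>" using c(1) \<epsilon> by simp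
      finally show ?thesis .
    qed
    show ?thesis
      by (intro exI[of _ \<rho>] conjI \<rho>(1) allI impI)
         (use one in \<open>auto simp: dist_real_def abs_less_iff dist_commute\<close>)
  qed
  then show ?thesis unfolding A_def continuous_on_iff by blast
qed

end

section \<open>Potentials and the integrated area bound\<close>

context systolic_metric
begin

text \<open>The McShane extension, from the lattice to the plane, of the linear function given by
  \<open>a\<close>. Domination makes that function 1-Lipschitz for \<open>d\<close> on the lattice
  and keeps the infimum finite.\<close>

definition potential :: "real ^ 2 \<Rightarrow> real ^ 2 \<Rightarrow> real" where
  "potential a x = (INF z\<in>int_lattice. d x z + a \<bullet> z)"

lemma dominated_le_d:
  assumes "dominated a" "z \<in> int_lattice"
  shows "\<bar>a \<bullet> z\<bar> \<le> d x (x + z)"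
  using assms stable_norm_le_d[of z x] by (force simp: dominated_def)

lemma potential_bdd_below:
  assumes "dominated a"
  shows "bdd_below ((\<lambda>z. d x z + a \<bullet> z) ` int_lattice)"
proof (rule bdd_belowI2)
  fix z assume "z \<in> int_lattice"
  then show "- d x 0 \<le> d x z + a \<bullet> z"
    using dominated_le_d[OF assms, of z 0] d_triangle[of 0 z x] d_commute[of 0 x] by simp
qed

lemma int_lattice_ne: "int_lattice \<noteq> {}"
  using int_lattice_simps(1) by blast

lemma potential_le:
  assumes "dominated a"
  shows "potential a x - potential a y \<le> d x y"
proof -
  have "potential a x - d x y \<le> potential a y"
    unfolding potential_def[of a y]
  proof (rule cINF_greatest[OF int_lattice_ne])
    fix z assume z: "z \<in> int_lattice"
    have "potential a x \<le> d x z + a \<bullet> z"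
      unfolding potential_def by (rule cINF_lower[OF potential_bdd_below[OF assms] z])
    then show "potential a x - d x y \<le> d y z + a \<bullet> z" using d_triangle[of x z y] by simp
  qed
  then show ?thesis by simp
qed

lemma potential_translate_le:
  assumes "dominated a" "w \<in> int_lattice"
  shows "potential a (x + w) \<le> potential a x + a \<bullet> w"
proof -
  have "potential a (x + w) - a \<bullet> w \<le> potential a x"
    unfolding potential_def[of a x]
  proof (rule cINF_greatest[OF int_lattice_ne])
    fix z assume z: "z \<in> int_lattice"
    have "potential a (x + w) \<le> d (x + w) (z + w) + a \<bullet> (z + w)"
      unfolding potential_def by (rule cINF_lower[OF potential_bdd_below[OF assms(1)]]) (use z assms in simp)
    then show "potential a (x + w) - a \<bullet> w \<le> d x z + a \<bullet> z"
      by (simp add: d_translate[OF assms(2)] inner_add_right)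
  qed
  then show ?thesis by simp
qed

lemma potential_translate:
  assumes "dominated a" "w \<in> int_lattice"
  shows "potential a (x + w) = potential a x + a \<bullet> w"
  using potential_translate_le[OF assms, of x] potential_translate_le[OF assms(1), of "- w" "x + w"] assms(2) by simp

lemma potential_continuous:
  assumes "dominated a"
  shows "continuous_on UNIV (potential a)"
proof -
  obtain M where M: "M > 0" "\<And>x y. d x y \<le> M * norm (y - x)" using d_upper by blast
  have "\<bar>potential a x - potential a y\<bar> \<le> M * norm (x - y)" for x y
    using potential_le[OF assms, of x y] potential_le[OF assms, of y x] M(2)[of x y] M(2)[of y x]
    by (simp add: norm_minus_commute abs_le_iff)
  then have "M-lipschitz_on UNIV (potential a)"
    using M(1) by (intro lipschitz_onI) (auto simp: dist_norm)
  then show ?thesis by (rule lipschitz_on_continuous_on)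
qed

text \<open>Along a short segment the potential grows by at most the length of the segment, and near
  \<open>pt x y\<close> this is at most \<open>1 + \<delta>\<close> times the length measured at
  that point. \<open>box_average\<close> passes the bound to the gradient.\<close>

lemma smooth_representative:
  assumes a: "dominated a" and \<delta>: "\<delta> > 0"
  shows "\<exists>g p q. smooth_form a g p q \<and>
    (\<forall>x y v. \<bar>pt (p x y) (q x y) \<bullet> v\<bar> \<le> (1 + \<delta>) * G (pt x y) v)"
proof -
  obtain \<rho> where \<rho>: "\<rho> > 0" "\<And>x y v. dist x y < \<rho> \<Longrightarrow> G y v \<le> (1 + \<delta>) * G x v"
    using bounds_and_comparison(3)[OF \<delta>] by blast
  \<comment> \<open>A shift within the averaging box has norm at most \<open>2 * e\<close>, which is
    \<open>\<rho> / 2\<close>; the other half of \<open>\<rho>\<close> is left for the step along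
    \<open>V\<close>.\<close>
  define e where "e = \<rho> / 4"
  have e: "e > 0" using \<rho>(1) by (simp add: e_def)
  define h where "h x y = potential a (pt x y)" for x y
  have "continuous_on UNIV (\<lambda>(x, y). h x y)"
    unfolding h_def case_prod_unfold
    by (rule continuous_on_compose2[OF potential_continuous[OF a]]) (auto intro!: continuous_intros)
  moreover have "h (x + 1) y = h x y + a $ 1" "h x (y + 1) = h x y + a $ 2" for x y
  proof -
    have "pt 1 0 \<in> int_lattice" "pt 0 1 \<in> int_lattice" by (auto simp: int_lattice_def forall_2)
    then show "h (x + 1) y = h x y + a $ 1" "h x (y + 1) = h x y + a $ 2"
      using potential_translate[OF a, of "pt 1 0" "pt x y"] potential_translate[OF a, of "pt 0 1" "pt x y"]
      by (simp_all add: h_def pt_add inner_vec_def sum_2)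
  qed
  ultimately obtain g p q where g: "smooth_form a g p q"
    and pq: "\<And>x y v w B \<tau>0. \<tau>0 > 0 \<Longrightarrow> (\<And>\<tau> s t. 0 < \<tau> \<Longrightarrow> \<tau> < \<tau>0 \<Longrightarrow> s \<in> {0..e} \<Longrightarrow> t \<in> {0..e} \<Longrightarrow>
        h (x + s + \<tau> * v) (y + t + \<tau> * w) - h (x + s) (y + t) \<le> \<tau> * B) \<Longrightarrow>
      p x y * v + q x y * w \<le> B"
    using box_average[of h e a] e by (smt (verit, del_insts))
  have one: "pt (p x y) (q x y) \<bullet> V \<le> (1 + \<delta>) * G (pt x y) V" for x y V
  proof -
    \<comment> \<open>Keeps \<open>\<tau> * norm V\<close> below \<open>\<rho> / 2\<close>; the
      added 1 covers \<open>V = 0\<close>.\<close>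
    define \<tau>0 where "\<tau>0 = \<rho> / (2 * (norm V + 1))"
    have n: "norm V + 1 > 0" using norm_ge_zero[of V] by linarith
    have "p x y * V $ 1 + q x y * V $ 2 \<le> (1 + \<delta>) * G (pt x y) V"
    proof (rule pq)
      show "\<tau>0 > 0" using \<rho>(1) n by (simp add: \<tau>0_def)
      fix \<tau> s t assume \<tau>: "0 < \<tau>" "\<tau> < \<tau>0" and st: "s \<in> {0..e}" "t \<in> {0..e}"
      define X where "X = pt (x + s) (y + t)"
      have X': "pt (x + s + \<tau> * V $ 1) (y + t + \<tau> * V $ 2) = X + \<tau> *\<^sub>R V"
        by (simp add: X_def vec_eq_iff forall_2)
      have "\<tau> * (2 * (norm V + 1)) < \<rho>" using \<tau>(2) n by (simp add: \<tau>0_def field_simps)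
      then have \<tau>V: "\<tau> * norm V < \<rho> / 2" using \<tau>(1) by (simp add: algebra_simps)
      have "norm (X - pt x y) \<le> \<bar>s\<bar> + \<bar>t\<bar>"
      proof -
        have "X - pt x y = pt s t" by (simp add: X_def vec_eq_iff forall_2)
        then show ?thesis using norm_pt_le by simp
      qed
      then have nX: "norm (X - pt x y) \<le> \<rho> / 2" using st by (simp add: e_def)
      have "h (x + s + \<tau> * V $ 1) (y + t + \<tau> * V $ 2) - h (x + s) (y + t) \<le> d (X + \<tau> *\<^sub>R V) X"
        unfolding h_def X' by (unfold X_def[symmetric]) (rule potential_le[OF a])
      also have "\<dots> \<le> seglen G X (X + \<tau> *\<^sub>R V)"
        using d_seglen[of X "X + \<tau> *\<^sub>R V"] d_commute[of X "X + \<tau> *\<^sub>R V"] by simp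
      also have "\<dots> \<le> (1 + \<delta>) * G (pt x y) (\<tau> *\<^sub>R V)"
      proof (rule seglen_le)
        fix r :: real assume r: "r \<in> {0..1}"
        have "norm (X + r *\<^sub>R (\<tau> *\<^sub>R V) - pt x y) \<le> norm (X - pt x y) + norm (r *\<^sub>R (\<tau> *\<^sub>R V))"
          using norm_triangle_ineq[of "X - pt x y" "r *\<^sub>R (\<tau> *\<^sub>R V)"] by (simp add: algebra_simps)
        also have "norm (r *\<^sub>R (\<tau> *\<^sub>R V)) \<le> \<tau> * norm V"
          using r \<tau>(1) by (simp add: abs_mult mult_left_le_one_le)
        finally have "dist (pt x y) (X + r *\<^sub>R (\<tau> *\<^sub>R V)) < \<rho>"
          using nX \<tau>V by (simp add: dist_norm norm_minus_commute)
        from \<rho>(2)[OF this] show "G (X + r *\<^sub>R (X + \<tau> *\<^sub>R V - X)) (X + \<tau> *\<^sub>R V - X)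
           \<le> (1 + \<delta>) * G (pt x y) (\<tau> *\<^sub>R V)" by simp
      qed
      also have "\<dots> = \<tau> * ((1 + \<delta>) * G (pt x y) V)"
        using homogeneous[of \<tau>] \<tau>(1) by simp
      finally show "h (x + s + \<tau> * V $ 1) (y + t + \<tau> * V $ 2) - h (x + s) (y + t)
         \<le> \<tau> * ((1 + \<delta>) * G (pt x y) V)" .
    qed
    then show ?thesis by (simp add: inner_vec_def sum_2)
  qed
  have "\<bar>pt (p x y) (q x y) \<bullet> v\<bar> \<le> (1 + \<delta>) * G (pt x y) v" for x y v
    using one[of x y v] one[of x y "- v"] by (simp add: abs_le_iff even)
  then show ?thesis using g by blast
qed

lemma area_bound_aux:
  assumes \<delta>: "\<delta> > 0"
  shows "\<sigma>\<^sup>2 / 4 / (1 + \<delta>)\<^sup>2 \<le> integral (cbox 0 1) (\<lambda>x. 1 / measure lebesgue (K x))"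
proof -
  obtain b1 b2 b3 w1 w2 w3 where dom: "dominated b1" "dominated b2" "dominated b3"
    and w: "0 \<le> w1" "0 \<le> w2" "0 \<le> w3" "w1 + w2 + w3 = 1"
    and sys: "\<sigma>\<^sup>2 / 4 \<le> \<bar>wedge b1 b2\<bar> * w1 * w2 + \<bar>wedge b1 b3\<bar> * w1 * w3 + \<bar>wedge b2 b3\<bar> * w2 * w3"
    using dominated_covectors by blast
  obtain g1 p1 q1 where f1: "smooth_form b1 g1 p1 q1"
    and l1: "\<And>x y v. \<bar>pt (p1 x y) (q1 x y) \<bullet> v\<bar> \<le> (1 + \<delta>) * G (pt x y) v"
    using smooth_representative[OF dom(1) \<delta>] by blast
  obtain g2 p2 q2 where f2: "smooth_form b2 g2 p2 q2"
    and l2: "\<And>x y v. \<bar>pt (p2 x y) (q2 x y) \<bullet> v\<bar> \<le> (1 + \<delta>) * G (pt x y) v"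
    using smooth_representative[OF dom(2) \<delta>] by blast
  obtain g3 p3 q3 where f3: "smooth_form b3 g3 p3 q3"
    and l3: "\<And>x y v. \<bar>pt (p3 x y) (q3 x y) \<bullet> v\<bar> \<le> (1 + \<delta>) * G (pt x y) v"
    using smooth_representative[OF dom(3) \<delta>] by blast
  have c: "continuous_on UNIV (\<lambda>(x, y). p1 x y)" "continuous_on UNIV (\<lambda>(x, y). q1 x y)"
    "continuous_on UNIV (\<lambda>(x, y). p2 x y)" "continuous_on UNIV (\<lambda>(x, y). q2 x y)"
    "continuous_on UNIV (\<lambda>(x, y). p3 x y)" "continuous_on UNIV (\<lambda>(x, y). q3 x y)"
    using f1 f2 f3 by (simp_all add: smooth_form_def)
  note cc = c[THEN continuous_on_curried]
  let ?Q = "cbox (0 :: real, 0 :: real) (1, 1)"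
  define W12 where "W12 = (\<lambda>(x, y). p1 x y * q2 x y - q1 x y * p2 x y)"
  define W13 where "W13 = (\<lambda>(x, y). p1 x y * q3 x y - q1 x y * p3 x y)"
  define W23 where "W23 = (\<lambda>(x, y). p2 x y * q3 x y - q2 x y * p3 x y)"
  \<comment> \<open>The sign of the constant wedge is built into the coefficient. Pointwise the
    signed wedge is at most its absolute value, while its integral is exactly the absolute value of
    the constant wedge.\<close>
  define s12 where "s12 = sgn (wedge b1 b2) * (w1 * w2)"
  define s13 where "s13 = sgn (wedge b1 b3) * (w1 * w3)"
  define s23 where "s23 = sgn (wedge b2 b3) * (w2 * w3)"
  have i: "W12 integrable_on ?Q" "W13 integrable_on ?Q" "W23 integrable_on ?Q"
    unfolding W12_def W13_def W23_def case_prod_unfold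
    by (intro integrable_continuous continuous_intros cc)+
  have I: "integral ?Q W12 = wedge b1 b2" "integral ?Q W13 = wedge b1 b3" "integral ?Q W23 = wedge b2 b3"
    unfolding W12_def W13_def W23_def
    by (rule smooth_form_wedge_integral f1 f2 f3)+
  define S where "S z = s12 * W12 z + s13 * W13 z + s23 * W23 z" for z
  have sgn_abs: "sgn x * x = \<bar>x\<bar>" for x :: real by (simp add: abs_sgn mult.commute)
  have iS: "S integrable_on ?Q" unfolding S_def by (intro integrable_add integrable_on_mult_right i)
  have "integral ?Q S = s12 * wedge b1 b2 + s13 * wedge b1 b3 + s23 * wedge b2 b3"
    unfolding S_def by (simp add: integral_add integrable_add integrable_on_mult_right i I)
  also have "\<dots> = (sgn (wedge b1 b2) * wedge b1 b2) * w1 * w2 + (sgn (wedge b1 b3) * wedge b1 b3) * w1 * w3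
      + (sgn (wedge b2 b3) * wedge b2 b3) * w2 * w3"
    by (simp only: s12_def s13_def s23_def ac_simps)
  also have "\<dots> = \<bar>wedge b1 b2\<bar> * w1 * w2 + \<bar>wedge b1 b3\<bar> * w1 * w3 + \<bar>wedge b2 b3\<bar> * w2 * w3"
    by (simp only: sgn_abs)
  finally have IS: "\<sigma>\<^sup>2 / 4 \<le> integral ?Q S" using sys by simp
  have point: "S (x, y) / (1 + \<delta>)\<^sup>2 \<le> 1 / measure lebesgue (K (pt x y))" for x y
  proof -
    define c1 where "c1 = pt (p1 x y) (q1 x y) /\<^sub>R (1 + \<delta>)"
    define c2 where "c2 = pt (p2 x y) (q2 x y) /\<^sub>R (1 + \<delta>)"
    define c3 where "c3 = pt (p3 x y) (q3 x y) /\<^sub>R (1 + \<delta>)"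
    have le1: "\<bar>(u /\<^sub>R (1 + \<delta>)) \<bullet> v\<bar> \<le> 1"
      if "\<bar>u \<bullet> v\<bar> \<le> (1 + \<delta>) * G (pt x y) v" "v \<in> K (pt x y)" for u v
    proof -
      have "(1 + \<delta>) * G (pt x y) v \<le> (1 + \<delta>) * 1"
        using that(2) \<delta> by (intro mult_left_mono) (auto simp: K_def)
      then have "\<bar>u \<bullet> v\<bar> \<le> 1 + \<delta>" using that(1) by simp
      then show ?thesis using \<delta> by (simp add: abs_mult field_simps)
    qed
    have "measure lebesgue (K (pt x y)) *
       (\<bar>wedge c1 c2\<bar> * w1 * w2 + \<bar>wedge c1 c3\<bar> * w1 * w3 + \<bar>wedge c2 c3\<bar> * w2 * w3) \<le> 1"
      by (rule measure_three_strips[OF K_lmeasurable w])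
         (auto simp: c1_def c2_def c3_def simp del: inner_scaleR_left intro!: le1 l1 l2 l3)
    then have le: "\<bar>wedge c1 c2\<bar> * w1 * w2 + \<bar>wedge c1 c3\<bar> * w1 * w3 + \<bar>wedge c2 c3\<bar> * w2 * w3
        \<le> 1 / measure lebesgue (K (pt x y))"
      using K_measure_pos[of "pt x y"] by (simp add: field_simps)
    have sgn_le: "sgn r * t \<le> \<bar>t\<bar>" for r t :: real
      by (cases r "0 :: real" rule: linorder_cases) auto
    have wedge_scale: "wedge (u /\<^sub>R c) (v /\<^sub>R c) = wedge u v / c\<^sup>2" for u v c
      by (simp add: wedge_def power2_eq_square divide_inverse algebra_simps)
    have W: "W12 (x, y) / (1 + \<delta>)\<^sup>2 = wedge c1 c2" "W13 (x, y) / (1 + \<delta>)\<^sup>2 = wedge c1 c3"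
       "W23 (x, y) / (1 + \<delta>)\<^sup>2 = wedge c2 c3"
      unfolding c1_def c2_def c3_def wedge_scale by (simp_all add: W12_def W13_def W23_def wedge_def)
    have "S (x, y) / (1 + \<delta>)\<^sup>2 = s12 * (W12 (x, y) / (1 + \<delta>)\<^sup>2) + s13 * (W13 (x, y) / (1 + \<delta>)\<^sup>2)
        + s23 * (W23 (x, y) / (1 + \<delta>)\<^sup>2)"
      by (simp add: S_def add_divide_distrib)
    also have "\<dots> = (sgn (wedge b1 b2) * wedge c1 c2) * (w1 * w2) + (sgn (wedge b1 b3) * wedge c1 c3) * (w1 * w3)
        + (sgn (wedge b2 b3) * wedge c2 c3) * (w2 * w3)"
      unfolding W s12_def s13_def s23_def by (simp only: ac_simps)
    also have "\<dots> \<le> \<bar>wedge c1 c2\<bar> * (w1 * w2) + \<bar>wedge c1 c3\<bar> * (w1 * w3) + \<bar>wedge c2 c3\<bar> * (w2 * w3)"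
      using w by (intro add_mono mult_right_mono sgn_le) auto
    finally show ?thesis using le by (simp add: mult.assoc)
  qed
  have iK: "(\<lambda>x. 1 / measure lebesgue (K x)) integrable_on cbox 0 1"
    by (rule integrable_continuous) (rule continuous_on_subset[OF continuous_inverse_K], simp)
  have "\<sigma>\<^sup>2 / 4 / (1 + \<delta>)\<^sup>2 \<le> integral ?Q S / (1 + \<delta>)\<^sup>2"
    by (rule divide_right_mono[OF IS]) simp
  also have "\<dots> = integral ?Q (\<lambda>z. S z / (1 + \<delta>)\<^sup>2)" by simp
  also have "\<dots> \<le> integral ?Q (\<lambda>(x, y). 1 / measure lebesgue (K (pt x y)))"
    by (intro integral_le integral_cbox_pt(2)[OF iK] integrable_on_divide iS) (auto simp: point)
  also have "\<dots> = integral (cbox 0 1) (\<lambda>x. 1 / measure lebesgue (K x))"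
    by (rule integral_cbox_pt(1)[OF iK])
  finally show ?thesis .
qed

theorem area_bound: "\<sigma>\<^sup>2 / 4 \<le> integral (cbox 0 1) (\<lambda>x. 1 / measure lebesgue (K x))"
proof (rule tendsto_upperbound)
  have "((\<lambda>\<delta>. \<sigma>\<^sup>2 / 4 / (1 + \<delta>)\<^sup>2) \<longlongrightarrow> \<sigma>\<^sup>2 / 4 / (1 + 0)\<^sup>2) (at_right 0)"
    by (intro tendsto_intros) auto
  then show "((\<lambda>\<delta>. \<sigma>\<^sup>2 / 4 / (1 + \<delta>)\<^sup>2) \<longlongrightarrow> \<sigma>\<^sup>2 / 4) (at_right 0)" by simp
  show "\<forall>\<^sub>F \<delta> in at_right 0. \<sigma>\<^sup>2 / 4 / (1 + \<delta>)\<^sup>2 \<le> integral (cbox 0 1) (\<lambda>x. 1 / measure lebesgue (K x))"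
    using eventually_at_right_less[of "0::real"] by eventually_elim (rule area_bound_aux)
qed auto

end

lemma finsler_lift_periodic_metric:
  assumes F: "finsler_metric F" and r: "reversible F"
  shows "periodic_metric (finsler_lift F)"
proof
  show "continuous_on UNIV (\<lambda>(x, v). finsler_lift F x v)" by (rule finsler_metric_lift_continuous[OF F])
  show "0 < finsler_lift F x v" if "v \<noteq> 0" for x v
    using F that by (simp add: finsler_metric_def nonsym_norm_def finsler_lift_def)
  show "finsler_lift F x (c *\<^sub>R v) = c * finsler_lift F x v" if "0 \<le> c" for x v c
    using F that by (simp add: finsler_metric_def nonsym_norm_def finsler_lift_def)
  show "finsler_lift F x (- v) = finsler_lift F x v" for x v
    using r by (simp add: reversible_def finsler_lift_def)
  show "finsler_lift F (x + z) v = finsler_lift F x v" if "z \<in> int_lattice" for x z v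
  proof -
    have "torus_proj (x + z) = torus_proj x" using that by (simp add: torus_proj_lattice)
    then show ?thesis by (simp add: finsler_lift_def)
  qed
qed

theorem area_systole:
  assumes F: "finsler_metric F" and r: "reversible F"
  shows "pi / 4 * (systole F)\<^sup>2 \<le> area_BH F"
proof -
  interpret periodic_metric "finsler_lift F" by (rule finsler_lift_periodic_metric[OF F r])
  have area: "area_BH F = pi * integral (cbox 0 1) (\<lambda>x. 1 / measure lebesgue (K x))"
    unfolding area_BH_def unit_body_def K_def by (simp flip: integral_mult_right)
  show ?thesis
  \<comment> \<open>The locale asks for a positive \<open>\<sigma>\<close>; for systole 0 the bound
    says that the area is nonnegative.\<close>
  proof (cases "systole F > 0")
    case True
    interpret systolic_metric "finsler_lift F" "systole F"
      by unfold_locales (use True systole_le_polygon[OF F] in auto)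
    show ?thesis using mult_left_mono[OF area_bound, of pi] by (simp add: area)
  next
    case False
    then have "systole F = 0" using systole_nonneg[OF F] by simp
    moreover have "0 \<le> integral (cbox 0 1) (\<lambda>x. 1 / measure lebesgue (K x))"
      by (rule integral_nonneg)
         (auto intro!: integrable_continuous continuous_on_subset[OF continuous_inverse_K])
    ultimately show ?thesis by (simp add: area)
  qed
qed

section \<open>The supremum norm\<close>

lemma infnorm_max: "infnorm (v :: real ^ 2) = max \<bar>v $ 1\<bar> \<bar>v $ 2\<bar>"
proof -
  have "{\<bar>v $ i\<bar> |i. i \<in> UNIV} = {\<bar>v $ 1\<bar>, \<bar>v $ 2\<bar>}" by (auto simp: exhaust_2) (metis exhaust_2)
  then show ?thesis by (simp add: infnorm_cart cSup_eq_Max)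
qed

lemma finsler_metric_infnorm: "finsler_metric (flat_metric infnorm)"
  unfolding finsler_metric_def flat_metric_def nonsym_norm_def
proof (intro conjI allI impI)
  show "continuous_on UNIV (\<lambda>(x :: torus, v :: real ^ 2). infnorm v)"
    unfolding case_prod_unfold infnorm_max by (intro continuous_intros)
  show "convex_on UNIV (infnorm :: real ^ 2 \<Rightarrow> real)"
  proof (intro convex_onI convex_UNIV)
    fix t :: real and x y :: "real ^ 2" assume "0 < t" "t < 1"
    then show "infnorm ((1 - t) *\<^sub>R x + t *\<^sub>R y) \<le> (1 - t) * infnorm x + t * infnorm y"
      using infnorm_triangle[of "(1 - t) *\<^sub>R x" "t *\<^sub>R y"] by (simp add: infnorm_mul)
  qed
qed (auto simp: infnorm_pos_lt infnorm_mul)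

lemma reversible_infnorm: "reversible (flat_metric infnorm)"
  by (simp add: reversible_def flat_metric_def infnorm_neg)

lemma area_BH_infnorm: "area_BH (flat_metric infnorm) = pi / 4"
proof -
  have "unit_body (flat_metric infnorm) x = {w. \<bar>w $ 1\<bar> \<le> 1 \<and> \<bar>w $ 2\<bar> \<le> 1}" for x
    by (auto simp: unit_body_def finsler_lift_def flat_metric_def infnorm_max)
  then have "area_BH (flat_metric infnorm) = integral (cbox 0 1) (\<lambda>x :: real ^ 2. pi / 4)"
    by (simp add: area_BH_def measure_square)
  also have "\<dots> = measure lborel (cbox 0 (1 :: real ^ 2)) * (pi / 4)" by simp
  also have "measure lborel (cbox 0 (1 :: real ^ 2)) = 1"
    by (simp add: content_cbox_cart interval_ne_empty_cart)
  finally show ?thesis by simp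
qed

lemma systole_infnorm_le: "systole (flat_metric infnorm) \<le> 1"
proof -
  define P :: "nat \<Rightarrow> real ^ 2" where "P i = real i *\<^sub>R axis 1 1" for i
  have "P 1 - P 0 \<in> int_lattice" by (simp add: P_def int_lattice_def axis_def)
  moreover have "P 1 \<noteq> P 0" by (simp add: P_def axis_eq_0_iff)
  ultimately have "systole (flat_metric infnorm)
      \<le> (\<Sum>i<1. seglen (finsler_lift (flat_metric infnorm)) (P i) (P (Suc i)))"
    by (rule systole_le_polygon[OF finsler_metric_infnorm])
  also have "\<dots> = 1"
    by (simp add: seglen_def finsler_lift_def flat_metric_def P_def infnorm_max axis_def)
  finally show ?thesis .
qed

lemma infnorm_integral_le:
  fixes v :: "real \<Rightarrow> real ^ 2"
  assumes v: "(v has_integral w) {a..b}" and n: "((\<lambda>t. infnorm (v t)) has_integral J) {a..b}"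
  shows "infnorm w \<le> J"
proof -
  have "\<bar>w $ i\<bar> \<le> J" for i
  proof -
    have "((\<lambda>t. v t $ i) has_integral w $ i) {a..b}"
      using has_integral_linear[OF v bounded_linear_vec_nth[of i]] by (simp add: o_def)
    then have "norm (integral {a..b} (\<lambda>t. v t $ i)) \<le> integral {a..b} (\<lambda>t. infnorm (v t))"
      using n by (intro integral_norm_bound_integral) (auto simp: component_le_infnorm_cart has_integral_integrable)
    then show ?thesis
      using \<open>((\<lambda>t. v t $ i) has_integral w $ i) {a..b}\<close> n by (simp add: integral_unique)
  qed
  then show ?thesis by (simp add: infnorm_max)
qed

text \<open>In the open interval the torus velocity is the derivative of the plane piece, whose
  displacement is at most its length; the end points form a null set.\<close>

lemma piece_length:
  assumes ab: "a < b" and g: "smooth_curve a b g" and \<gamma>: "\<forall>t\<in>{a..b}. \<gamma> t = torus_proj (g t)"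
  shows "\<exists>J. ((\<lambda>t. infnorm (torus_velocity \<gamma> t)) has_integral J) {a..b} \<and> infnorm (g b - g a) \<le> J"
proof -
  obtain D where D: "D 0 = g" "\<And>k t. t \<in> {a..b} \<Longrightarrow>
      (D k has_vector_derivative D (Suc k) t) (at t within {a..b})"
    using g unfolding smooth_curve_def by blast
  have "continuous_on {a..b} (D 1)"
    unfolding continuous_on_eq_continuous_within
    by (intro ballI has_vector_derivative_continuous[OF D(2)])
  then have "continuous_on {a..b} (\<lambda>t. infnorm (D 1 t))"
    unfolding infnorm_max by (intro continuous_intros)
  then have "(\<lambda>t. infnorm (D 1 t)) integrable_on {a..b}" by (rule integrable_continuous_real)
  then obtain J where J: "((\<lambda>t. infnorm (D 1 t)) has_integral J) {a..b}" by (auto simp: integrable_on_def)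
  have "(D 1 has_integral (g b - g a)) {a..b}"
    using D(2)[of _ 0] ab unfolding D(1)[symmetric] by (intro fundamental_theorem_of_calculus) auto
  then have "infnorm (g b - g a) \<le> J" by (rule infnorm_integral_le) (rule J)
  moreover have "((\<lambda>t. infnorm (torus_velocity \<gamma> t)) has_integral J) (cbox a b)"
  proof (rule has_integral_spike_interior)
    show "((\<lambda>t. infnorm (D 1 t)) has_integral J) (cbox a b)" using J by simp
    fix t assume t: "t \<in> box a b"
    then have "at t within {a..b} = at t" by (intro at_within_interior) auto
    then have "(g has_vector_derivative D 1 t) (at t)"
      using D(2)[of t 0] t by (auto simp: D(1))
    then have "has_torus_velocity \<gamma> (D 1 t) t"
      using t \<gamma> by (intro has_torus_velocity_projI[of a t b]) auto
    then show "infnorm (torus_velocity \<gamma> t) = infnorm (D 1 t)" by (simp add: torus_velocity_eq)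
  qed
  ultimately show ?thesis by auto
qed

lemma smooth_curve_continuous:
  assumes "smooth_curve a b g"
  shows "continuous_on {a..b} g"
proof -
  obtain D where D: "D 0 = g" "\<And>k t. t \<in> {a..b} \<Longrightarrow>
      (D k has_vector_derivative D (Suc k) t) (at t within {a..b})"
    using assms unfolding smooth_curve_def by blast
  have "continuous_on {a..b} (D 0)" unfolding continuous_on_eq_continuous_within
    by (intro ballI has_vector_derivative_continuous[OF D(2)])
  then show ?thesis by (simp add: D(1))
qed

text \<open>The plane pieces supplied by the definition need not fit together. Translating each next
  piece by a lattice vector gives a continuous lift, and the lengths and displacement bounds add
  up.\<close>

lemma piecewise_smooth_lift:
  fixes s :: "nat \<Rightarrow> real"
  assumes "\<forall>i<n. s i < s (Suc i) \<and>
     (\<exists>g. smooth_curve (s i) (s (Suc i)) g \<and> (\<forall>t\<in>{s i..s (Suc i)}. \<gamma> t = torus_proj (g t)))"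
  shows "s 0 \<le> s n \<and> (\<exists>c J. continuous_on {s 0..s n} c \<and> (\<forall>t\<in>{s 0..s n}. \<gamma> t = torus_proj (c t)) \<and>
     ((\<lambda>t. infnorm (torus_velocity \<gamma> t)) has_integral J) {s 0..s n} \<and> infnorm (c (s n) - c (s 0)) \<le> J)"
  using assms
proof (induction n)
  case 0
  obtain x where "torus_proj x = \<gamma> (s 0)" using surj_torus_proj by blast
  then show ?case by (auto simp: has_integral_refl infnorm_0 intro!: exI[of _ "\<lambda>_. x"] exI[of _ "0 :: real"])
next
  case (Suc n)
  obtain g where lt: "s n < s (Suc n)" and g: "smooth_curve (s n) (s (Suc n)) g"
    "\<forall>t\<in>{s n..s (Suc n)}. \<gamma> t = torus_proj (g t)" using Suc.prems by blast
  obtain J' where J': "((\<lambda>t. infnorm (torus_velocity \<gamma> t)) has_integral J') {s n..s (Suc n)}"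
     "infnorm (g (s (Suc n)) - g (s n)) \<le> J'" using piece_length[OF lt g] by blast
  note cg = smooth_curve_continuous[OF g(1)]
  obtain c J where le: "s 0 \<le> s n" and c: "continuous_on {s 0..s n} c"
    "\<forall>t\<in>{s 0..s n}. \<gamma> t = torus_proj (c t)"
    "((\<lambda>t. infnorm (torus_velocity \<gamma> t)) has_integral J) {s 0..s n}" "infnorm (c (s n) - c (s 0)) \<le> J"
    using Suc.IH Suc.prems by auto
  define w where "w = c (s n) - g (s n)"
  have "torus_proj (c (s n)) = torus_proj (g (s n))"
    using c(2) g(2) le lt by (metis atLeastAtMost_iff order_refl less_imp_le)
  then have w: "w \<in> int_lattice" by (simp add: torus_proj_lattice w_def)
  define c' where "c' t = (if t \<le> s n then c t else g t + w)" for t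
  have un: "{s 0..s n} \<union> {s n..s (Suc n)} = {s 0..s (Suc n)}" using le lt by auto
  have "continuous_on ({s 0..s n} \<union> {s n..s (Suc n)}) (\<lambda>t. if t \<le> s n then c t else g t + w)"
  proof (rule continuous_on_cases)
    show "\<forall>t. t \<in> {s 0..s n} \<and> \<not> t \<le> s n \<or> t \<in> {s n..s (Suc n)} \<and> t \<le> s n \<longrightarrow> c t = g t + w"
    proof (intro allI impI)
      fix t assume "t \<in> {s 0..s n} \<and> \<not> t \<le> s n \<or> t \<in> {s n..s (Suc n)} \<and> t \<le> s n"
      then have "t = s n" by auto
      then show "c t = g t + w" by (simp add: w_def)
    qed
  qed (use c cg in \<open>auto intro!: continuous_intros\<close>)
  then have "continuous_on {s 0..s (Suc n)} c'" by (simp add: c'_def[abs_def] un)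
  moreover have "\<gamma> t = torus_proj (c' t)" if "t \<in> {s 0..s (Suc n)}" for t
  proof (cases "t \<le> s n")
    case True then show ?thesis using that c(2) by (simp add: c'_def)
  next
    case False
    have "torus_proj (g t + w) = torus_proj (g t)" using w by (simp add: torus_proj_lattice)
    then show ?thesis using that False g(2) by (simp add: c'_def)
  qed
  moreover have "((\<lambda>t. infnorm (torus_velocity \<gamma> t)) has_integral (J + J')) {s 0..s (Suc n)}"
    by (rule has_integral_combine[OF le _ c(3) J'(1)]) (use lt in simp)
  moreover have "infnorm (c' (s (Suc n)) - c' (s 0)) \<le> J + J'"
  proof -
    have "c' (s (Suc n)) - c' (s 0) = (g (s (Suc n)) - g (s n)) + (c (s n) - c (s 0))"
      using le lt by (simp add: c'_def w_def)
    then show ?thesis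
      using infnorm_triangle[of "g (s (Suc n)) - g (s n)" "c (s n) - c (s 0)"] c(4) J'(2) by simp
  qed
  ultimately show ?case using le lt by (intro conjI exI[of _ c'] exI[of _ "J + J'"]) auto
qed

text \<open>A closed lift contracts linearly in the plane, and the projection carries the homotopy
  to the torus.\<close>

lemma contractible_if_lift_closed:
  assumes ab: "a < b" and c: "continuous_on {a..b} c" "\<forall>t\<in>{a..b}. \<gamma> t = torus_proj (c t)" "c b = c a"
  shows "contractible_curve a b \<gamma>"
proof -
  have lp: "linepath a b t \<in> {a..b}" if "t \<in> {0..1}" for t
    using linepath_in_path[OF that, of a b] ab by (simp add: closed_segment_eq_real_ivl)
  have path: "path (c \<circ> linepath a b)"
    unfolding path_def
    by (intro continuous_on_compose continuous_on_subset[OF c(1)] continuous_on_linepath) (use lp in auto)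
  have "homotopic_loops UNIV (c \<circ> linepath a b) (\<lambda>_. c a)"
  proof (rule homotopic_loops_linear[OF path])
    show "path (\<lambda>_. c a)" by (simp add: path_def)
  qed (use c(3) in \<open>auto simp: pathfinish_def pathstart_def linepath_def\<close>)
  then have h: "homotopic_loops UNIV (torus_proj \<circ> (c \<circ> linepath a b)) (torus_proj \<circ> (\<lambda>_. c a))"
    by (rule homotopic_loops_continuous_image[OF _ continuous_on_torus_proj]) auto
  have p: "path (torus_proj \<circ> (c \<circ> linepath a b))"
    using path unfolding path_def by (rule continuous_on_compose[OF _ continuous_on_torus_proj])
  have "homotopic_loops UNIV (torus_proj \<circ> (c \<circ> linepath a b)) (\<gamma> \<circ> linepath a b)"
    by (rule homotopic_loops_eq[OF p]) (use c lp in \<open>auto simp: pathfinish_def pathstart_def linepath_def\<close>)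
  then have "homotopic_loops UNIV (\<gamma> \<circ> linepath a b) (torus_proj \<circ> (\<lambda>_. c a))"
    using h homotopic_loops_sym homotopic_loops_trans by blast
  then show ?thesis unfolding contractible_curve_def by (auto simp: o_def)
qed

text \<open>The lift of a non-contractible loop ends at a different point of the same lattice orbit,
  so some coordinate of its displacement is a nonzero integer.\<close>

lemma systole_infnorm_ge: "1 \<le> systole (flat_metric infnorm)"
proof (rule systole_ge[OF finsler_metric_infnorm])
  fix a b \<gamma> assume cl: "closed_curve a b \<gamma>" and nc: "\<not> contractible_curve a b \<gamma>"
  then have ab: "a < b" "\<gamma> a = \<gamma> b" by (auto simp: closed_curve_def)
  obtain n s where s: "s 0 = a" "s n = b" and pieces: "\<forall>i<n. s i < s (Suc i) \<and>
     (\<exists>g. smooth_curve (s i) (s (Suc i)) g \<and> (\<forall>t\<in>{s i..s (Suc i)}. \<gamma> t = torus_proj (g t)))"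
    using cl unfolding closed_curve_def piecewise_smooth_torus_def by blast
  obtain c J where c: "continuous_on {a..b} c" "\<forall>t\<in>{a..b}. \<gamma> t = torus_proj (c t)"
    and J: "((\<lambda>t. infnorm (torus_velocity \<gamma> t)) has_integral J) {a..b}" "infnorm (c b - c a) \<le> J"
    using piecewise_smooth_lift[OF pieces] s by auto
  have "torus_proj (c b) = torus_proj (c a)" using c(2) ab by (metis atLeastAtMost_iff less_imp_le order_refl)
  then have z: "c b - c a \<in> int_lattice" by (simp add: torus_proj_lattice)
  have "c b \<noteq> c a" using nc contractible_if_lift_closed[OF ab(1) c] by blast
  then obtain i where "(c b - c a) $ i \<noteq> 0" by (auto simp: vec_eq_iff)
  moreover have "(c b - c a) $ i \<in> \<int>" using z by (simp add: int_lattice_def)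
  ultimately have "1 \<le> \<bar>(c b - c a) $ i\<bar>" by (intro Ints_nonzero_abs_ge1)
  also have "\<dots> \<le> infnorm (c b - c a)" by (rule component_le_infnorm_cart)
  also have "\<dots> \<le> J" by (rule J(2))
  also have "J = finsler_length (flat_metric infnorm) a b \<gamma>"
    using J(1) by (simp add: finsler_length_def flat_metric_def integral_unique)
  finally show "1 \<le> finsler_length (flat_metric infnorm) a b \<gamma>" .
qed

theorem theorem1p1:
  shows "(\<forall>F. finsler_metric F \<and> reversible F \<longrightarrow> area_BH F \<ge> pi / 4 * (systole F)\<^sup>2)
    \<and> (\<forall>C::real. (\<forall>F. finsler_metric F \<and> reversible F \<longrightarrow> area_BH F \<ge> C * (systole F)\<^sup>2)
           \<longrightarrow> C \<le> pi / 4)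
    \<and> finsler_metric (flat_metric infnorm) \<and> reversible (flat_metric infnorm)
    \<and> area_BH (flat_metric infnorm) = pi / 4 * (systole (flat_metric infnorm))\<^sup>2"
proof (intro conjI allI impI)
  have sys: "systole (flat_metric infnorm) = 1"
    using systole_infnorm_le systole_infnorm_ge by simp
  show "pi / 4 * (systole F)\<^sup>2 \<le> area_BH F" if "finsler_metric F \<and> reversible F" for F
    using that area_systole by blast
  show "C \<le> pi / 4" if "\<forall>F. finsler_metric F \<and> reversible F \<longrightarrow> C * (systole F)\<^sup>2 \<le> area_BH F" for C
    using that finsler_metric_infnorm reversible_infnorm area_BH_infnorm sys
    by (metis mult.right_neutral power_one)
  show "area_BH (flat_metric infnorm) = pi / 4 * (systole (flat_metric infnorm))\<^sup>2"
    by (simp add: area_BH_infnorm sys)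
qed (rule finsler_metric_infnorm reversible_infnorm)+

end
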